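(* Let $t \geq 2$ and let $(D,\mathcal R)$ be a $k$-CSP that is $t$-wise independent, and let $\rho$ be any distribution over $\mathcal R$. Then there is a constant $c_k>0$ depending only on $k$ such that, except with probability $o_n(1)$, a binomial $\rho$-random instance $\mathcal I$ of the CSP with $n$ variables and $\Delta n$ expected constraints (where $\Delta$ may depend on $n$) has an SoS solution of value $1$ and of degree at least $c_k\, n/(\Delta^{2/(t-1)} \log \Delta)$; that is, there is a pseudo-distribution $\mu$ of that degree with $\widetilde{\mathbb E}_\mu \mathrm{Val}_{\mathcal I}(x)=1$.
   Context: A $k$-CSP is a pair $(D,\mathcal R)$ with $D$ a finite domain and $\mathcal R$ a collection of $k$-ary relations $R\subseteq D^k$. An instance $\mathcal I=(V,\mathcal C)$ consists of a variable set $V$ and a multiset $\mathcal C$ of constraints $(\sigma,R)$ with $R\in\mathcal R$ and $\sigma:[k]\to V$ injective. For $x\in D^V$, $\mathrm{Val}_{\mathcal I}(x)=\Pr_{(\sigma,R)\sim\mathcal C}[x\circ\sigma\in R]$ (uniform over the multiset). Binomial $\rho$-random instance ($\rho$ a distribution over $\mathcal R$): on a set $V$ of $n$ variables, each $k$-subset $e\subseteq V$ is independently selected with probability $p$; for each selected $e$, independently choose a uniformly random bijection $\sigma:[k]\to e$ and $R\sim\rho$ and add the constraint $(\sigma,R)$. The expected number of constraints is $p\binom nk$. A distribution $\mu$ on $D^k$ is $t$-wise $\nu$-independent ($\nu$ a distribution on $D$) if for every $T\subseteq[k]$ with $|T|=t$ its marginal on $D^T$ equals the product distribution $\nu^T$.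 The CSP is $t$-wise independent if there is a distribution $\nu$ on $D$ and, for each $R\in\mathcal R$, a $t$-wise $\nu$-independent distribution $\mu^R$ with support contained in $R$. SoS (pseudo-distribution) conventions: use indeterminates $x_{v,a}$ ($v\in V$, $a\in D$) intended as indicators of $x_v=a$. A pseudo-distribution of degree $d$ is a linear functional $\widetilde{\mathbb E}_\mu$ on real polynomials of degree $\le d$ in these indeterminates with $\widetilde{\mathbb E}_\mu[1]=1$, $\widetilde{\mathbb E}_\mu[q^2]\ge 0$ whenever $\deg q\le d/2$, and $\widetilde{\mathbb E}_\mu[h q]=0$ for every $h$ in $\{\sum_{a\in D}x_{v,a}^2-1\}_{v\in V}\cup\{x_{v,a}x_{v,a'}\}_{v\in V,a\ne a'}$ and every $q$ with $\deg(hq)\le d$. The objective is the polynomial $\mathrm{Val}_{\mathcal I}(x)=\frac1{|\mathcal C|}\sum_{(\sigma,R)\in\mathcal C}\sum_{b\in R}\prod_{i=1}^k x_{\sigma(i),b_i}$, and the value of $\mu$ is $\widetilde{\mathbb E}_\mu\mathrm{Val}_{\mathcal I}(x)$.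
   Formalization: Proved for t ≤ k, Δ ≥ 2 for all large n (claim fails as Δ → 1, e.g. 3-XOR with Δ = 1+1/n) and Δn at most binom(n,k), with D a finite set of naturals; where the stated degree is below k, Val lies outside the functional's domain and its value is unconstrained. *)

theory Defs
  imports "HOL-Probability.Probability" "HOL-Library.Poly_Mapping"
begin

section \<open>Constraint satisfaction problems\<close>

text \<open>
  The index set \<open>[k]\<close> is \<open>{1..k}\<close>; tuples in \<open>D\<^sup>k\<close> and maps \<open>[k] \<rightarrow> V\<close> are extensional
  functions on it (undefined outside \<open>{1..k}\<close>).
\<close>

definition is_csp :: "nat \<Rightarrow> 'd set \<Rightarrow> (nat \<Rightarrow> 'd) set set \<Rightarrow> bool" where
  "is_csp k D Rs \<longleftrightarrow> finite D \<and> (\<forall>R\<in>Rs. R \<subseteq> {1..k} \<rightarrow>\<^sub>E D)"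

type_synonym ('v, 'd) csp_constraint = "(nat \<Rightarrow> 'v) \<times> (nat \<Rightarrow> 'd) set"

type_synonym ('v, 'd) csp_instance = "'v set \<times> ('v, 'd) csp_constraint multiset"

definition twise_independent ::
    "nat \<Rightarrow> nat \<Rightarrow> 'd pmf \<Rightarrow> (nat \<Rightarrow> 'd) pmf \<Rightarrow> bool" where
  "twise_independent t k \<nu> \<mu> \<longleftrightarrow>
     (\<forall>T. T \<subseteq> {1..k} \<and> card T = t \<longrightarrow>
        map_pmf (\<lambda>b. restrict b T) \<mu> = Pi_pmf T undefined (\<lambda>_. \<nu>))"

definition twise_independent_csp ::
    "nat \<Rightarrow> nat \<Rightarrow> 'd set \<Rightarrow> (nat \<Rightarrow> 'd) set set \<Rightarrow> bool" where
  "twise_independent_csp t k D Rs \<longleftrightarrow>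
     (\<exists>\<nu>. set_pmf \<nu> \<subseteq> D \<and>
        (\<forall>R\<in>Rs. \<exists>\<mu>. set_pmf \<mu> \<subseteq> R \<and> twise_independent t k \<nu> \<mu>))"


section \<open>Binomial random instances\<close>

definition random_constraint ::
    "nat \<Rightarrow> (nat \<Rightarrow> 'd) set pmf \<Rightarrow> 'v set \<Rightarrow> ('v, 'd) csp_constraint pmf" where
  "random_constraint k \<rho> e =
     pair_pmf (pmf_of_set {\<sigma> \<in> {1..k} \<rightarrow>\<^sub>E e. bij_betw \<sigma> {1..k} e}) \<rho>"

text \<open>
  Independently for every \<open>k\<close>-subset \<open>e\<close> of \<open>V\<close>, the value at \<open>e\<close> is \<open>None\<close> if \<open>e\<close> is not
  selected, and otherwise the constraint placed on \<open>e\<close>.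
\<close>

definition random_instance ::
    "nat \<Rightarrow> (nat \<Rightarrow> 'd) set pmf \<Rightarrow> real \<Rightarrow> 'v set \<Rightarrow> ('v, 'd) csp_instance pmf" where
  "random_instance k \<rho> p V =
     map_pmf
       (\<lambda>f. (V, image_mset (\<lambda>e. the (f e)) (mset_set {e. e \<subseteq> V \<and> card e = k \<and> f e \<noteq> None})))
       (Pi_pmf {e. e \<subseteq> V \<and> card e = k} None
         (\<lambda>e. bind_pmf (bernoulli_pmf p)
            (\<lambda>selected. if selected then map_pmf Some (random_constraint k \<rho> e)
                        else return_pmf None)))"


section \<open>Pseudo-distributions\<close>

type_synonym 'x mpoly = "('x \<Rightarrow>\<^sub>0 nat) \<Rightarrow>\<^sub>0 real"

definition mconst :: "real \<Rightarrow> 'x mpoly" where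
  "mconst a = Poly_Mapping.single 0 a"

definition mvar :: "'x \<Rightarrow> 'x mpoly" where
  "mvar x = Poly_Mapping.single (Poly_Mapping.single x 1) 1"

definition mvars :: "'x mpoly \<Rightarrow> 'x set" where
  "mvars p = (\<Union>m\<in>Poly_Mapping.keys p. Poly_Mapping.keys m)"

definition mdeg :: "'x mpoly \<Rightarrow> nat" where
  "mdeg p = Max (insert 0
     ((\<lambda>m. \<Sum>x\<in>Poly_Mapping.keys m. Poly_Mapping.lookup m x) ` Poly_Mapping.keys p))"

definition assignment_axioms :: "'v set \<Rightarrow> 'd set \<Rightarrow> ('v \<times> 'd) mpoly set" where
  "assignment_axioms V D =
     {(\<Sum>a\<in>D. (mvar (v, a))\<^sup>2) - 1 | v. v \<in> V} \<union>
     {mvar (v, a) * mvar (v, a') | v a a'. v \<in> V \<and> a \<in> D \<and> a' \<in> D \<and> a \<noteq> a'}"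

text \<open>
  A functional on the polynomials of degree at most \<open>d\<close> is modelled by a total function whose
  values on all other polynomials are irrelevant.
\<close>

definition pseudo_distribution ::
    "'v set \<Rightarrow> 'd set \<Rightarrow> nat \<Rightarrow> (('v \<times> 'd) mpoly \<Rightarrow> real) \<Rightarrow> bool" where
  "pseudo_distribution V D d E \<longleftrightarrow>
     (\<forall>p q. mvars p \<subseteq> V \<times> D \<and> mdeg p \<le> d \<and> mvars q \<subseteq> V \<times> D \<and> mdeg q \<le> d \<longrightarrow>
        E (p + q) = E p + E q) \<and>
     (\<forall>a p. mvars p \<subseteq> V \<times> D \<and> mdeg p \<le> d \<longrightarrow> E (mconst a * p) = a * E p) \<and>
     E 1 = 1 \<and>
     (\<forall>q. mvars q \<subseteq> V \<times> D \<and> 2 * mdeg q \<le> d \<longrightarrow> E (q\<^sup>2) \<ge> 0) \<and>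
     (\<forall>h\<in>assignment_axioms V D. \<forall>q. mvars q \<subseteq> V \<times> D \<and> mdeg (h * q) \<le> d \<longrightarrow>
        E (h * q) = 0)"

definition val_poly :: "nat \<Rightarrow> ('v, 'd) csp_instance \<Rightarrow> ('v \<times> 'd) mpoly" where
  "val_poly k I =
     mconst (1 / real (size (snd I))) *
     (\<Sum>(\<sigma>, R)\<in>#snd I. \<Sum>b\<in>R. \<Prod>i=1..k. mvar (\<sigma> i, b i))"

end

theory Submission
  imports Defs "HOL-Real_Asymp.Real_Asymp"
begin

text \<open>
  Let \<open>w\<^sub>f\<close> be the density of \<open>\<mu>\<^sub>f\<close> relative to \<open>\<nu>\<^sup>k\<close>.  The pseudo-expectation of a function of
  few variables is its \<open>\<nu>\<close>-average weighted by \<open>\<Prod>w\<^sub>f\<close> over the constraints \<open>f\<close> inside a closed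
  set \<open>Z\<close> containing these variables.  Closedness is measured by the submodular potential
  \<open>\<phi>(X) = 2|X| - \<Sum>\<^sub>e max(0, 2|e \<inter> X| - t - 1)\<close>: a set is closed if every larger small set has
  strictly larger potential.  By \<open>t\<close>-wise independence, averaging out the other variables removes
  every constraint outside \<open>Z\<close>, since any surviving configuration could be added to \<open>Z\<close> without
  raising \<open>\<phi>\<close>; hence the choice of \<open>Z\<close> does not matter.

  For positivity, let \<open>S \<noteq> T\<close> be closed with \<open>\<phi>(T) \<le> \<phi>(S)\<close>, and let \<open>g\<close> depend on \<open>S\<close> and be
  orthogonal to the functions on closed proper subsets of \<open>S\<close>.  The same counting shows that \<open>S\<close>
  and \<open>T\<close> are separated by a subset of \<open>S\<close> or of \<open>T\<close> of smaller potential than the set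
  containing it, so \<open>g\<close> is orthogonal to all functions on \<open>T\<close> by induction.  The pseudo-expectation
  is thus a sum of local, genuinely positive forms.

  In a random instance \<open>\<phi>(X) \<ge> 2\<delta>|X|\<close> holds for all \<open>X\<close> of size up to order
  \<open>n / \<Delta>\<^bsup>2/(t-1)\<^esup>\<close> with \<open>\<delta>\<close> of order \<open>1 / ln \<Delta>\<close>, by an exponential moment bound for each \<open>X\<close>
  and a union bound.  This keeps closed sets small up to the claimed degree.
\<close>

section \<open>Averaging over independent coordinates\<close>

text \<open>Positivity is the obstacle: each pair of monomials is evaluated in its own closed set,
  and the weights used there need not come from one distribution on all of V. Hence a Gram-Schmidt
  process along inclusion of closed sets, after which only terms on a common set remain. The numbers
  in the potential are dictated by peeling: a surviving edge keeps j > t variables and lowers the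
  potential by 2j - (t+1) \<ge> j, while a new variable raises it by 2 and is covered at least
  twice. The threshold (t+1)/2 also explains the exponent: up to constants, \<Delta> n
  (|X|/n)^((t+1)/2) edges meet X that heavily, which is at most |X| when |X| \<le> n /
  \<Delta>^(2/(t-1)). The logarithm comes from the union bound: with y = n/|X|, choosing X costs
  about ln y per variable, a fraction \<delta> of this is not repaid, and \<delta> ln \<Delta> has
  to stay bounded. If the target degree is at most 1, the instance may be too dense for this
  argument, and a separate functional of degree 1 is used.\<close>

definition depends_only :: "(('v \<Rightarrow> 'd) \<Rightarrow> real) \<Rightarrow> 'v set \<Rightarrow> bool" where
  "depends_only g X \<longleftrightarrow> (\<forall>x y. (\<forall>v\<in>X. x v = y v) \<longrightarrow> g x = g y)"

lemma depends_onlyD: "depends_only g X \<Longrightarrow> (\<And>v. v \<in> X \<Longrightarrow> x v = y v) \<Longrightarrow> g x = g y"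
  unfolding depends_only_def by blast

lemma depends_only_mono: "depends_only g X \<Longrightarrow> X \<subseteq> Y \<Longrightarrow> depends_only g Y"
  unfolding depends_only_def by blast

lemma depends_only_const [simp]: "depends_only (\<lambda>_. c) X"
  unfolding depends_only_def by blast

lemma depends_only_mult:
  "depends_only g X \<Longrightarrow> depends_only h X \<Longrightarrow> depends_only (\<lambda>x. g x * h x) X"
  unfolding depends_only_def by metis

lemma depends_only_divide:
  "depends_only g X \<Longrightarrow> depends_only h X \<Longrightarrow> depends_only (\<lambda>x. g x / h x) X"
  unfolding depends_only_def by metis

lemma depends_only_diff:
  "depends_only g X \<Longrightarrow> depends_only h X \<Longrightarrow> depends_only (\<lambda>x. g x - h x) X"
  unfolding depends_only_def by metis

lemma depends_only_prod:
  "(\<And>i. i \<in> I \<Longrightarrow> depends_only (g i) X) \<Longrightarrow> depends_only (\<lambda>x. \<Prod>i\<in>I. g i x) X"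
  unfolding depends_only_def by (intro allI impI prod.cong) auto

lemma depends_only_sum:
  "(\<And>i. i \<in> I \<Longrightarrow> depends_only (g i) X) \<Longrightarrow> depends_only (\<lambda>x. \<Sum>i\<in>I. g i x) X"
  unfolding depends_only_def by (intro allI impI sum.cong) auto

lemma depends_only_upd: "depends_only g X \<Longrightarrow> v \<notin> X \<Longrightarrow> g (x(v := a)) = g x"
  by (rule depends_onlyD) auto

locale averaging =
  fixes \<nu> :: "'d \<Rightarrow> real" and D :: "'d set"
  assumes finite_D: "finite D"
    and nu_pos: "a \<in> D \<Longrightarrow> \<nu> a > 0"
    and nu_sum: "(\<Sum>a\<in>D. \<nu> a) = 1"
begin

text \<open>Averaging overwrites a coordinate instead of shrinking the domain, so partial averages
  remain functions of full assignments and can be multiplied and compared directly.\<close>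

definition avg :: "'v \<Rightarrow> (('v \<Rightarrow> 'd) \<Rightarrow> real) \<Rightarrow> ('v \<Rightarrow> 'd) \<Rightarrow> real" where
  "avg v g = (\<lambda>x. \<Sum>a\<in>D. \<nu> a * g (x(v := a)))"

lemma avg_commute: "avg u (avg v g) = avg v (avg u g)"
proof (cases "u = v")
  case False
  show ?thesis
  proof
    fix x
    have "avg u (avg v g) x = (\<Sum>a\<in>D. \<Sum>b\<in>D. \<nu> a * (\<nu> b * g (x(u := a, v := b))))"
      by (simp add: avg_def sum_distrib_left)
    also have "\<dots> = (\<Sum>b\<in>D. \<Sum>a\<in>D. \<nu> a * (\<nu> b * g (x(u := a, v := b))))"
      by (rule sum.swap)
    also have "\<dots> = avg v (avg u g) x"
      using False by (simp add: avg_def sum_distrib_left fun_upd_twist mult.left_commute)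
    finally show "avg u (avg v g) x = avg v (avg u g) x" .
  qed
qed simp

sublocale avg_fold: comp_fun_commute avg
  by standard (simp add: fun_eq_iff avg_commute)

definition av :: "'v set \<Rightarrow> (('v \<Rightarrow> 'd) \<Rightarrow> real) \<Rightarrow> ('v \<Rightarrow> 'd) \<Rightarrow> real" where
  "av M g = Finite_Set.fold avg g M"

lemma av_empty [simp]: "av {} g = g"
  by (simp add: av_def)

lemma av_insert: "finite M \<Longrightarrow> v \<notin> M \<Longrightarrow> av (insert v M) g = avg v (av M g)"
  by (simp add: av_def avg_fold.fold_insert)

lemma av_union: "finite M \<Longrightarrow> finite M' \<Longrightarrow> M \<inter> M' = {} \<Longrightarrow> av (M \<union> M') g = av M (av M' g)"
  by (induction M rule: finite_induct) (auto simp: av_insert)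

lemma avg_depends: "depends_only g X \<Longrightarrow> depends_only (avg v g) (X - {v})"
  unfolding avg_def
  by (subst depends_only_def, intro allI impI sum.cong refl arg_cong2[where f="(*)"])
     (auto elim!: depends_onlyD)

lemma av_depends: "finite M \<Longrightarrow> depends_only g X \<Longrightarrow> depends_only (av M g) (X - M)"
proof (induction M rule: finite_induct)
  case (insert v M)
  have "depends_only (avg v (av M g)) (X - M - {v})"
    using insert by (intro avg_depends) auto
  moreover have "X - M - {v} = X - insert v M" by auto
  ultimately show ?case using insert by (simp add: av_insert)
qed simp

lemma avg_mult: "depends_only g X \<Longrightarrow> v \<notin> X \<Longrightarrow> avg v (\<lambda>x. g x * h x) = (\<lambda>x. g x * avg v h x)"
  by (simp add: avg_def depends_only_upd sum_distrib_left mult.left_commute)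

lemma av_mult:
  "finite M \<Longrightarrow> depends_only g X \<Longrightarrow> X \<inter> M = {} \<Longrightarrow> av M (\<lambda>x. g x * h x) = (\<lambda>x. g x * av M h x)"
  by (induction M rule: finite_induct) (auto simp: av_insert avg_mult)

lemma av_one: "finite M \<Longrightarrow> av M (\<lambda>_. 1) = (\<lambda>_. 1)"
  by (induction M rule: finite_induct) (auto simp: av_insert avg_def nu_sum)

lemma av_linear:
  "finite M \<Longrightarrow> av M (\<lambda>x. a * g x + b * h x) = (\<lambda>x. a * av M g x + b * av M h x)"
proof (induction M rule: finite_induct)
  case (insert v M)
  then show ?case
    by (simp add: av_insert avg_def sum_distrib_left distrib_left sum.distrib mult.left_commute)
qed simp

lemma av_nonneg: "finite M \<Longrightarrow> (\<And>x. g x \<ge> 0) \<Longrightarrow> av M g x \<ge> 0"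
  by (induction M arbitrary: x rule: finite_induct)
     (auto simp: av_insert avg_def less_imp_le nu_pos intro!: sum_nonneg mult_nonneg_nonneg)

text \<open>An average of nonnegative values with positive weights vanishes only if all of them do.
  This lets a conditional expectation be written as a quotient even where the conditioning weight
  has mass 0.\<close>

lemma av_mult_eq_0:
  assumes "finite M" "\<And>x. w x \<ge> 0" "av M w x = 0"
  shows "av M (\<lambda>x. h x * w x) x = 0"
  using assms(1,3)
proof (induction M arbitrary: x rule: finite_induct)
  case (insert v M)
  have "(\<Sum>a\<in>D. \<nu> a * av M w (x(v := a))) = 0"
    using insert by (simp add: av_insert avg_def)
  then have "\<forall>a\<in>D. \<nu> a * av M w (x(v := a)) = 0"
    using insert(1) assms(2) nu_pos
    by (subst (asm) sum_nonneg_eq_0_iff)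
       (auto simp: finite_D less_imp_le intro!: mult_nonneg_nonneg av_nonneg)
  then have "\<forall>a\<in>D. av M w (x(v := a)) = 0"
    using nu_pos by fastforce
  then have "\<forall>a\<in>D. av M (\<lambda>x. h x * w x) (x(v := a)) = 0"
    using insert.IH by blast
  then show ?case
    using insert.hyps by (simp add: av_insert avg_def)
qed simp

lemma av_cong:
  assumes "finite M" "\<And>y. (\<And>v. v \<in> M \<Longrightarrow> y v \<in> D) \<Longrightarrow> (\<And>v. v \<notin> M \<Longrightarrow> y v = x v) \<Longrightarrow> g y = h y"
  shows "av M g x = av M h x"
  using assms
proof (induction M arbitrary: x rule: finite_induct)
  case empty
  then show ?case by simp
next
  case (insert v M)
  have "av M g (x(v := a)) = av M h (x(v := a))" if "a \<in> D" for a
  proof (rule insert.IH)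
    fix y assume *: "\<And>u. u \<in> M \<Longrightarrow> y u \<in> D" "\<And>u. u \<notin> M \<Longrightarrow> y u = (x(v := a)) u"
    show "g y = h y"
      by (rule insert.prems) (use * that insert.hyps in auto)
  qed
  then show ?case
    using insert.hyps by (simp add: av_insert avg_def)
qed

end

text \<open>
  The bilinear form may be degenerate, so orthogonal projections exist but need not be unique.
\<close>

lemma projection_exists:
  fixes l :: "('x \<Rightarrow> real) \<Rightarrow> real" and b :: "'i \<Rightarrow> 'x \<Rightarrow> real"
  assumes lin: "\<And>a f c g. l (\<lambda>x. a * f x + c * g x) = a * l f + c * l g"
    and psd: "\<And>f. l (\<lambda>x. f x * f x) \<ge> 0"
    and "finite I"
  shows "\<exists>c. \<forall>i\<in>I. l (\<lambda>x. (g x - (\<Sum>j\<in>I. c j * b j x)) * b i x) = 0"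
  using assms(3)
proof (induction I arbitrary: g rule: finite_induct)
  case (insert k I)
  \<comment> \<open>A null vector is orthogonal to everything: since h is null, the value of l at
    the square of f + s h is affine in s, and the chosen s makes it -1.\<close>
  have cs: "l (\<lambda>x. f x * h x) = 0" if "l (\<lambda>x. h x * h x) = 0" for f h
  proof (rule ccontr)
    assume ne: "l (\<lambda>x. f x * h x) \<noteq> 0"
    define s where "s = - (l (\<lambda>x. f x * f x) + 1) / (2 * l (\<lambda>x. f x * h x))"
    have "l (\<lambda>x. (f x + s * h x) * (f x + s * h x)) =
        l (\<lambda>x. 1 * (1 * (f x * f x) + (2 * s) * (f x * h x)) + (s * s) * (h x * h x))"
      by (rule arg_cong[where f = l]) (auto simp: algebra_simps)
    also have "\<dots> = l (\<lambda>x. f x * f x) + 2 * s * l (\<lambda>x. f x * h x)"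
      unfolding lin using that by simp
    also have "\<dots> = - 1"
      using ne by (simp add: s_def field_simps)
    finally show False
      using psd[of "\<lambda>x. f x + s * h x"] by simp
  qed
  obtain c where c: "\<forall>i\<in>I. l (\<lambda>x. (g x - (\<Sum>j\<in>I. c j * b j x)) * b i x) = 0"
    using insert.IH by blast
  \<comment> \<open>The induction hypothesis is general in g and applies to the new vector
    \<open>b k\<close> as well; one Gram-Schmidt step along b' then remains.\<close>
  obtain e where e: "\<forall>i\<in>I. l (\<lambda>x. (b k x - (\<Sum>j\<in>I. e j * b j x)) * b i x) = 0"
    using insert.IH by blast
  define g' where "g' = (\<lambda>x. g x - (\<Sum>j\<in>I. c j * b j x))"
  define b' where "b' = (\<lambda>x. b k x - (\<Sum>j\<in>I. e j * b j x))"
  \<comment> \<open>If b' is null, s is 0 by x / 0 = 0, and by \<open>cs\<close> there is nothing to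
    subtract.\<close>
  define s where "s = l (\<lambda>x. g' x * b' x) / l (\<lambda>x. b' x * b' x)"
  define r where "r = (\<lambda>x. 1 * g' x + (- s) * b' x)"
  have lsum: "l (\<lambda>x. \<Sum>j\<in>J. f j x) = (\<Sum>j\<in>J. l (f j))" if "finite J" for J and f :: "'i \<Rightarrow> 'x \<Rightarrow> real"
    using that
  proof (induction J rule: finite_induct)
    case empty
    show ?case using lin[of 0 "\<lambda>_. 0" 0 "\<lambda>_. 0"] by simp
  next
    case (insert j J)
    then show ?case using lin[of 1 "f j" 1 "\<lambda>x. \<Sum>j\<in>J. f j x"] by simp
  qed
  have rI: "l (\<lambda>x. r x * b i x) = 0" if "i \<in> I" for i
  proof -
    have "l (\<lambda>x. r x * b i x) = l (\<lambda>x. 1 * (g' x * b i x) + (- s) * (b' x * b i x))"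
      by (rule arg_cong[where f = l]) (auto simp: r_def algebra_simps)
    also have "\<dots> = 0"
      unfolding lin using c e that by (simp add: g'_def b'_def)
    finally show ?thesis .
  qed
  have rb': "l (\<lambda>x. r x * b' x) = 0"
  proof -
    have "l (\<lambda>x. r x * b' x) = l (\<lambda>x. 1 * (g' x * b' x) + (- s) * (b' x * b' x))"
      by (rule arg_cong[where f = l]) (auto simp: r_def algebra_simps)
    also have "\<dots> = l (\<lambda>x. g' x * b' x) - s * l (\<lambda>x. b' x * b' x)"
      unfolding lin by simp
    also have "\<dots> = 0"
      using cs[of b' g'] by (cases "l (\<lambda>x. b' x * b' x) = 0") (auto simp: s_def)
    finally show ?thesis .
  qed
  have "l (\<lambda>x. r x * b k x) = l (\<lambda>x. 1 * (r x * b' x) + 1 * (\<Sum>j\<in>I. e j * (r x * b j x)))"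
    by (rule arg_cong[where f = l]) (auto simp: b'_def algebra_simps sum_distrib_left)
  also have "\<dots> = (\<Sum>j\<in>I. l (\<lambda>x. e j * (r x * b j x)))"
    unfolding lin using rb' insert.hyps by (simp add: lsum)
  also have "\<dots> = 0"
  proof (rule sum.neutral, rule ballI)
    fix j assume "j \<in> I"
    show "l (\<lambda>x. e j * (r x * b j x)) = 0"
      using lin[of "e j" "\<lambda>x. r x * b j x" 0 "\<lambda>_. 0"] rI[OF \<open>j \<in> I\<close>] by simp
  qed
  finally have rk: "l (\<lambda>x. r x * b k x) = 0" .
  define c' where "c' = (\<lambda>j. if j = k then s else c j - s * e j)"
  have "r x = g x - (\<Sum>j\<in>insert k I. c' j * b j x)" for x
  proof -
    have "(\<Sum>j\<in>insert k I. c' j * b j x) = s * b k x + (\<Sum>j\<in>I. c' j * b j x)"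
      using insert.hyps by (simp add: c'_def)
    also have "(\<Sum>j\<in>I. c' j * b j x) = (\<Sum>j\<in>I. (c j - s * e j) * b j x)"
      using insert.hyps by (intro sum.cong) (auto simp: c'_def)
    finally show ?thesis
      by (simp add: r_def g'_def b'_def algebra_simps sum_subtractf sum_distrib_left sum_negf)
  qed
  then have "r = (\<lambda>x. g x - (\<Sum>j\<in>insert k I. c' j * b j x))" by auto
  then have "\<forall>i\<in>insert k I. l (\<lambda>x. (g x - (\<Sum>j\<in>insert k I. c' j * b j x)) * b i x) = 0"
    using rI rk by (auto simp: fun_eq_iff)
  then show ?case by (intro exI[of _ c'])
qed auto

section \<open>Potential and peeling\<close>

text \<open>Doubled, so that the threshold (t + 1) / 2 causes no fractions for even t.\<close>

definition excess :: "nat \<Rightarrow> 'v set \<Rightarrow> 'v set \<Rightarrow> int" where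
  "excess t e X = max 0 (2 * int (card (e \<inter> X)) - (int t + 1))"

definition potential :: "nat \<Rightarrow> 'v set set \<Rightarrow> 'v set \<Rightarrow> int" where
  "potential t C X = 2 * int (card X) - (\<Sum>e\<in>C. excess t e X)"

lemma excess_nonneg [simp]: "excess t e X \<ge> 0"
  by (simp add: excess_def)

lemma excess_mono:
  assumes "finite e" "X \<subseteq> Y"
  shows "excess t e X \<le> excess t e Y"
proof -
  have "card (e \<inter> X) \<le> card (e \<inter> Y)" using assms by (intro card_mono) auto
  then show ?thesis by (simp add: excess_def)
qed

text \<open>\<open>excess\<close> is a convex function of the modular function
  \<open>card (e \<inter> X)\<close>: the sizes for X and Y lie between those for the intersection
  and the union and have the same sum.\<close>

lemma excess_supermodular:
  assumes "finite e"
  shows "excess t e X + excess t e Y \<le> excess t e (X \<union> Y) + excess t e (X \<inter> Y)"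
proof -
  have 1: "card (e \<inter> X) + card (e \<inter> Y) = card (e \<inter> (X \<union> Y)) + card (e \<inter> (X \<inter> Y))"
    using card_Un_Int[of "e \<inter> X" "e \<inter> Y"] assms
    by (simp add: Int_Un_distrib Int_assoc Int_left_commute)
  have 2: "card (e \<inter> (X \<inter> Y)) \<le> card (e \<inter> X)" "card (e \<inter> (X \<inter> Y)) \<le> card (e \<inter> Y)"
    using assms by (auto intro!: card_mono)
  have "max 0 (2 * p - s) + max 0 (2 * q - s) \<le> max 0 (2 * u - s) + max 0 (2 * i - s)"
    if "p + q = u + i" "i \<le> p" "i \<le> q" for p q u i s :: int
    using that by (auto simp: max_def)
  from this[of "int (card (e \<inter> X))" "int (card (e \<inter> Y))" "int (card (e \<inter> (X \<union> Y)))"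
      "int (card (e \<inter> (X \<inter> Y)))"]
  show ?thesis
    using 1 2 unfolding excess_def by linarith
qed

lemma potential_submodular:
  assumes "finite X" "finite Y" "\<And>e. e \<in> C \<Longrightarrow> finite e"
  shows "potential t C (X \<union> Y) + potential t C (X \<inter> Y) \<le> potential t C X + potential t C Y"
proof -
  have "(\<Sum>e\<in>C. excess t e X + excess t e Y) \<le> (\<Sum>e\<in>C. excess t e (X \<union> Y) + excess t e (X \<inter> Y))"
    using assms by (intro sum_mono excess_supermodular) auto
  then show ?thesis
    using card_Un_Int[OF assms(1,2)] by (simp add: potential_def sum.distrib)
qed

text \<open>Double counting of incidences between variables and the sets \<open>n f\<close>: a
  variable outside Y is counted at least twice, one in Y at least once. A set of size j > t
  satisfies j \<le> 2j - (t+1), so the excess pays 2 for each new variable and 1 for each variable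
  of Y that is touched.\<close>

lemma cover_twice_count:
  assumes "finite A" and "\<And>f. f \<in> A \<Longrightarrow> finite (n f) \<and> t < card (n f)"
    and twice: "\<And>f v. f \<in> A \<Longrightarrow> v \<in> n f \<Longrightarrow> v \<notin> Y \<Longrightarrow> \<exists>f'\<in>A. f' \<noteq> f \<and> v \<in> n f'"
  shows "2 * int (card ((\<Union>f\<in>A. n f) - Y)) + int (card ((\<Union>f\<in>A. n f) \<inter> Y))
    \<le> (\<Sum>f\<in>A. 2 * int (card (n f)) - (int t + 1))"
proof -
  let ?N = "\<Union>f\<in>A. n f"
  have fin: "finite ?N" using assms by auto
  have "(\<Sum>f\<in>A. card (n f)) = (\<Sum>f\<in>A. \<Sum>v\<in>?N. if v \<in> n f then 1 else 0)"
  proof (rule sum.cong)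
    fix f assume "f \<in> A"
    then have "?N \<inter> {v. v \<in> n f} = n f" by auto
    then show "card (n f) = (\<Sum>v\<in>?N. if v \<in> n f then 1 else 0)"
      using fin by (simp add: sum.If_cases)
  qed simp
  also have "\<dots> = (\<Sum>v\<in>?N. \<Sum>f\<in>A. if v \<in> n f then 1 else 0)"
    by (rule sum.swap)
  also have "\<dots> = (\<Sum>v\<in>?N. card {f\<in>A. v \<in> n f})"
    using assms(1) by (intro sum.cong) (auto simp: sum.If_cases Int_def)
  also have "\<dots> = (\<Sum>v\<in>?N - Y. card {f\<in>A. v \<in> n f}) + (\<Sum>v\<in>?N \<inter> Y. card {f\<in>A. v \<in> n f})"
    using fin by (subst sum.union_disjoint[symmetric]) (auto intro!: sum.cong)
  also have "\<dots> \<ge> (\<Sum>v\<in>?N - Y. 2) + (\<Sum>v\<in>?N \<inter> Y. 1)"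
  proof (intro add_mono sum_mono)
    fix v assume "v \<in> ?N - Y"
    then obtain f where f: "f \<in> A" "v \<in> n f" "v \<notin> Y" by auto
    then obtain f' where f': "f' \<in> A" "f' \<noteq> f" "v \<in> n f'" using twice by blast
    have "card {f, f'} \<le> card {f\<in>A. v \<in> n f}"
      using f f' assms(1) by (intro card_mono) auto
    then show "2 \<le> card {f\<in>A. v \<in> n f}" using f' by simp
  next
    fix v assume "v \<in> ?N \<inter> Y"
    then have "{f\<in>A. v \<in> n f} \<noteq> {}" by auto
    then show "1 \<le> card {f\<in>A. v \<in> n f}"
      using assms(1) by (simp add: Suc_le_eq card_gt_0_iff)
  qed
  finally have "2 * card (?N - Y) + card (?N \<inter> Y) \<le> (\<Sum>f\<in>A. card (n f))" by simp
  then have "2 * int (card (?N - Y)) + int (card (?N \<inter> Y)) \<le> (\<Sum>f\<in>A. int (card (n f)))"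
    by (metis (mono_tags) of_nat_add of_nat_le_iff of_nat_mult of_nat_numeral of_nat_sum)
  also have "\<dots> \<le> (\<Sum>f\<in>A. 2 * int (card (n f)) - (int t + 1))"
  proof (rule sum_mono)
    fix f assume "f \<in> A"
    then have "t < card (n f)" using assms(2) by blast
    then show "int (card (n f)) \<le> 2 * int (card (n f)) - (int t + 1)" by linarith
  qed
  finally show ?thesis .
qed

text \<open>\<open>w e\<close> stands for the density of a constraint distribution relative to the
  product measure, and \<open>w_av\<close> is t-wise independence: its marginal density on at most t
  variables is 1. Edges can index the weights because an instance has at most one constraint on each
  set of variables.\<close>

locale csp_weights = averaging \<nu> D for \<nu> :: "'d \<Rightarrow> real" and D +
  fixes V :: "'v set" and C :: "'v set set" and w :: "'v set \<Rightarrow> ('v \<Rightarrow> 'd) \<Rightarrow> real" and t :: nat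
  assumes finite_V: "finite V"
    and C_sub: "e \<in> C \<Longrightarrow> e \<subseteq> V"
    and C_ne: "e \<in> C \<Longrightarrow> e \<noteq> {}"
    and w_nonneg: "e \<in> C \<Longrightarrow> w e x \<ge> 0"
    and w_depends: "e \<in> C \<Longrightarrow> depends_only (w e) e"
    and w_av: "e \<in> C \<Longrightarrow> M \<subseteq> e \<Longrightarrow> card M \<le> t \<Longrightarrow> av (e - M) (w e) = (\<lambda>_. 1)"
begin

abbreviation phi :: "'v set \<Rightarrow> int" where "phi \<equiv> potential t C"

text \<open>The base point only fills the coordinates outside V.\<close>

definition Ex :: "(('v \<Rightarrow> 'd) \<Rightarrow> real) \<Rightarrow> real" where
  "Ex g = av V g (\<lambda>_. undefined)"

definition weight :: "'v set set \<Rightarrow> ('v \<Rightarrow> 'd) \<Rightarrow> real" where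
  "weight A x = (\<Prod>e\<in>A. w e x)"

definition inside :: "'v set \<Rightarrow> 'v set set" where
  "inside Z = {e\<in>C. e \<subseteq> Z}"

definition local_ex :: "'v set \<Rightarrow> (('v \<Rightarrow> 'd) \<Rightarrow> real) \<Rightarrow> real" where
  "local_ex Z p = Ex (\<lambda>x. p x * weight (inside Z) x)"

lemma finite_sub: "X \<subseteq> V \<Longrightarrow> finite X"
  using finite_V finite_subset by blast

lemma finite_C: "finite C"
  using C_sub finite_V by (intro finite_subset[of C "Pow V"]) auto

lemma finite_edge: "e \<in> C \<Longrightarrow> finite e"
  using C_sub finite_sub by blast

lemma finite_inside [simp]: "finite (inside Z)"
  by (simp add: inside_def finite_C)

lemma inside_sub: "inside Z \<subseteq> C"
  by (auto simp: inside_def)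

lemma weight_nonneg: "A \<subseteq> C \<Longrightarrow> weight A x \<ge> 0"
  unfolding weight_def by (intro prod_nonneg) (auto intro: w_nonneg)

lemma weight_depends: "A \<subseteq> C \<Longrightarrow> (\<And>e. e \<in> A \<Longrightarrow> e \<subseteq> X) \<Longrightarrow> depends_only (weight A) X"
  unfolding weight_def by (rule depends_only_prod) (meson depends_only_mono subsetD w_depends)

lemma weight_disjoint_Un:
  "finite A \<Longrightarrow> finite B \<Longrightarrow> A \<inter> B = {} \<Longrightarrow> weight (A \<union> B) x = weight A x * weight B x"
  unfolding weight_def by (rule prod.union_disjoint)

lemma Ex_linear: "Ex (\<lambda>x. a * g x + b * h x) = a * Ex g + b * Ex h"
  by (simp add: Ex_def av_linear finite_V)

lemma Ex_nonneg: "(\<And>x. g x \<ge> 0) \<Longrightarrow> Ex g \<ge> 0"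
  by (simp add: Ex_def av_nonneg finite_V)

lemma Ex_cong: "(\<And>x. (\<And>v. v \<in> V \<Longrightarrow> x v \<in> D) \<Longrightarrow> g x = h x) \<Longrightarrow> Ex g = Ex h"
  unfolding Ex_def by (rule av_cong) (auto simp: finite_V)

text \<open>Tower property of conditional expectation: the average over V already includes the one
  over M, and averaging over M twice is the same as once.\<close>

lemma Ex_av:
  assumes "depends_only G X" "M \<subseteq> V" "X \<inter> M = {}"
  shows "Ex (\<lambda>x. G x * F x) = Ex (\<lambda>x. G x * av M F x)"
proof -
  have fin: "finite M" "finite (V - M)"
    using assms finite_V finite_subset by auto
  have split: "av V g = av (V - M) (av M g)" for g
    using av_union[of "V - M" M g] fin assms(2) by (simp add: Un_absorb2 Diff_disjoint Int_commute)
  have "depends_only (av M F) (UNIV - M)"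
    by (rule av_depends) (auto simp: fin depends_only_def fun_eq_iff[symmetric])
  then have "av M (\<lambda>x. av M F x * 1) = (\<lambda>x. av M F x * av M (\<lambda>_. 1) x)"
    by (intro av_mult) (auto simp: fin)
  then have idem: "av M (av M F) = av M F"
    by (simp add: av_one fin)
  show ?thesis
    unfolding Ex_def split using assms fin by (simp add: av_mult idem)
qed

lemma local_ex_linear: "local_ex Z (\<lambda>x. a * g x + b * h x) = a * local_ex Z g + b * local_ex Z h"
  unfolding local_ex_def
  by (subst Ex_linear[symmetric]) (simp add: algebra_simps)

lemma local_ex_square: "local_ex Z (\<lambda>x. g x * g x) \<ge> 0"
  unfolding local_ex_def
  by (intro Ex_nonneg mult_nonneg_nonneg[of "g x * g x" for x] weight_nonneg inside_sub) auto

lemma local_ex_sum: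
  "finite J \<Longrightarrow> local_ex Z (\<lambda>x. \<Sum>j\<in>J. f j x) = (\<Sum>j\<in>J. local_ex Z (f j))"
proof (induction J rule: finite_induct)
  case empty
  show ?case using local_ex_linear[of Z 0 "\<lambda>_. 0" 0 "\<lambda>_. 0"] by simp
next
  case (insert j J)
  then show ?case using local_ex_linear[of Z 1 "f j" 1 "\<lambda>x. \<Sum>j\<in>J. f j x"] by simp
qed

text \<open>
  A variable outside \<open>Y\<close> occurring in a single factor can be integrated out, and a factor with
  at most \<open>t\<close> remaining variables is \<open>1\<close>.  Iterating this leaves a hypergraph of
  minimum degree two outside \<open>Y\<close>.
\<close>

definition peels_to where
  "peels_to Y A n A' n' \<longleftrightarrow> A' \<subseteq> A \<and> (\<forall>f\<in>A'. n' f \<subseteq> f \<and> t < card (n' f)) \<and>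
    (\<forall>f\<in>A'. \<forall>v\<in>n' f - Y. \<exists>f'\<in>A'. f' \<noteq> f \<and> v \<in> n' f') \<and>
    (\<forall>p. depends_only p Y \<longrightarrow> Ex (\<lambda>x. p x * (\<Prod>f\<in>A. av (f - n f) (w f) x)) =
       Ex (\<lambda>x. p x * (\<Prod>f\<in>A'. av (f - n' f) (w f) x)))"

lemma peels_to_step:
  assumes "peels_to Y B m A' n'" "B \<subseteq> A"
    and "\<And>p. depends_only p Y \<Longrightarrow> Ex (\<lambda>x. p x * (\<Prod>f\<in>A. av (f - n f) (w f) x)) =
       Ex (\<lambda>x. p x * (\<Prod>f\<in>B. av (f - m f) (w f) x))"
  shows "peels_to Y A n A' n'"
  using assms unfolding peels_to_def by auto

lemma peel:
  assumes "A \<subseteq> C" "\<And>f. f \<in> A \<Longrightarrow> n f \<subseteq> f"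
  shows "\<exists>A' n'. peels_to Y A n A' n'"
  using assms
\<comment> \<open>\<open>Suc\<close> makes the measure drop even when a removed edge has no
  variables left.\<close>
proof (induction "\<Sum>f\<in>A. Suc (card (n f))" arbitrary: A n rule: less_induct)
  case less
  have finA: "finite A" using less.prems finite_C finite_subset by blast
  consider (small) f where "f \<in> A" "card (n f) \<le> t"
    | (leaf) f v where "f \<in> A" "v \<in> n f - Y" "\<forall>f'\<in>A. f' \<noteq> f \<longrightarrow> v \<notin> n f'"
    | (core) "\<forall>f\<in>A. t < card (n f)" "\<forall>f\<in>A. \<forall>v\<in>n f - Y. \<exists>f'\<in>A. f' \<noteq> f \<and> v \<in> n f'"
    by (metis not_le)
  then show ?case
  proof cases
    case small
    have lt: "(\<Sum>f\<in>A - {f}. Suc (card (n f))) < (\<Sum>f\<in>A. Suc (card (n f)))"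
      using small finA by (subst sum.remove[of A f]) auto
    have eq: "(\<Prod>f\<in>A. av (f - n f) (w f) x) = (\<Prod>f\<in>A - {f}. av (f - n f) (w f) x)" for x
      using small finA less.prems
      by (subst prod.remove[of A f]) (auto simp: w_av subset_iff)
    have "A - {f} \<subseteq> C" "\<And>f'. f' \<in> A - {f} \<Longrightarrow> n f' \<subseteq> f'"
      using less.prems by auto
    from less.hyps[OF lt this] obtain A' n' where "peels_to Y (A - {f}) n A' n'"
      by blast
    then have "peels_to Y A n A' n'" by (rule peels_to_step) (auto simp: eq)
    then show ?thesis by blast
  next
    case leaf
    define m where "m = n(f := n f - {v})"
    have finf: "finite f" using leaf less.prems finite_edge by blast
    have nf: "n f \<subseteq> f" using leaf less.prems by blast
    have finn: "finite (n f)" using nf finf finite_subset by blast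
    have eqs: "(\<Sum>f\<in>A - {f}. Suc (card (m f))) = (\<Sum>f\<in>A - {f}. Suc (card (n f)))"
      by (intro sum.cong) (auto simp: m_def)
    have "card (m f) < card (n f)"
      using leaf finn psubset_card_mono[of "n f" "n f - {v}"] by (auto simp: m_def)
    then have lt: "(\<Sum>f\<in>A. Suc (card (m f))) < (\<Sum>f\<in>A. Suc (card (n f)))"
      using leaf finA eqs by (simp add: sum.remove[of A f])
    have "A \<subseteq> C" "\<And>f'. f' \<in> A \<Longrightarrow> m f' \<subseteq> f'"
      using less.prems by (auto simp: m_def split: if_splits)
    from less.hyps[OF lt this] obtain A' n' where *: "peels_to Y A m A' n'"
      by blast
    have "Ex (\<lambda>x. p x * (\<Prod>f\<in>A. av (f - n f) (w f) x)) = Ex (\<lambda>x. p x * (\<Prod>f\<in>A. av (f - m f) (w f) x))"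
      if p: "depends_only p Y" for p
    proof -
      \<comment> \<open>The rest of the integrand does not see v: p because v is outside Y, the
        other factors because v is in none of their remaining sets. So v is averaged out in the
        factor of f alone.\<close>
      let ?G = "\<lambda>x. p x * (\<Prod>f\<in>A - {f}. av (f - n f) (w f) x)"
      have G: "depends_only ?G (UNIV - {v})"
      proof (intro depends_only_mult depends_only_prod)
        show "depends_only p (UNIV - {v})"
          using leaf by (intro depends_only_mono[OF p]) auto
        fix f' assume f': "f' \<in> A - {f}"
        have "finite f'" using f' less.prems finite_edge by blast
        then have "depends_only (av (f' - n f') (w f')) (f' - (f' - n f'))"
          using f' less.prems by (intro av_depends w_depends) auto
        then show "depends_only (av (f' - n f') (w f')) (UNIV - {v})"
          using leaf f' by (elim depends_only_mono) auto
      qed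
      have vV: "v \<in> V" using leaf less.prems C_sub by blast
      have split: "(\<lambda>x. p x * (\<Prod>f\<in>A. av (f - n f) (w f) x)) = (\<lambda>x. ?G x * av (f - n f) (w f) x)"
        using leaf finA by (subst prod.remove[of A f]) (auto simp: mult_ac)
      have 1: "av {v} (av (f - n f) (w f)) = av (f - m f) (w f)"
      proof -
        have "f - m f = insert v (f - n f)" using leaf nf by (auto simp: m_def)
        then show ?thesis using leaf finf by (simp add: av_insert)
      qed
      have 2: "(\<Prod>f\<in>A - {f}. av (f - n f) (w f) x) = (\<Prod>f\<in>A - {f}. av (f - m f) (w f) x)" for x
        by (intro prod.cong) (auto simp: m_def)
      have "Ex (\<lambda>x. p x * (\<Prod>f\<in>A. av (f - n f) (w f) x)) = Ex (\<lambda>x. ?G x * av {v} (av (f - n f) (w f)) x)"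
        unfolding split using G vV by (intro Ex_av) auto
      also have "\<dots> = Ex (\<lambda>x. p x * (\<Prod>f\<in>A. av (f - m f) (w f) x))"
        unfolding 1 2 using leaf finA by (simp add: prod.remove[of A f] mult_ac)
      finally show ?thesis .
    qed
    then have "peels_to Y A n A' n'" by (intro peels_to_step[OF *]) auto
    then show ?thesis by blast
  next
    case core
    then have "peels_to Y A n A n" using less.prems by (auto simp: peels_to_def)
    then show ?thesis by blast
  qed
qed

lemma peel_full:
  assumes "A \<subseteq> C"
  obtains A' n where "A' \<subseteq> A" "\<And>f. f \<in> A' \<Longrightarrow> n f \<subseteq> f \<and> t < card (n f)"
    "\<And>f v. f \<in> A' \<Longrightarrow> v \<in> n f \<Longrightarrow> v \<notin> Y \<Longrightarrow> \<exists>f'\<in>A'. f' \<noteq> f \<and> v \<in> n f'"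
    "\<And>p. depends_only p Y \<Longrightarrow> Ex (\<lambda>x. p x * weight A x) =
       Ex (\<lambda>x. p x * (\<Prod>f\<in>A'. av (f - n f) (w f) x))"
proof -
  obtain A' n where "peels_to Y A (\<lambda>f. f) A' n"
    using peel[OF assms, of "\<lambda>f. f" Y] by blast
  then show thesis
    by (intro that[of A' n]) (auto simp: peels_to_def weight_def)
qed

text \<open>Each edge contributes a nonpositive term to \<open>phi\<close>, so edges may be dropped,
  and each excess may be replaced by a lower bound.\<close>

lemma potential_upper:
  assumes "A1 \<subseteq> C" "A2 \<subseteq> C" "A1 \<inter> A2 = {}" "\<And>e. e \<in> A1 \<Longrightarrow> e \<subseteq> X"
    and "\<And>f. f \<in> A2 \<Longrightarrow> n f \<subseteq> f \<inter> X"
  shows "phi X \<le> 2 * int (card X) - (\<Sum>e\<in>A1. excess t e e) - (\<Sum>f\<in>A2. 2 * int (card (n f)) - (int t + 1))"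
proof -
  have fin: "finite A1" "finite A2" using assms finite_C finite_subset by blast+
  have "(\<Sum>e\<in>A1. excess t e e) + (\<Sum>f\<in>A2. 2 * int (card (n f)) - (int t + 1)) \<le>
    (\<Sum>e\<in>A1. excess t e X) + (\<Sum>f\<in>A2. excess t f X)"
  proof (intro add_mono sum_mono)
    fix e assume "e \<in> A1"
    then have "e \<inter> X = e" using assms(4) by blast
    then show "excess t e e \<le> excess t e X" by (simp add: excess_def)
  next
    fix f assume f: "f \<in> A2"
    then have "finite f" using assms finite_edge by blast
    then have "card (n f) \<le> card (f \<inter> X)" using assms f by (intro card_mono) auto
    then show "2 * int (card (n f)) - (int t + 1) \<le> excess t f X" by (simp add: excess_def)
  qed
  also have "\<dots> = (\<Sum>e\<in>A1 \<union> A2. excess t e X)"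
    using fin assms by (simp add: sum.union_disjoint)
  also have "\<dots> \<le> (\<Sum>e\<in>C. excess t e X)"
    using assms finite_C by (intro sum_mono2) auto
  finally show ?thesis by (simp add: potential_def)
qed

text \<open>
  Under the weight \<open>W1 * W2\<close> the variables in \<open>X1\<close> and \<open>X2\<close> are conditionally independent given
  those in \<open>X1 \<inter> X2\<close>, and \<open>h'\<close> is the conditional expectation of \<open>h\<close>.
\<close>

lemma separator_projection:
  assumes "X1 \<subseteq> V" "X2 \<subseteq> V" "depends_only W1 X1" "depends_only W2 X2" "\<And>x. W2 x \<ge> 0"
    and "depends_only h X2"
  shows "\<exists>h'. depends_only h' (X1 \<inter> X2) \<and> (\<forall>g. depends_only g X1 \<longrightarrow>
     Ex (\<lambda>x. g x * h x * (W1 x * W2 x)) = Ex (\<lambda>x. g x * h' x * (W1 x * W2 x)))"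
proof -
  define M where "M = X2 - X1"
  have M: "M \<subseteq> V" "finite M" using assms finite_sub by (auto simp: M_def)
  define h' where "h' = (\<lambda>x. av M (\<lambda>x. h x * W2 x) x / av M W2 x)"
  have eq: "X2 - M = X1 \<inter> X2" by (auto simp: M_def)
  have dep: "depends_only h' (X1 \<inter> X2)"
    unfolding h'_def eq[symmetric] using assms M
    by (intro depends_only_divide av_depends depends_only_mult) auto
  \<comment> \<open>Where the denominator is 0 the numerator is 0 too, so the quotient can be
    multiplied back.\<close>
  have h': "h' x * av M W2 x = av M (\<lambda>x. h x * W2 x) x" for x
    using av_mult_eq_0[of M W2 x h] M assms(5) by (cases "av M W2 x = 0") (auto simp: h'_def)
  have "Ex (\<lambda>x. g x * h x * (W1 x * W2 x)) = Ex (\<lambda>x. g x * h' x * (W1 x * W2 x))"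
    if g: "depends_only g X1" for g
  proof -
    have G: "depends_only (\<lambda>x. g x * W1 x) X1" using g assms by (intro depends_only_mult)
    have "Ex (\<lambda>x. g x * h x * (W1 x * W2 x)) = Ex (\<lambda>x. (g x * W1 x) * (h x * W2 x))"
      by (simp add: mult_ac)
    also have "\<dots> = Ex (\<lambda>x. (g x * W1 x) * av M (\<lambda>x. h x * W2 x) x)"
      using G M by (intro Ex_av) (auto simp: M_def)
    also have "\<dots> = Ex (\<lambda>x. (g x * W1 x) * av M (\<lambda>x. h' x * W2 x) x)"
    proof -
      have "av M (\<lambda>x. h' x * W2 x) = (\<lambda>x. h' x * av M W2 x)"
        using dep M by (intro av_mult) (auto simp: M_def)
      then show ?thesis by (simp add: h')
    qed
    also have "\<dots> = Ex (\<lambda>x. (g x * W1 x) * (h' x * W2 x))"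
      using G M by (intro Ex_av[symmetric]) (auto simp: M_def)
    finally show ?thesis by (simp add: mult_ac)
  qed
  then show ?thesis using dep by blast
qed

end

section \<open>Closed sets and consistency\<close>

text \<open>M is the size up to which the potential is known to be large, 1 / L the guaranteed
  potential per variable. By \<open>M_large\<close>, a closed set of potential at most 2 * d has at
  most M / 2 elements, so the union of two of them is still within reach of plausibility.\<close>

locale plausible_csp = csp_weights \<nu> D V C w t
  for \<nu> :: "'d \<Rightarrow> real" and D and V :: "'v set" and C w t +
  fixes M d :: nat and L :: real
  assumes L_pos: "L > 0" and M_pos: "M > 0"
    and plausible: "X \<subseteq> V \<Longrightarrow> card X \<le> M \<Longrightarrow> real (card X) \<le> L * real_of_int (phi X)"
    and M_large: "4 * L * real d \<le> real M" and d_le_M: "d \<le> M"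
begin

definition closed_set :: "'v set \<Rightarrow> bool" where
  "closed_set X \<longleftrightarrow> X \<subseteq> V \<and> card X \<le> M \<and>
     (\<forall>Y. X \<subset> Y \<and> Y \<subseteq> V \<and> card Y \<le> M \<longrightarrow> phi X < phi Y)"

text \<open>Two levels occur: d for monomials of a polynomial that gets squared, since they have at
  most d / 2 variables, and 2 * d for their products and for unions of two sets of level d.\<close>

definition closed_upto :: "int \<Rightarrow> 'v set set" where
  "closed_upto r = {X. closed_set X \<and> phi X \<le> r}"

lemma phi_nonneg: "X \<subseteq> V \<Longrightarrow> card X \<le> M \<Longrightarrow> phi X \<ge> 0"
  using order_trans[OF of_nat_0_le_iff plausible[of X]] L_pos by (simp add: zero_le_mult_iff)

lemma submodular:
  "X \<subseteq> V \<Longrightarrow> Y \<subseteq> V \<Longrightarrow> phi (X \<union> Y) + phi (X \<inter> Y) \<le> phi X + phi Y"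
  by (intro potential_submodular finite_sub finite_edge)

lemma phi_le_card: "phi X \<le> 2 * int (card X)"
  by (simp add: potential_def sum_nonneg)

lemma card_closed_upto: "X \<in> closed_upto (2 * int d) \<Longrightarrow> 2 * card X \<le> M"
proof -
  assume X: "X \<in> closed_upto (2 * int d)"
  then have "real (card X) \<le> L * real_of_int (phi X)"
    by (intro plausible) (auto simp: closed_upto_def closed_set_def)
  also have "real_of_int (phi X) \<le> real_of_int (2 * int d)"
    using X by (simp add: closed_upto_def del: of_int_mult)
  then have "L * real_of_int (phi X) \<le> L * real_of_int (2 * int d)"
    using L_pos by (intro mult_left_mono) auto
  finally have "2 * real (card X) \<le> real M" using M_large by simp
  then show ?thesis by linarith
qed

lemma closed_upto_sub: "X \<in> closed_upto r \<Longrightarrow> X \<subseteq> V"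
  by (simp add: closed_upto_def closed_set_def)

lemma finite_closed_upto: "finite (closed_upto r)"
  by (rule finite_subset[of _ "Pow V"]) (auto simp: closed_upto_sub finite_V dest: closed_upto_sub)

lemma card_Un_closed_upto:
  assumes "X \<in> closed_upto (2 * int d)" "Y \<in> closed_upto (2 * int d)"
  shows "card (X \<union> Y) \<le> M"
  using card_Un_le[of X Y] card_closed_upto[OF assms(1)] card_closed_upto[OF assms(2)] by linarith

lemma closure_exists:
  assumes "S \<subseteq> V" "card S \<le> M"
  obtains X where "S \<subseteq> X" "closed_set X"
    "\<And>Y. S \<subseteq> Y \<Longrightarrow> Y \<subseteq> V \<Longrightarrow> card Y \<le> M \<Longrightarrow> phi X \<le> phi Y"
proof -
  define F where "F = {Y. S \<subseteq> Y \<and> Y \<subseteq> V \<and> card Y \<le> M}"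
  \<comment> \<open>Minimises the potential and, among ties, maximises the size; M + 1 exceeds every
    size, so the first criterion dominates. The tie-break yields the strict inequality in the
    definition of closedness.\<close>
  define r where "r = (\<lambda>Y. phi Y * (int M + 1) - int (card Y))"
  have F: "finite F" "F \<noteq> {}"
    using assms finite_V by (auto simp: F_def intro: finite_subset[of _ "Pow V"])
  obtain X where X: "X \<in> F" "\<And>Y. Y \<in> F \<Longrightarrow> r X \<le> r Y"
    using ex_is_arg_min_if_finite[OF F, of r] by (auto simp: is_arg_min_linorder)
  have min: "phi X \<le> phi Y" if "Y \<in> F" for Y
  proof (rule ccontr)
    assume "\<not> phi X \<le> phi Y"
    then have "phi Y * (int M + 1) \<le> (phi X - 1) * (int M + 1)"
      by (intro mult_right_mono) auto
    moreover have "int (card X) \<le> int M" using X(1) by (simp add: F_def)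
    ultimately have "r Y < r X" by (simp add: r_def algebra_simps)
    then show False using X(2)[OF that] by simp
  qed
  have "closed_set X"
    unfolding closed_set_def
  proof (intro conjI allI impI)
    fix Y assume Y: "X \<subset> Y \<and> Y \<subseteq> V \<and> card Y \<le> M"
    then have YF: "Y \<in> F" using X(1) by (auto simp: F_def)
    have "card X < card Y" using Y finite_sub by (intro psubset_card_mono) auto
    then have "phi X * (int M + 1) < phi Y * (int M + 1)"
      using X(2)[OF YF] unfolding r_def by linarith
    then show "phi X < phi Y" by (rule mult_right_less_imp_less) simp
  qed (use X in \<open>auto simp: F_def\<close>)
  then show thesis using X(1) min by (intro that[of X]) (auto simp: F_def)
qed

text \<open>Uncrossing: if the closure X of B left S, then phi (S \<union> X) > phi S by closedness,
  and submodularity would make S \<inter> X, which contains B, cheaper than X.\<close>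

lemma closure_within:
  assumes S: "S \<in> closed_upto (2 * int d)" and B: "B \<subseteq> S" and lt: "phi B < phi S"
  shows "\<exists>X. B \<subseteq> X \<and> X \<subset> S \<and> X \<in> closed_upto (phi B)"
proof -
  have SV: "S \<subseteq> V" "card S \<le> M" using S by (auto simp: closed_upto_def closed_set_def)
  have BV: "B \<subseteq> V" "card B \<le> M"
    using SV B card_mono[of S B] finite_sub by force+
  obtain X where X: "B \<subseteq> X" "closed_set X"
    and min: "\<And>Y. B \<subseteq> Y \<Longrightarrow> Y \<subseteq> V \<Longrightarrow> card Y \<le> M \<Longrightarrow> phi X \<le> phi Y"
    using closure_exists[OF BV] by blast
  have XB: "phi X \<le> phi B" using min BV by blast
  have Xc: "X \<in> closed_upto (2 * int d)"
    using X XB lt S by (simp add: closed_upto_def)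
  have "X \<subseteq> S"
  proof (rule ccontr)
    assume "\<not> X \<subseteq> S"
    then have "S \<subset> S \<union> X" by auto
    moreover have "S \<union> X \<subseteq> V" using SV X by (auto simp: closed_set_def)
    ultimately have "phi S < phi (S \<union> X)"
      using S card_Un_closed_upto[OF S Xc] by (simp add: closed_upto_def closed_set_def)
    moreover have "phi X \<le> phi (S \<inter> X)"
      using B X SV card_mono[of S "S \<inter> X"] finite_sub by (intro min) auto
    ultimately show False
      using submodular[of S X] SV X by (auto simp: closed_set_def)
  qed
  moreover have "X \<noteq> S" using XB lt by auto
  ultimately show ?thesis using X XB by (intro exI[of _ X]) (auto simp: closed_upto_def)
qed

text \<open>Once an edge meets S in at least (t + 1) / 2 variables, a further one costs 2 and adds 2
  to the excess, so a closed set swallows the whole edge.\<close>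

lemma closed_dichotomy:
  assumes S: "S \<in> closed_upto (2 * int d)" and e: "e \<in> C"
  shows "e \<subseteq> S \<or> 2 * card (e \<inter> S) \<le> t"
proof (rule ccontr)
  assume "\<not> ?thesis"
  then obtain v where v: "v \<in> e" "v \<notin> S" and big: "2 * card (e \<inter> S) \<ge> t + 1" by auto
  have SV: "S \<subseteq> V" "finite S" using S closed_upto_sub finite_sub by blast+
  have "card (insert v S) \<le> M"
    using card_closed_upto[OF S] M_pos v SV by simp
  moreover have "S \<subset> insert v S" "insert v S \<subseteq> V" using v SV C_sub[OF e] by auto
  ultimately have "phi S < phi (insert v S)"
    using S by (simp add: closed_upto_def closed_set_def)
  moreover have "phi (insert v S) \<le> phi S"
  proof -
    have "e \<inter> insert v S = insert v (e \<inter> S)" using v by auto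
    then have "excess t e (insert v S) = excess t e S + 2"
      using v big SV by (simp add: excess_def)
    moreover have "(\<Sum>f\<in>C - {e}. excess t f S) \<le> (\<Sum>f\<in>C - {e}. excess t f (insert v S))"
      by (intro sum_mono excess_mono) (auto intro: finite_edge)
    ultimately have "(\<Sum>f\<in>C. excess t f S) + 2 \<le> (\<Sum>f\<in>C. excess t f (insert v S))"
      using e finite_C by (simp add: sum.remove[of C e])
    then show ?thesis using v SV by (simp add: potential_def)
  qed
  ultimately show False by simp
qed

lemma phi_closed:
  assumes S: "S \<in> closed_upto (2 * int d)"
  shows "phi S = 2 * int (card S) - (\<Sum>e\<in>inside S. excess t e e)"
proof -
  have "(\<Sum>e\<in>C. excess t e S) = (\<Sum>e\<in>inside S. excess t e S)"
  proof (rule sum.mono_neutral_right)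
    show "\<forall>e\<in>C - inside S. excess t e S = 0"
    proof
      fix e assume "e \<in> C - inside S"
      then have "2 * card (e \<inter> S) \<le> t"
        using closed_dichotomy[OF S, of e] by (auto simp: inside_def)
      then show "excess t e S = 0" by (simp add: excess_def)
    qed
  qed (auto simp: finite_C inside_def)
  also have "\<dots> = (\<Sum>e\<in>inside S. excess t e e)"
    by (intro sum.cong) (auto simp: inside_def excess_def Int_absorb2)
  finally show ?thesis by (simp add: potential_def)
qed

lemma local_ex_restrict:
  assumes X: "X \<in> closed_upto (2 * int d)" and Z: "X \<subseteq> Z" "Z \<subseteq> V" "card Z \<le> M"
    and p: "depends_only p X"
  shows "local_ex Z p = local_ex X p"
proof -
  define A where "A = inside Z - inside X"
  have "A \<subseteq> C" by (auto simp: A_def inside_def)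
  then obtain A' n where A': "A' \<subseteq> A"
    and n: "\<And>f. f \<in> A' \<Longrightarrow> n f \<subseteq> f \<and> t < card (n f)"
    and twice: "\<And>f v. f \<in> A' \<Longrightarrow> v \<in> n f \<Longrightarrow> v \<notin> X \<Longrightarrow> \<exists>f'\<in>A'. f' \<noteq> f \<and> v \<in> n f'"
    and ex: "\<And>p. depends_only p (X) \<Longrightarrow> Ex (\<lambda>x. p x * weight A x) =
       Ex (\<lambda>x. p x * (\<Prod>f\<in>A'. av (f - n f) (w f) x))"
    by (rule peel_full[of A X]) auto
  have XV: "X \<subseteq> V" "finite X" using X closed_upto_sub finite_sub by blast+
  have fin: "finite A'" using A' finite_inside by (auto simp: A_def intro: finite_subset)
  have finn: "finite (n f)" if "f \<in> A'" for f
    using n[OF that] A' that finite_edge by (auto simp: A_def inside_def intro: finite_subset)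
  have "A' = {}"
  proof (rule ccontr)
    assume "A' \<noteq> {}"
    then obtain f where f: "f \<in> A'" by auto
    have fC: "f \<in> C" "\<not> f \<subseteq> X" using f A' by (auto simp: A_def inside_def)
    let ?N = "\<Union>f\<in>A'. n f"
    have N: "?N \<subseteq> Z" using n A' by (fastforce simp: A_def inside_def)
    \<comment> \<open>A core edge retains more than t variables, whereas an edge not inside X meets
      it in at most t / 2. So the core sticks out of X and enlarges it properly.\<close>
    have "\<not> n f \<subseteq> X"
    proof
      assume "n f \<subseteq> X"
      then have "card (n f) \<le> card (f \<inter> X)"
        using n[OF f] XV by (intro card_mono) auto
      then show False
        using closed_dichotomy[OF X fC(1)] fC(2) n[OF f] by linarith
    qed
    then have "X \<subset> X \<union> ?N" using f by auto
    moreover have "X \<union> ?N \<subseteq> V" using XV N Z by auto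
    moreover have "card (X \<union> ?N) \<le> M"
      using card_mono[of Z "X \<union> ?N"] N Z finite_sub by auto
    ultimately have lt: "phi X < phi (X \<union> ?N)"
      using X by (auto simp: closed_upto_def closed_set_def)
    have "phi (X \<union> ?N) \<le> 2 * int (card (X \<union> ?N)) - (\<Sum>e\<in>inside X. excess t e e)
        - (\<Sum>f\<in>A'. 2 * int (card (n f)) - (int t + 1))"
      using n A' by (intro potential_upper) (auto simp: A_def inside_def)
    moreover have "2 * int (card (?N - X)) + int (card (?N \<inter> X))
        \<le> (\<Sum>f\<in>A'. 2 * int (card (n f)) - (int t + 1))"
      using fin finn n twice by (intro cover_twice_count) auto
    moreover have "card (X \<union> ?N) = card X + card (?N - X)"
    proof -
      have "X \<union> ?N = X \<union> (?N - X)" by auto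
      also have "card \<dots> = card X + card (?N - X)"
        using XV fin finn by (intro card_Un_disjoint) auto
      finally show ?thesis .
    qed
    ultimately show False using lt phi_closed[OF X] by linarith
  qed
  then have *: "Ex (\<lambda>x. q x * weight A x) = Ex q" if "depends_only q X" for q
    using ex[OF that] by simp
  have "inside Z = inside X \<union> A" using Z by (auto simp: A_def inside_def)
  then have eq: "weight (inside Z) x = weight (inside X) x * weight A x" for x
    using weight_disjoint_Un[of "inside X" A x] by (simp add: A_def)
  have "depends_only (\<lambda>x. p x * weight (inside X) x) X"
    using p by (intro depends_only_mult weight_depends) (auto simp: inside_def)
  from *[OF this] show ?thesis
    unfolding local_ex_def eq by (simp add: mult.assoc)
qed

text \<open>Both sides are compared through the union, which need not be closed:
  \<open>local_ex_restrict\<close> only asks that it has at most M elements.\<close>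

lemma local_ex_consistent:
  assumes "X \<in> closed_upto (2 * int d)" "Y \<in> closed_upto (2 * int d)" "depends_only p (X \<inter> Y)"
  shows "local_ex X p = local_ex Y p"
proof -
  have XY: "X \<union> Y \<subseteq> V" "card (X \<union> Y) \<le> M"
    using assms closed_upto_sub card_Un_closed_upto by blast+
  have "depends_only p X" "depends_only p Y"
    using assms(3) depends_only_mono by blast+
  then have "local_ex (X \<union> Y) p = local_ex X p" "local_ex (X \<union> Y) p = local_ex Y p"
    using assms XY by (auto intro!: local_ex_restrict)
  then show ?thesis by simp
qed

text \<open>
  Peeling relative to \<open>S \<union> T\<close> leaves a hypergraph whose attachments to \<open>S\<close> and \<open>T\<close> are both
  separators.  If neither had smaller potential than the set containing it, adding the
  hypergraph to \<open>S \<union> T\<close> would not raise the potential above the average of those of \<open>S\<close> and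
  \<open>T\<close>, against the closedness of \<open>S\<close>.
\<close>

lemma small_separator:
  assumes S: "S \<in> closed_upto (2 * int d)" and T: "T \<in> closed_upto (2 * int d)"
    and Z: "Z \<in> closed_upto (2 * int d)" "S \<union> T \<subseteq> Z"
    and le: "phi T \<le> phi S" and nsub: "\<not> T \<subseteq> S" and h: "depends_only h T"
  shows "\<exists>B h'. depends_only h' B \<and> (B \<subseteq> T \<and> phi B < phi T \<or> B \<subseteq> S \<and> phi B < phi S) \<and>
     (\<forall>g. depends_only g S \<longrightarrow> local_ex Z (\<lambda>x. g x * h x) = local_ex Z (\<lambda>x. g x * h' x))"
proof -
  define A where "A = inside Z - inside S - inside T"
  have "A \<subseteq> C" by (auto simp: A_def inside_def)
  then obtain A' n where A': "A' \<subseteq> A"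
    and n: "\<And>f. f \<in> A' \<Longrightarrow> n f \<subseteq> f \<and> t < card (n f)"
    and twice: "\<And>f v. f \<in> A' \<Longrightarrow> v \<in> n f \<Longrightarrow> v \<notin> S \<union> T \<Longrightarrow> \<exists>f'\<in>A'. f' \<noteq> f \<and> v \<in> n f'"
    and ex: "\<And>p. depends_only p (S \<union> T) \<Longrightarrow> Ex (\<lambda>x. p x * weight A x) =
       Ex (\<lambda>x. p x * (\<Prod>f\<in>A'. av (f - n f) (w f) x))"
    by (rule peel_full[of A "S \<union> T"]) auto
  have V: "S \<subseteq> V" "T \<subseteq> V" "Z \<subseteq> V" "finite S" "finite T" "finite Z"
    using S T Z closed_upto_sub finite_sub by blast+
  have fin: "finite A'" using A' finite_inside by (auto simp: A_def intro: finite_subset)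
  have finn: "finite (n f)" if "f \<in> A'" for f
    using n[OF that] A' that finite_edge by (auto simp: A_def inside_def intro: finite_subset)
  define N where "N = (\<Union>f\<in>A'. n f)"
  have NZ: "N \<subseteq> Z" using n A' by (fastforce simp: N_def A_def inside_def)
  have NV: "N \<subseteq> V" using NZ V by blast
  have finN: "finite N" using fin finn by (simp add: N_def)
  define P where "P = (\<lambda>x. \<Prod>f\<in>A'. av (f - n f) (w f) x)"
  have P_dep: "depends_only P N"
    unfolding P_def
  proof (rule depends_only_prod)
    fix f assume f: "f \<in> A'"
    then have fC: "f \<in> C" using A' by (auto simp: A_def inside_def)
    then have "depends_only (av (f - n f) (w f)) (f - (f - n f))"
      using finite_edge by (intro av_depends w_depends) auto
    then show "depends_only (av (f - n f) (w f)) N"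
      by (rule depends_only_mono) (use f in \<open>auto simp: N_def\<close>)
  qed
  have P_nonneg: "P x \<ge> 0" for x
    unfolding P_def using A' finite_edge w_nonneg
    by (intro prod_nonneg ballI av_nonneg) (auto simp: A_def inside_def)
  define WS where "WS = weight (inside S)"
  \<comment> \<open>Constraints inside both S and T are assigned to S, so that each is counted
    once.\<close>
  define WT where "WT = weight (inside T - inside S)"
  have WS_dep: "depends_only WS S" and WT_dep: "depends_only WT T"
    unfolding WS_def WT_def by (intro weight_depends; auto simp: inside_def)+
  have WT_nonneg: "WT x \<ge> 0" for x
    unfolding WT_def by (intro weight_nonneg) (auto simp: inside_def)
  have lex: "local_ex Z p = Ex (\<lambda>x. p x * (WS x * WT x * P x))" if p: "depends_only p (S \<union> T)" for p
  proof -
    have "inside Z = (inside S \<union> (inside T - inside S)) \<union> A" using Z by (auto simp: A_def inside_def)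
    then have "weight (inside Z) x = weight (inside S \<union> (inside T - inside S)) x * weight A x" for x
      using weight_disjoint_Un[of "inside S \<union> (inside T - inside S)" A x] by (auto simp: A_def)
    moreover have "weight (inside S \<union> (inside T - inside S)) x = WS x * WT x" for x
      unfolding WS_def WT_def by (rule weight_disjoint_Un) auto
    ultimately have "local_ex Z p = Ex (\<lambda>x. (p x * (WS x * WT x)) * weight A x)"
      by (simp add: local_ex_def mult.assoc)
    also have "\<dots> = Ex (\<lambda>x. (p x * (WS x * WT x)) * P x)"
      unfolding P_def
      by (intro ex depends_only_mult p depends_only_mono[OF WS_dep] depends_only_mono[OF WT_dep]) auto
    finally show ?thesis by (simp add: mult.assoc)
  qed
  \<comment> \<open>The core N may be joined to either side: with S it leaves the interface
    \<open>BT\<close>, with T the interface \<open>BS\<close>. The factor P moves along with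
    it.\<close>
  define BT where "BT = (S \<union> N) \<inter> T"
  define BS where "BS = S \<inter> (T \<union> N)"
  consider (left) "phi BT < phi T" | (right) "phi BS < phi S"
  proof -
    have "phi BT < phi T \<or> phi BS < phi S"
    proof (rule ccontr)
      assume "\<not> ?thesis"
      then have ge: "phi T \<le> phi BT" "phi S \<le> phi BS" by auto
      \<comment> \<open>The potential of S \<inter> T when only the edges inside it are counted; the
        intersection need not be closed, so this is merely an upper bound.\<close>
      define psi where "psi = 2 * int (card (S \<inter> T)) - (\<Sum>e\<in>inside (S \<inter> T). excess t e e)"
      have bound: "phi (S \<inter> T \<union> Q) \<le> psi + 2 * int (card Q)" for Q
      proof -
        have "phi (S \<inter> T \<union> Q) \<le> 2 * int (card (S \<inter> T \<union> Q)) - (\<Sum>e\<in>inside (S \<inter> T). excess t e e)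
            - (\<Sum>f\<in>{}. 2 * int (card (n f)) - (int t + 1))"
          by (intro potential_upper) (auto simp: inside_def)
        then show ?thesis using card_Un_le[of "S \<inter> T" Q] by (simp add: psi_def)
      qed
      have BT: "BT = S \<inter> T \<union> (N \<inter> (T - S))" and BS: "BS = S \<inter> T \<union> (N \<inter> (S - T))"
        by (auto simp: BT_def BS_def)
      have "card (N \<inter> (T - S)) + card (N \<inter> (S - T)) = card (N \<inter> (T - S) \<union> N \<inter> (S - T))"
        using finN by (intro card_Un_disjoint[symmetric]) auto
      also have "\<dots> \<le> card (N \<inter> (S \<union> T))"
        using finN by (intro card_mono) auto
      finally have b1: "card (N \<inter> (T - S)) + card (N \<inter> (S - T)) \<le> card (N \<inter> (S \<union> T))" .
      have b2: "phi T + phi S \<le> 2 * psi + 2 * int (card (N \<inter> (S \<union> T)))"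
        using ge bound[of "N \<inter> (T - S)"] bound[of "N \<inter> (S - T)"] b1 unfolding BT BS by linarith
      define Y where "Y = S \<union> T \<union> N"
      have b3: "phi Y \<le> 2 * int (card Y) - (\<Sum>e\<in>inside S \<union> inside T. excess t e e)
        - (\<Sum>f\<in>A'. 2 * int (card (n f)) - (int t + 1))"
        using n A' unfolding Y_def N_def by (intro potential_upper) (auto simp: A_def inside_def)
      have b4: "2 * int (card (N - (S \<union> T))) + int (card (N \<inter> (S \<union> T)))
        \<le> (\<Sum>f\<in>A'. 2 * int (card (n f)) - (int t + 1))"
        unfolding N_def using fin finn n twice by (intro cover_twice_count) auto
      have b5: "card Y = card (S \<union> T) + card (N - (S \<union> T))"
      proof -
        have "Y = (S \<union> T) \<union> (N - (S \<union> T))" by (auto simp: Y_def)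
        also have "card \<dots> = card (S \<union> T) + card (N - (S \<union> T))"
          using V finN by (intro card_Un_disjoint) auto
        finally show ?thesis .
      qed
      have b6: "card S + card T = card (S \<union> T) + card (S \<inter> T)"
        using V by (intro card_Un_Int)
      have "int (card Y) = int (card (S \<union> T)) + int (card (N - (S \<union> T)))"
        "int (card S) + int (card T) = int (card (S \<union> T)) + int (card (S \<inter> T))"
        using b5 b6 by linarith+
      note b56 = this
      have "inside (S \<inter> T) = inside S \<inter> inside T" by (auto simp: inside_def)
      then have b7: "(\<Sum>e\<in>inside S \<union> inside T. excess t e e) + (\<Sum>e\<in>inside (S \<inter> T). excess t e e) =
          (\<Sum>e\<in>inside S. excess t e e) + (\<Sum>e\<in>inside T. excess t e e)"
        by (simp add: sum.union_inter)
      have "S \<subset> Y" using nsub by (auto simp: Y_def)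
      moreover have "Y \<subseteq> Z" using Z NZ by (auto simp: Y_def)
      moreover from this have "card Y \<le> M"
        using card_mono[of Z Y] V card_closed_upto[OF Z(1)] by linarith
      ultimately have "phi S < phi Y"
        using S subset_trans[OF \<open>Y \<subseteq> Z\<close> V(3)] by (simp add: closed_upto_def closed_set_def)
      \<comment> \<open>By \<open>b2\<close>, psi plus
        \<open>card (N \<inter> (S \<union> T))\<close> is at least the mean of phi S and phi T. So
        phi Y is at most this mean, hence at most phi S because phi T \<le> phi S.\<close>
      moreover have "phi Y \<le> phi S + phi T - psi - int (card (N \<inter> (S \<union> T)))"
      proof -
        have "\<lbrakk>y \<le> 2 * cY - u - r; 2 * cN + b \<le> r; cY = cU + cN; cS + cT = cU + cI; u + i = s + t\<rbrakk>
          \<Longrightarrow> y \<le> (2 * cS - s) + (2 * cT - t) - (2 * cI - i) - b"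
          for y cY u r cN b cU cS cT cI i s t :: int by linarith
        from this[OF b3 b4 b56 b7] show ?thesis
          unfolding psi_def phi_closed[OF S] phi_closed[OF T] .
      qed
      ultimately show False using b2 le by linarith
    qed
    then show thesis using that by blast
  qed
  then show ?thesis
  proof cases
    case left
    obtain h' where h': "depends_only h' ((S \<union> N) \<inter> T)"
      and eq: "\<And>g. depends_only g (S \<union> N) \<Longrightarrow>
       Ex (\<lambda>x. g x * h x * ((WS x * P x) * WT x)) = Ex (\<lambda>x. g x * h' x * ((WS x * P x) * WT x))"
      using separator_projection[of "S \<union> N" T "\<lambda>x. WS x * P x" WT h] V NV WT_dep WT_nonneg h
        depends_only_mult[OF depends_only_mono[OF WS_dep] depends_only_mono[OF P_dep], of "S \<union> N"]
      by auto
    have "local_ex Z (\<lambda>x. g x * h x) = local_ex Z (\<lambda>x. g x * h' x)" if g: "depends_only g S" for g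
    proof -
      have dep: "depends_only (\<lambda>x. g x * k x) (S \<union> T)" if "depends_only k T" for k
        using g that by (intro depends_only_mult) (auto elim: depends_only_mono)
      have "depends_only h' T" using h' by (rule depends_only_mono) auto
      moreover have "depends_only g (S \<union> N)" using g by (rule depends_only_mono) auto
      ultimately show ?thesis
        using lex[OF dep[OF h]] lex[OF dep[of h']] eq[of g] by (simp add: mult_ac)
    qed
    then show ?thesis using h' left by (intro exI[of _ BT] exI[of _ h']) (auto simp: BT_def)
  next
    case right
    obtain h' where h': "depends_only h' (S \<inter> (T \<union> N))"
      and eq: "\<And>g. depends_only g S \<Longrightarrow>
       Ex (\<lambda>x. g x * h x * (WS x * (WT x * P x))) = Ex (\<lambda>x. g x * h' x * (WS x * (WT x * P x)))"
      using separator_projection[of S "T \<union> N" WS "\<lambda>x. WT x * P x" h] V NV WS_dep WT_nonneg P_nonneg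
        depends_only_mono[OF h, of "T \<union> N"]
        depends_only_mult[OF depends_only_mono[OF WT_dep] depends_only_mono[OF P_dep], of "T \<union> N"]
      by auto
    have "local_ex Z (\<lambda>x. g x * h x) = local_ex Z (\<lambda>x. g x * h' x)" if g: "depends_only g S" for g
    proof -
      have dep: "depends_only (\<lambda>x. g x * k x) (S \<union> T)" if "depends_only k (S \<union> T)" for k
        using g that by (intro depends_only_mult) (auto elim: depends_only_mono)
      have "depends_only h' (S \<union> T)" using h' by (rule depends_only_mono) auto
      moreover have "depends_only h (S \<union> T)" using h by (rule depends_only_mono) auto
      ultimately show ?thesis
        using lex[OF dep[of h]] lex[OF dep[of h']] eq[OF g] by (simp add: mult_ac)
    qed
    then show ?thesis using h' right by (intro exI[of _ BS] exI[of _ h']) (auto simp: BS_def)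
  qed
qed

end

section \<open>Positivity\<close>

context plausible_csp
begin

definition orth :: "'v set \<Rightarrow> (('v \<Rightarrow> 'd) \<Rightarrow> real) set" where
  "orth S = {g. depends_only g S \<and> (\<forall>R h. R \<in> closed_upto (int d) \<and> R \<subset> S \<and> depends_only h R \<longrightarrow>
     local_ex S (\<lambda>x. g x * h x) = 0)}"

lemma orth_depends: "g \<in> orth S \<Longrightarrow> depends_only g S"
  by (simp add: orth_def)

lemma closed_upto_double: "X \<in> closed_upto (int d) \<Longrightarrow> X \<in> closed_upto (2 * int d)"
  by (simp add: closed_upto_def)

text \<open>The two kinds of separator end differently. One inside T is enclosed in a smaller closed
  set X \<subset> T, to which the induction applies; X differs from S as phi X < phi T \<le> phi S.
  One inside S is enclosed in a closed proper subset of S, where orthogonality holds by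
  definition.\<close>

lemma orth_vanish:
  assumes S: "S \<in> closed_upto (int d)" and g: "g \<in> orth S"
    and T: "T \<in> closed_upto (int d)" "T \<noteq> S" "phi T \<le> phi S" and h: "depends_only h T"
    and Z: "Z \<in> closed_upto (2 * int d)" "S \<union> T \<subseteq> Z"
  shows "local_ex Z (\<lambda>x. g x * h x) = 0"
  using T h Z
proof (induction "card T" arbitrary: T h rule: less_induct)
  case less
  note S2 = closed_upto_double[OF S]
  have inside_S: "local_ex Z (\<lambda>x. g x * h x) = 0"
    if "R \<in> closed_upto (int d)" "R \<subset> S" "depends_only h R" for R h
  proof -
    have "depends_only (\<lambda>x. g x * h x) S"
      using that(2) orth_depends[OF g] by (intro depends_only_mult depends_only_mono[OF that(3)]) auto
    then have "depends_only (\<lambda>x. g x * h x) (Z \<inter> S)"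
      by (rule depends_only_mono) (use less.prems in auto)
    then have "local_ex Z (\<lambda>x. g x * h x) = local_ex S (\<lambda>x. g x * h x)"
      using less.prems S2 by (intro local_ex_consistent)
    then show ?thesis using g that by (auto simp: orth_def)
  qed
  show ?case
  proof (cases "T \<subseteq> S")
    case True
    then show ?thesis using inside_S less.prems by blast
  next
    case False
    obtain B h' where h': "depends_only h' B" and
      B: "B \<subseteq> T \<and> phi B < phi T \<or> B \<subseteq> S \<and> phi B < phi S" and
      eq: "\<And>g. depends_only g S \<Longrightarrow> local_ex Z (\<lambda>x. g x * h x) = local_ex Z (\<lambda>x. g x * h' x)"
      using small_separator[OF S2 closed_upto_double[OF less.prems(1)] less.prems(5,6,3) False less.prems(4)]
      by blast
    have eq': "local_ex Z (\<lambda>x. g x * h x) = local_ex Z (\<lambda>x. g x * h' x)"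
      using eq orth_depends[OF g] by blast
    from B show ?thesis
    proof (elim disjE conjE)
      assume B: "B \<subseteq> T" "phi B < phi T"
      then obtain X where X: "B \<subseteq> X" "X \<subset> T" "X \<in> closed_upto (phi B)"
        using closure_within[OF closed_upto_double[OF less.prems(1)]] by blast
      have Xd: "X \<in> closed_upto (int d)" "phi X < phi T"
        using X(3) B less.prems(1) by (auto simp: closed_upto_def)
      have "card X < card T"
        using X(2) less.prems(1) closed_upto_sub finite_sub by (intro psubset_card_mono) blast+
      then have "local_ex Z (\<lambda>x. g x * h' x) = 0"
        using X Xd less.prems depends_only_mono[OF h' X(1)] by (intro less.hyps) auto
      then show ?thesis using eq' by simp
    next
      assume B: "B \<subseteq> S" "phi B < phi S"
      then obtain X where X: "B \<subseteq> X" "X \<subset> S" "X \<in> closed_upto (phi B)"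
        using closure_within[OF S2] by blast
      have Xd: "X \<in> closed_upto (int d)"
        using X(3) B S by (auto simp: closed_upto_def)
      show ?thesis
        unfolding eq' using inside_S[OF Xd X(2)] depends_only_mono[OF h' X(1)] by blast
    qed
  qed
qed

lemma orth_sum:
  assumes "finite J" "\<And>j. j \<in> J \<Longrightarrow> f j \<in> orth S"
  shows "(\<lambda>x. \<Sum>j\<in>J. f j x) \<in> orth S"
  unfolding orth_def
proof (intro CollectI conjI allI impI)
  show "depends_only (\<lambda>x. \<Sum>j\<in>J. f j x) S"
    using assms by (intro depends_only_sum orth_depends)
next
  fix R and h :: "('v \<Rightarrow> 'd) \<Rightarrow> real" assume *: "R \<in> closed_upto (int d) \<and> R \<subset> S \<and> depends_only h R"
  have "local_ex S (\<lambda>x. (\<Sum>j\<in>J. f j x) * h x) = (\<Sum>j\<in>J. local_ex S (\<lambda>x. f j x * h x))"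
    unfolding sum_distrib_right by (rule local_ex_sum[OF assms(1)])
  also have "\<dots> = 0"
    using assms(2) * by (intro sum.neutral) (auto simp: orth_def)
  finally show "local_ex S (\<lambda>x. (\<Sum>j\<in>J. f j x) * h x) = 0" .
qed

lemma orth_projection:
  assumes S: "S \<in> closed_upto (int d)" and g: "depends_only g S"
  shows "\<exists>u hs. u \<in> orth S \<and> (\<forall>R. R \<subset> S \<longrightarrow> depends_only (hs R) R) \<and>
    g = (\<lambda>x. u x + (\<Sum>R\<in>{R\<in>closed_upto (int d). R \<subset> S}. hs R x))"
proof -
  define P where "P = {R\<in>closed_upto (int d). R \<subset> S}"
  have finP: "finite P" by (simp add: P_def finite_closed_upto)
  have finR: "finite R" "finite (R \<rightarrow>\<^sub>E D)" if "R \<in> P" for R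
    using that closed_upto_sub finite_sub finite_D by (auto simp: P_def intro!: finite_PiE)
  \<comment> \<open>Indicators of partial assignments on R span the functions on R, up to values
    outside D, so a finite family suffices for the projection.\<close>
  define I where "I = Sigma P (\<lambda>R. R \<rightarrow>\<^sub>E D)"
  define b :: "'v set \<times> ('v \<Rightarrow> 'd) \<Rightarrow> ('v \<Rightarrow> 'd) \<Rightarrow> real"
    where "b = (\<lambda>(R, a) x. if \<forall>v\<in>R. x v = a v then 1 else 0)"
  have b_dep: "depends_only (b (R, a)) R" for R a
    by (auto simp: b_def depends_only_def)
  have "finite I" using finP finR by (auto simp: I_def)
  from projection_exists[of "local_ex S" I g b, OF local_ex_linear local_ex_square this]
  obtain c where c: "\<forall>i\<in>I. local_ex S (\<lambda>x. (g x - (\<Sum>j\<in>I. c j * b j x)) * b i x) = 0" by blast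
  define u where "u = (\<lambda>x. g x - (\<Sum>j\<in>I. c j * b j x))"
  define hs where "hs = (\<lambda>R x. \<Sum>a\<in>R \<rightarrow>\<^sub>E D. c (R, a) * b (R, a) x)"
  have hs_dep: "depends_only (hs R) R" for R
    unfolding hs_def by (intro depends_only_sum depends_only_mult b_dep depends_only_const)
  have sum_eq: "(\<Sum>j\<in>I. c j * b j x) = (\<Sum>R\<in>P. hs R x)" for x
    unfolding I_def hs_def using finP finR by (subst sum.Sigma) auto
  have u_dep: "depends_only u S"
    unfolding u_def sum_eq using g
    by (intro depends_only_diff depends_only_sum depends_only_mono[OF hs_dep]) (auto simp: P_def)
  have "u \<in> orth S"
    unfolding orth_def
  proof (intro CollectI conjI allI impI u_dep)
    fix R and h :: "('v \<Rightarrow> 'd) \<Rightarrow> real" assume *: "R \<in> closed_upto (int d) \<and> R \<subset> S \<and> depends_only h R"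
    then have R: "R \<in> P" by (simp add: P_def)
    have RV: "R \<subseteq> V" using * closed_upto_sub by blast
    \<comment> \<open>h is the combination of the indicators with coefficients \<open>h a\<close>.
      The identity holds only for assignments into D, which is all that \<open>Ex\<close>
      sees.\<close>
    have "local_ex S (\<lambda>x. u x * h x) = local_ex S (\<lambda>x. \<Sum>a\<in>R \<rightarrow>\<^sub>E D. h a * (u x * b (R, a) x) + 0 * 0)"
      unfolding local_ex_def
    proof (rule Ex_cong)
      fix x assume x: "\<And>v. v \<in> V \<Longrightarrow> x v \<in> D"
      have "(\<Sum>a\<in>R \<rightarrow>\<^sub>E D. h a * (u x * b (R, a) x)) = (\<Sum>a\<in>{restrict x R}. h a * (u x * b (R, a) x))"
      proof (rule sum.mono_neutral_right)
        show "\<forall>a\<in>(R \<rightarrow>\<^sub>E D) - {restrict x R}. h a * (u x * b (R, a) x) = 0"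
        proof
          fix a assume a: "a \<in> (R \<rightarrow>\<^sub>E D) - {restrict x R}"
          have "\<not> (\<forall>v\<in>R. x v = a v)"
          proof
            assume "\<forall>v\<in>R. x v = a v"
            then have "a = restrict x R" using a by (auto simp: PiE_iff extensional_def restrict_def)
            then show False using a by simp
          qed
          then show "h a * (u x * b (R, a) x) = 0" by (auto simp: b_def)
        qed
      qed (use finR[OF R] x RV in auto)
      also have "\<dots> = u x * h x"
      proof -
        have "h (restrict x R) = h x" using * by (auto elim!: depends_onlyD)
        then show ?thesis by (simp add: b_def)
      qed
      finally show "u x * h x * weight (inside S) x =
        (\<Sum>a\<in>R \<rightarrow>\<^sub>E D. h a * (u x * b (R, a) x) + 0 * 0) * weight (inside S) x" by simp
    qed
    also have "\<dots> = (\<Sum>a\<in>R \<rightarrow>\<^sub>E D. local_ex S (\<lambda>x. h a * (u x * b (R, a) x) + 0 * 0))"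
      by (rule local_ex_sum) (use finR[OF R] in auto)
    also have "\<dots> = (\<Sum>a\<in>R \<rightarrow>\<^sub>E D. h a * local_ex S (\<lambda>x. u x * b (R, a) x) + 0 * local_ex S (\<lambda>_. 0))"
      by (intro sum.cong refl local_ex_linear)
    also have "\<dots> = 0"
      using c R by (intro sum.neutral) (auto simp: I_def u_def)
    finally show "local_ex S (\<lambda>x. u x * h x) = 0" .
  qed
  moreover have "g = (\<lambda>x. u x + (\<Sum>R\<in>P. hs R x))"
    by (auto simp: u_def sum_eq)
  ultimately show ?thesis using hs_dep unfolding P_def by blast
qed

text \<open>Repeated projection, by induction on the size of S. Components live on subsets of S,
  which is what allows them to be evaluated in any closed set containing S.\<close>

lemma orth_decomposition:
  assumes "S \<in> closed_upto (int d)" "depends_only g S"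
  shows "\<exists>u. (\<forall>R. u R \<in> orth R) \<and> (\<forall>R. \<not> R \<subseteq> S \<longrightarrow> u R = (\<lambda>_. 0)) \<and>
    g = (\<lambda>x. \<Sum>R\<in>closed_upto (int d). u R x)"
  using assms
proof (induction "card S" arbitrary: S g rule: less_induct)
  case less
  define P where "P = {R\<in>closed_upto (int d). R \<subset> S}"
  have finP: "finite P" by (simp add: P_def finite_closed_upto)
  obtain u0 hs where u0: "u0 \<in> orth S" and hs: "\<And>R. R \<subset> S \<Longrightarrow> depends_only (hs R) R"
    and g: "g = (\<lambda>x. u0 x + (\<Sum>R\<in>P. hs R x))"
    using orth_projection[OF less.prems] unfolding P_def by blast
  have "\<exists>u. (\<forall>R'. u R' \<in> orth R') \<and> (\<forall>R'. \<not> R' \<subseteq> R \<longrightarrow> u R' = (\<lambda>_. 0)) \<and>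
    hs R = (\<lambda>x. \<Sum>R'\<in>closed_upto (int d). u R' x)" if "R \<in> P" for R
  proof (rule less.hyps)
    have "finite S" using less.prems closed_upto_sub finite_sub by blast
    then show "card R < card S" using that by (intro psubset_card_mono) (auto simp: P_def)
  qed (use that hs in \<open>auto simp: P_def\<close>)
  then obtain U where U: "\<And>R R'. R \<in> P \<Longrightarrow> U R R' \<in> orth R'"
    "\<And>R R'. R \<in> P \<Longrightarrow> \<not> R' \<subseteq> R \<Longrightarrow> U R R' = (\<lambda>_. 0)"
    "\<And>R. R \<in> P \<Longrightarrow> hs R = (\<lambda>x. \<Sum>R'\<in>closed_upto (int d). U R R' x)"
    by metis
  \<comment> \<open>Nothing from the sets in P reaches S, since they are proper subsets; the
    component at S is \<open>u0\<close> alone.\<close>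
  define u where "u = (\<lambda>R'. if R' = S then u0 else (\<lambda>x. \<Sum>R\<in>P. U R R' x))"
  have U_S: "U R S = (\<lambda>_. 0)" if "R \<in> P" for R
    using that by (intro U(2)) (auto simp: P_def)
  have "u R' \<in> orth R'" for R'
    using u0 U(1) finP by (auto simp: u_def intro!: orth_sum)
  moreover have "u R' = (\<lambda>_. 0)" if "\<not> R' \<subseteq> S" for R'
  proof -
    have "U R R' = (\<lambda>_. 0)" if "R \<in> P" for R
      using that \<open>\<not> R' \<subseteq> S\<close> by (intro U(2)) (auto simp: P_def)
    then show ?thesis using that by (auto simp: u_def fun_eq_iff)
  qed
  moreover have "g = (\<lambda>x. \<Sum>R'\<in>closed_upto (int d). u R' x)"
  proof
    fix x
    have S0: "(\<Sum>R\<in>P. U R S x) = 0" using U_S by (intro sum.neutral) simp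
    have "(\<Sum>R\<in>P. hs R x) = (\<Sum>R\<in>P. \<Sum>R'\<in>closed_upto (int d). U R R' x)"
      using U(3) by (intro sum.cong) auto
    also have "\<dots> = (\<Sum>R'\<in>closed_upto (int d). \<Sum>R\<in>P. U R R' x)"
      by (rule sum.swap)
    also have "\<dots> = (\<Sum>R'\<in>closed_upto (int d) - {S}. u R' x)"
      using S0 less.prems(1) finite_closed_upto
      by (subst sum.remove[of _ S]) (auto simp: u_def intro!: sum.cong)
    finally show "g x = (\<Sum>R'\<in>closed_upto (int d). u R' x)"
      using g less.prems(1) finite_closed_upto by (subst sum.remove[of _ S]) (auto simp: u_def)
  qed
  ultimately show ?case by (intro exI[of _ u]) auto
qed

text \<open>\<open>Z i j\<close> varies with the pair, so the sum is not visibly the expectation of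
  a square. After decomposition the cross terms vanish, and a diagonal term may be evaluated in R
  itself, independently of i and j; so every R contributes one genuine square.\<close>

lemma local_ex_psd:
  assumes "finite I" "\<And>i. i \<in> I \<Longrightarrow> S i \<in> closed_upto (int d)" "\<And>i. i \<in> I \<Longrightarrow> depends_only (g i) (S i)"
    and Z: "\<And>i j. i \<in> I \<Longrightarrow> j \<in> I \<Longrightarrow> Z i j \<in> closed_upto (2 * int d) \<and> S i \<union> S j \<subseteq> Z i j"
  shows "(\<Sum>i\<in>I. \<Sum>j\<in>I. local_ex (Z i j) (\<lambda>x. g i x * g j x)) \<ge> 0"
proof -
  let ?F = "closed_upto (int d)"
  note fin = finite_closed_upto[of "int d"]
  obtain u where u: "\<And>i R. i \<in> I \<Longrightarrow> u i R \<in> orth R" "\<And>i R. i \<in> I \<Longrightarrow> \<not> R \<subseteq> S i \<Longrightarrow> u i R = (\<lambda>_. 0)"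
    "\<And>i. i \<in> I \<Longrightarrow> g i = (\<lambda>x. \<Sum>R\<in>?F. u i R x)"
    using orth_decomposition[OF assms(2,3)] by metis
  have zero: "local_ex Y (\<lambda>_. 0) = 0" for Y
    using local_ex_linear[of Y 0 "\<lambda>_. 0" 0 "\<lambda>_. 0"] by simp
  have cross: "local_ex (Z i j) (\<lambda>x. u i R x * u j R' x) =
      (if R = R' then local_ex R (\<lambda>x. u i R x * u j R x) else 0)"
    if ij: "i \<in> I" "j \<in> I" and R: "R \<in> ?F" "R' \<in> ?F" for i j R R'
  proof (cases "R \<subseteq> S i \<and> R' \<subseteq> S j")
    case False
    then have "u i R = (\<lambda>_. 0) \<or> u j R' = (\<lambda>_. 0)" using u(2) ij by blast
    then show ?thesis by (auto simp: zero)
  next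
    case True
    have sub: "R \<union> R' \<subseteq> Z i j" "R' \<union> R \<subseteq> Z i j" using True Z[OF ij] by auto
    note dep = orth_depends[OF u(1)[OF ij(1), of R]] orth_depends[OF u(1)[OF ij(2), of R']]
    consider "R = R'" | "R \<noteq> R'" "phi R' \<le> phi R" | "R \<noteq> R'" "phi R \<le> phi R'" by linarith
    then show ?thesis
    proof cases
      case 1
      have "depends_only (\<lambda>x. u i R x * u j R x) R" using dep 1 by (auto intro: depends_only_mult)
      then have "depends_only (\<lambda>x. u i R x * u j R x) (Z i j \<inter> R)"
        by (rule depends_only_mono) (use sub in auto)
      then have "local_ex (Z i j) (\<lambda>x. u i R x * u j R x) = local_ex R (\<lambda>x. u i R x * u j R x)"
        using Z[OF ij] R closed_upto_double by (intro local_ex_consistent) auto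
      then show ?thesis using 1 by simp
    next
      case 2
      then show ?thesis
        using orth_vanish[OF R(1) u(1)[OF ij(1)] R(2) _ 2(2) dep(2)] Z[OF ij] sub by auto
    next
      case 3
      have "local_ex (Z i j) (\<lambda>x. u j R' x * u i R x) = 0"
        using orth_vanish[OF R(2) u(1)[OF ij(2)] R(1) 3(1) 3(2) dep(1)] Z[OF ij] sub by auto
      then show ?thesis using 3 by (simp add: mult.commute)
    qed
  qed
  have pair: "local_ex (Z i j) (\<lambda>x. g i x * g j x) = (\<Sum>R\<in>?F. local_ex R (\<lambda>x. u i R x * u j R x))"
    if ij: "i \<in> I" "j \<in> I" for i j
  proof -
    have "local_ex (Z i j) (\<lambda>x. g i x * g j x) =
        local_ex (Z i j) (\<lambda>x. \<Sum>R\<in>?F. \<Sum>R'\<in>?F. u i R x * u j R' x)"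
      unfolding u(3)[OF ij(1)] u(3)[OF ij(2)] sum_product ..
    also have "\<dots> = (\<Sum>R\<in>?F. \<Sum>R'\<in>?F. local_ex (Z i j) (\<lambda>x. u i R x * u j R' x))"
      using fin by (simp add: local_ex_sum)
    also have "\<dots> = (\<Sum>R\<in>?F. \<Sum>R'\<in>?F. if R = R' then local_ex R (\<lambda>x. u i R x * u j R x) else 0)"
      using ij by (intro sum.cong refl cross) auto
    also have "\<dots> = (\<Sum>R\<in>?F. local_ex R (\<lambda>x. u i R x * u j R x))"
      using fin by simp
    finally show ?thesis .
  qed
  have "(\<Sum>i\<in>I. \<Sum>j\<in>I. local_ex (Z i j) (\<lambda>x. g i x * g j x)) =
      (\<Sum>i\<in>I. \<Sum>j\<in>I. \<Sum>R\<in>?F. local_ex R (\<lambda>x. u i R x * u j R x))"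
    by (intro sum.cong refl pair)
  also have "\<dots> = (\<Sum>i\<in>I. \<Sum>R\<in>?F. \<Sum>j\<in>I. local_ex R (\<lambda>x. u i R x * u j R x))"
    by (intro sum.cong refl sum.swap)
  also have "\<dots> = (\<Sum>R\<in>?F. \<Sum>i\<in>I. \<Sum>j\<in>I. local_ex R (\<lambda>x. u i R x * u j R x))"
    by (rule sum.swap)
  also have "\<dots> = (\<Sum>R\<in>?F. local_ex R (\<lambda>x. (\<Sum>i\<in>I. u i R x) * (\<Sum>j\<in>I. u j R x)))"
    using assms(1) by (simp add: sum_product local_ex_sum)
  also have "\<dots> \<ge> 0"
    by (intro sum_nonneg local_ex_square)
  finally show ?thesis .
qed

text \<open>Comparison with the empty set, where the weight is an empty product. It is closed
  because plausibility gives every nonempty small set positive potential.\<close>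

lemma local_ex_one:
  assumes "Z \<in> closed_upto (2 * int d)"
  shows "local_ex Z (\<lambda>_. 1) = 1"
proof -
  have phi_empty: "phi {} = 0"
    by (simp add: potential_def excess_def)
  have "{} \<in> closed_upto (2 * int d)"
    unfolding closed_upto_def closed_set_def
  proof (intro CollectI conjI allI impI)
    fix Y assume Y: "{} \<subset> Y \<and> Y \<subseteq> V \<and> card Y \<le> M"
    then have "real (card Y) > 0" using finite_sub by (auto simp: card_gt_0_iff)
    also have "real (card Y) \<le> L * real_of_int (phi Y)" using Y by (intro plausible) auto
    finally show "phi {} < phi Y" using L_pos phi_empty by (simp add: zero_less_mult_iff)
  qed (auto simp: phi_empty)
  then have "local_ex Z (\<lambda>_. 1) = local_ex {} (\<lambda>_. 1)"
    using assms by (intro local_ex_consistent) auto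
  also have "inside {} = {}" using C_ne by (auto simp: inside_def)
  then have "local_ex {} (\<lambda>_. 1) = 1"
    by (simp add: local_ex_def weight_def Ex_def av_one finite_V)
  finally show ?thesis .
qed

lemma phi_Un_closed:
  assumes "S \<in> closed_upto (int d)" "T \<in> closed_upto (int d)"
  shows "phi (S \<union> T) \<le> 2 * int d"
proof -
  have V: "S \<subseteq> V" "T \<subseteq> V" and S: "card S \<le> M"
    using assms by (auto simp: closed_upto_def closed_set_def)
  have "card (S \<inter> T) \<le> card S" using V finite_sub by (intro card_mono) auto
  then have "phi (S \<inter> T) \<ge> 0" using S V by (intro phi_nonneg) auto
  then show ?thesis
    using submodular[OF V] assms by (auto simp: closed_upto_def)
qed

end

section \<open>Pseudo-expectation of polynomials\<close>

definition lin_ext :: "('m \<Rightarrow> real) \<Rightarrow> ('m \<Rightarrow>\<^sub>0 real) \<Rightarrow> real" where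
  "lin_ext e p = (\<Sum>m\<in>Poly_Mapping.keys p. Poly_Mapping.lookup p m * e m)"

lemma lin_ext_superset:
  "finite A \<Longrightarrow> Poly_Mapping.keys p \<subseteq> A \<Longrightarrow> lin_ext e p = (\<Sum>m\<in>A. Poly_Mapping.lookup p m * e m)"
  unfolding lin_ext_def by (rule sum.mono_neutral_left) (auto simp: in_keys_iff)

lemma lin_ext_add: "lin_ext e (p + q) = lin_ext e p + lin_ext e q"
proof -
  let ?A = "Poly_Mapping.keys p \<union> Poly_Mapping.keys q"
  have "lin_ext e (p + q) = (\<Sum>m\<in>?A. Poly_Mapping.lookup (p + q) m * e m)"
    by (rule lin_ext_superset) (auto dest: keys_add[THEN subsetD])
  also have "\<dots> = (\<Sum>m\<in>?A. Poly_Mapping.lookup p m * e m) + (\<Sum>m\<in>?A. Poly_Mapping.lookup q m * e m)"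
    by (simp add: lookup_add distrib_right sum.distrib)
  also have "\<dots> = lin_ext e p + lin_ext e q"
    by (simp add: lin_ext_superset[of ?A])
  finally show ?thesis .
qed

lemma lin_ext_zero [simp]: "lin_ext e 0 = 0"
  by (simp add: lin_ext_def)

lemma lin_ext_single [simp]: "lin_ext e (Poly_Mapping.single m c) = c * e m"
  by (simp add: lin_ext_def)

lemma lin_ext_sum: "lin_ext e (\<Sum>i\<in>I. f i) = (\<Sum>i\<in>I. lin_ext e (f i))"
  by (induction I rule: infinite_finite_induct) (auto simp: lin_ext_add)

lemma lin_ext_uminus: "lin_ext e (- p) = - lin_ext e p"
  using lin_ext_add[of e p "- p"] by simp

lemma lin_ext_diff: "lin_ext e (p - q) = lin_ext e p - lin_ext e q"
  using lin_ext_add[of e p "- q"] by (simp add: lin_ext_uminus)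

lemma poly_mapping_expand:
  "p = (\<Sum>m\<in>Poly_Mapping.keys p. Poly_Mapping.single m (Poly_Mapping.lookup p m))"
  by (rule poly_mapping_eqI)
     (auto simp: lookup_sum lookup_single when_def in_keys_iff)

lemma lin_ext_mult:
  "lin_ext e (p * q) = (\<Sum>m\<in>Poly_Mapping.keys p. \<Sum>m'\<in>Poly_Mapping.keys q.
     Poly_Mapping.lookup p m * Poly_Mapping.lookup q m' * e (m + m'))"
proof -
  have "p * q = (\<Sum>m\<in>Poly_Mapping.keys p. \<Sum>m'\<in>Poly_Mapping.keys q.
      Poly_Mapping.single m (Poly_Mapping.lookup p m) * Poly_Mapping.single m' (Poly_Mapping.lookup q m'))"
    by (subst poly_mapping_expand[of p], subst poly_mapping_expand[of q]) (rule sum_product)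
  then show ?thesis
    by (simp add: lin_ext_sum mult_single)
qed

lemma lin_ext_single_mult:
  "lin_ext e (Poly_Mapping.single s c * q) =
     (\<Sum>m\<in>Poly_Mapping.keys q. c * Poly_Mapping.lookup q m * e (s + m))"
  by (simp add: lin_ext_mult)

lemma lin_ext_mconst: "lin_ext e (mconst a * p) = a * lin_ext e p"
  unfolding mconst_def lin_ext_single_mult by (simp add: lin_ext_def sum_distrib_left mult.assoc)

lemma lookup_single_mult:
  "Poly_Mapping.lookup (Poly_Mapping.single s (c :: real) * q) n =
     (\<Sum>m\<in>Poly_Mapping.keys q. if s + m = n then c * Poly_Mapping.lookup q m else 0)"
proof -
  have "Poly_Mapping.single s c * q =
     (\<Sum>m\<in>Poly_Mapping.keys q. Poly_Mapping.single s c * Poly_Mapping.single m (Poly_Mapping.lookup q m))"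
    by (subst poly_mapping_expand[of q]) (rule sum_distrib_left)
  then show ?thesis
    by (simp add: lookup_sum mult_single lookup_single when_def)
qed

section \<open>Degrees and the absence of cancellation\<close>

definition tdeg :: "('x \<Rightarrow>\<^sub>0 nat) \<Rightarrow> nat" where
  "tdeg m = (\<Sum>x\<in>Poly_Mapping.keys m. Poly_Mapping.lookup m x)"

lemma tdeg_superset:
  "finite A \<Longrightarrow> Poly_Mapping.keys m \<subseteq> A \<Longrightarrow> tdeg m = (\<Sum>x\<in>A. Poly_Mapping.lookup m x)"
  unfolding tdeg_def by (rule sum.mono_neutral_left) (auto simp: in_keys_iff)

lemma keys_add_nat: "Poly_Mapping.keys (m + m' :: 'x \<Rightarrow>\<^sub>0 nat) = Poly_Mapping.keys m \<union> Poly_Mapping.keys m'"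
  by (auto simp: in_keys_iff lookup_add)

lemma tdeg_add: "tdeg (m + m') = tdeg m + tdeg m'"
proof -
  let ?A = "Poly_Mapping.keys m \<union> Poly_Mapping.keys m'"
  show ?thesis
    by (simp add: tdeg_superset[of ?A] keys_add_nat lookup_add sum.distrib)
qed

lemma tdeg_single [simp]: "tdeg (Poly_Mapping.single x n) = n"
  by (simp add: tdeg_def)

lemma mdeg_eq: "mdeg p = Max (insert 0 (tdeg ` Poly_Mapping.keys p))"
  by (simp add: mdeg_def tdeg_def[abs_def])

lemma tdeg_le_mdeg: "m \<in> Poly_Mapping.keys p \<Longrightarrow> tdeg m \<le> mdeg p"
  by (simp add: mdeg_eq)

lemma mvar_square: "(mvar x)\<^sup>2 = Poly_Mapping.single (Poly_Mapping.single x 2) 1"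
  by (simp add: mvar_def power2_eq_square mult_single single_add[symmetric] flip: numeral_2_eq_2)

text \<open>Among the monomials of q of top degree take one with the largest exponent at (v, a0).
  Its product with the square of \<open>mvar (v, a0)\<close> does not arise from another value a,
  which would need a top-degree monomial with an exponent larger by 2, nor from the constant -1, by
  degree.\<close>

lemma mdeg_assignment_mult:
  fixes q :: "('v \<times> 'd) mpoly"
  assumes "finite D" "a0 \<in> D" "q \<noteq> 0"
  shows "mdeg q + 2 \<le> mdeg (((\<Sum>a\<in>D. (mvar (v, a))\<^sup>2) - 1) * q)"
proof -
  let ?s = "\<lambda>a. Poly_Mapping.single (v, a) (2::nat)"
  define K where "K = {m \<in> Poly_Mapping.keys q. tdeg m = mdeg q}"
  have "Poly_Mapping.keys q \<noteq> {}" using assms by simp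
  then have "mdeg q \<in> tdeg ` Poly_Mapping.keys q"
    using Max_in[of "tdeg ` Poly_Mapping.keys q"] by (simp add: mdeg_eq)
  then have K: "finite K" "K \<noteq> {}" by (auto simp: K_def)
  obtain m where m: "m \<in> K"
    and max: "\<And>m'. m' \<in> K \<Longrightarrow> Poly_Mapping.lookup m' (v, a0) \<le> Poly_Mapping.lookup m (v, a0)"
  proof -
    let ?f = "\<lambda>m :: ('v \<times> 'd) \<Rightarrow>\<^sub>0 nat. Poly_Mapping.lookup m (v, a0)"
    have "Max (?f ` K) \<in> ?f ` K" using K by (intro Max_in) auto
    then obtain m where "m \<in> K" "?f m = Max (?f ` K)" by auto
    moreover from this K have "\<And>m'. m' \<in> K \<Longrightarrow> ?f m' \<le> ?f m" by simp
    ultimately show thesis using that by blast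
  qed
  define n where "n = ?s a0 + m"
  have mq: "m \<in> Poly_Mapping.keys q" "tdeg m = mdeg q" using m by (auto simp: K_def)
  have expand: "((\<Sum>a\<in>D. (mvar (v, a))\<^sup>2) - 1) * q = (\<Sum>a\<in>D. Poly_Mapping.single (?s a) 1 * q) - q"
    by (simp add: mvar_square left_diff_distrib sum_distrib_right)
  have q_n: "Poly_Mapping.lookup q n = 0"
  proof (rule ccontr)
    assume "Poly_Mapping.lookup q n \<noteq> 0"
    then have "tdeg n \<le> mdeg q" by (intro tdeg_le_mdeg) (simp add: in_keys_iff)
    then show False using mq by (simp add: n_def tdeg_add)
  qed
  have other: "Poly_Mapping.lookup (Poly_Mapping.single (?s a) 1 * q) n = 0" if "a \<noteq> a0" for a
    unfolding lookup_single_mult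
  proof (rule sum.neutral, rule ballI)
    fix m' assume m': "m' \<in> Poly_Mapping.keys q"
    have "?s a + m' \<noteq> n"
    proof
      assume eq: "?s a + m' = n"
      then have "tdeg (?s a + m') = tdeg n" by simp
      then have "m' \<in> K" using m' mq by (simp add: K_def n_def tdeg_add)
      moreover have "Poly_Mapping.lookup (?s a + m') (v, a0) = Poly_Mapping.lookup n (v, a0)"
        using eq by simp
      ultimately show False
        using max[of m'] that by (simp add: n_def lookup_add lookup_single)
    qed
    then show "(if ?s a + m' = n then 1 * Poly_Mapping.lookup q m' else 0) = 0" by simp
  qed
  have self: "Poly_Mapping.lookup (Poly_Mapping.single (?s a0) 1 * q) n = Poly_Mapping.lookup q m"
    using mq by (simp add: lookup_single_mult n_def)
  have "Poly_Mapping.lookup (((\<Sum>a\<in>D. (mvar (v, a))\<^sup>2) - 1) * q) n = Poly_Mapping.lookup q m"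
    unfolding expand
    using assms other self q_n by (simp add: lookup_minus lookup_add lookup_sum sum.remove[of D a0])
  then have "n \<in> Poly_Mapping.keys (((\<Sum>a\<in>D. (mvar (v, a))\<^sup>2) - 1) * q)"
    using mq by (simp add: in_keys_iff)
  then have "tdeg n \<le> mdeg (((\<Sum>a\<in>D. (mvar (v, a))\<^sup>2) - 1) * q)" by (rule tdeg_le_mdeg)
  then show ?thesis using mq by (simp add: n_def tdeg_add)
qed

text \<open>Exponents are dropped: the indeterminates are indicators, so on assignments every
  positive power equals the variable.\<close>

definition mono_val :: "('v \<times> 'd \<Rightarrow>\<^sub>0 nat) \<Rightarrow> ('v \<Rightarrow> 'd) \<Rightarrow> real" where
  "mono_val m x = (if \<forall>(v, a)\<in>Poly_Mapping.keys m. x v = a then 1 else 0)"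

definition mono_vars :: "('v \<times> 'd \<Rightarrow>\<^sub>0 nat) \<Rightarrow> 'v set" where
  "mono_vars m = fst ` Poly_Mapping.keys m"

lemma mono_val_add: "mono_val (m + m') x = mono_val m x * mono_val m' x"
  by (auto simp: mono_val_def keys_add_nat)

lemma mono_val_single: "n \<noteq> 0 \<Longrightarrow> mono_val (Poly_Mapping.single (v, a) n) x = (if x v = a then 1 else 0)"
  by (simp add: mono_val_def)

lemma mono_vars_add: "mono_vars (m + m') = mono_vars m \<union> mono_vars m'"
  by (auto simp: mono_vars_def keys_add_nat)

lemma mono_val_depends: "depends_only (mono_val m) (mono_vars m)"
proof -
  have "(\<forall>(v, a)\<in>Poly_Mapping.keys m. x v = a) \<longleftrightarrow> (\<forall>(v, a)\<in>Poly_Mapping.keys m. y v = a)"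
    if "\<forall>v\<in>mono_vars m. x v = y v" for x y
    using that by (intro ball_cong refl) (force simp: mono_vars_def)
  then show ?thesis
    unfolding depends_only_def mono_val_def by (intro allI impI if_cong refl)
qed

lemma card_mono_vars: "card (mono_vars m) \<le> tdeg m"
proof -
  have "card (mono_vars m) \<le> card (Poly_Mapping.keys m)"
    unfolding mono_vars_def by (rule card_image_le) simp
  also have "\<dots> = (\<Sum>x\<in>Poly_Mapping.keys m. 1)" by simp
  also have "\<dots> \<le> tdeg m"
    unfolding tdeg_def by (intro sum_mono) (simp add: in_keys_iff Suc_le_eq)
  finally show ?thesis .
qed

lemma mono_vars_sub: "m \<in> Poly_Mapping.keys p \<Longrightarrow> mvars p \<subseteq> V \<times> D \<Longrightarrow> mono_vars m \<subseteq> V"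
  by (fastforce simp: mono_vars_def mvars_def)

lemma prod_mvar:
  "finite I \<Longrightarrow> (\<Prod>i\<in>I. mvar (f i)) = Poly_Mapping.single (\<Sum>i\<in>I. Poly_Mapping.single (f i) 1) 1"
  by (induction I rule: finite_induct) (auto simp: mvar_def mult_single)

lemma keys_sum_single:
  "finite I \<Longrightarrow> Poly_Mapping.keys (\<Sum>i\<in>I. Poly_Mapping.single (f i) (1::nat)) = f ` I"
  by (induction I rule: finite_induct) (auto simp: keys_add_nat)

context plausible_csp
begin

definition envelope :: "'v set \<Rightarrow> 'v set" where
  "envelope Y = (SOME Z. Y \<subseteq> Z \<and> Z \<in> closed_upto (2 * int d))"

lemma closed_superset:
  assumes "Y \<subseteq> V" "card Y \<le> M" "phi Y \<le> r"
  shows "\<exists>Z. Y \<subseteq> Z \<and> Z \<in> closed_upto r"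
proof (rule closure_exists[OF assms(1,2)])
  fix X assume X: "Y \<subseteq> X" "closed_set X"
    and min: "\<And>Y'. Y \<subseteq> Y' \<Longrightarrow> Y' \<subseteq> V \<Longrightarrow> card Y' \<le> M \<Longrightarrow> phi X \<le> phi Y'"
  have "phi X \<le> phi Y" by (rule min[OF subset_refl assms(1,2)])
  then show ?thesis using X assms(3) by (intro exI[of _ X]) (simp add: closed_upto_def)
qed

lemma envelope:
  assumes "Y \<subseteq> V" "card Y \<le> d"
  shows "Y \<subseteq> envelope Y" "envelope Y \<in> closed_upto (2 * int d)"
proof -
  have "phi Y \<le> 2 * int d" using phi_le_card[of Y] assms by linarith
  then have "\<exists>Z. Y \<subseteq> Z \<and> Z \<in> closed_upto (2 * int d)"
    using assms d_le_M by (intro closed_superset) auto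
  then have "Y \<subseteq> envelope Y \<and> envelope Y \<in> closed_upto (2 * int d)"
    unfolding envelope_def by (rule someI_ex)
  then show "Y \<subseteq> envelope Y" "envelope Y \<in> closed_upto (2 * int d)" by auto
qed

text \<open>The choice of envelope is harmless for at most d variables, by consistency; on larger
  monomials the value carries no meaning.\<close>

definition mono_ex :: "('v \<times> 'd \<Rightarrow>\<^sub>0 nat) \<Rightarrow> real" where
  "mono_ex m = local_ex (envelope (mono_vars m)) (mono_val m)"

lemma mono_ex_eq:
  assumes "mono_vars m \<subseteq> Z" "Z \<in> closed_upto (2 * int d)" "card (mono_vars m) \<le> d"
  shows "mono_ex m = local_ex Z (mono_val m)"
proof -
  have V: "mono_vars m \<subseteq> V" using assms closed_upto_sub by blast
  show ?thesis
    unfolding mono_ex_def using envelope[OF V assms(3)] assms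
    by (intro local_ex_consistent depends_only_mono[OF mono_val_depends]) auto
qed

lemma mono_ex_square:
  assumes "mvars q \<subseteq> V \<times> D'" "2 * mdeg q \<le> d"
  shows "lin_ext mono_ex (q\<^sup>2) \<ge> 0"
proof -
  let ?K = "Poly_Mapping.keys q"
  let ?c = "Poly_Mapping.lookup q"
  have vars: "mono_vars m \<subseteq> V" "2 * card (mono_vars m) \<le> d" if "m \<in> ?K" for m
    using mono_vars_sub[OF that assms(1)] card_mono_vars[of m] tdeg_le_mdeg[OF that] assms(2) by auto
  \<comment> \<open>At most d / 2 variables give potential at most d, so that unions of two closures
    stay at level 2 * d.\<close>
  have "\<exists>S. mono_vars m \<subseteq> S \<and> S \<in> closed_upto (int d)" if "m \<in> ?K" for m
    using vars[OF that] phi_le_card[of "mono_vars m"] d_le_M by (intro closed_superset) auto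
  then obtain S where S: "\<And>m. m \<in> ?K \<Longrightarrow> mono_vars m \<subseteq> S m"
    "\<And>m. m \<in> ?K \<Longrightarrow> S m \<in> closed_upto (int d)" by metis
  have "\<exists>Z. S m \<union> S m' \<subseteq> Z \<and> Z \<in> closed_upto (2 * int d)" if "m \<in> ?K" "m' \<in> ?K" for m m'
    using S(2)[OF that(1)] S(2)[OF that(2)]
    by (intro closed_superset phi_Un_closed card_Un_closed_upto closed_upto_double)
       (auto dest: closed_upto_sub)
  then obtain Z where Z: "\<And>m m'. m \<in> ?K \<Longrightarrow> m' \<in> ?K \<Longrightarrow> S m \<union> S m' \<subseteq> Z m m'"
    "\<And>m m'. m \<in> ?K \<Longrightarrow> m' \<in> ?K \<Longrightarrow> Z m m' \<in> closed_upto (2 * int d)" by metis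
  define g where "g = (\<lambda>m x. ?c m * mono_val m x)"
  have "lin_ext mono_ex (q\<^sup>2) = (\<Sum>m\<in>?K. \<Sum>m'\<in>?K. ?c m * ?c m' * mono_ex (m + m'))"
    by (simp add: power2_eq_square lin_ext_mult)
  also have "\<dots> = (\<Sum>m\<in>?K. \<Sum>m'\<in>?K. local_ex (Z m m') (\<lambda>x. g m x * g m' x))"
  proof (intro sum.cong refl)
    fix m m' assume mm: "m \<in> ?K" "m' \<in> ?K"
    have "card (mono_vars (m + m')) \<le> d"
      using vars[OF mm(1)] vars[OF mm(2)] card_Un_le[of "mono_vars m" "mono_vars m'"]
      unfolding mono_vars_add by linarith
    moreover have "mono_vars (m + m') \<subseteq> Z m m'"
      using S(1)[OF mm(1)] S(1)[OF mm(2)] Z(1)[OF mm] by (auto simp: mono_vars_add)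
    ultimately have "mono_ex (m + m') = local_ex (Z m m') (mono_val (m + m'))"
      using Z(2)[OF mm] by (intro mono_ex_eq)
    then have "?c m * ?c m' * mono_ex (m + m') =
        (?c m * ?c m') * local_ex (Z m m') (mono_val (m + m')) + 0 * local_ex (Z m m') (\<lambda>_. 0)"
      by simp
    also have "\<dots> = local_ex (Z m m') (\<lambda>x. g m x * g m' x)"
      unfolding local_ex_linear[symmetric] by (simp add: g_def mono_val_add mult_ac)
    finally show "?c m * ?c m' * mono_ex (m + m') = local_ex (Z m m') (\<lambda>x. g m x * g m' x)" .
  qed
  also have "\<dots> \<ge> 0"
  proof (rule local_ex_psd[of ?K S])
    fix m assume "m \<in> ?K"
    then show "depends_only (g m) (S m)"
      unfolding g_def
      by (intro depends_only_mult depends_only_const depends_only_mono[OF mono_val_depends] S(1))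
  qed (use S Z in simp_all)
  finally show ?thesis .
qed

text \<open>D' is the full domain and D the support of \<nu>. Averages run over D only, so
  indicators of values outside D contribute 0 and the sum over D' is still complete.\<close>

lemma mono_ex_assignment:
  assumes "finite D'" "D \<subseteq> D'" "v \<in> V" "mono_vars m \<subseteq> V" "card (mono_vars m) + 1 \<le> d"
  shows "(\<Sum>a\<in>D'. mono_ex (Poly_Mapping.single (v, a) 2 + m)) = mono_ex m"
proof -
  define Y where "Y = insert v (mono_vars m)"
  have "card Y \<le> d" using assms(5) card_insert_le_m1[of d "mono_vars m" v] by (simp add: Y_def card_insert_if)
  moreover have "Y \<subseteq> V" using assms by (simp add: Y_def)
  ultimately have Z: "Y \<subseteq> envelope Y" "envelope Y \<in> closed_upto (2 * int d)" using envelope by auto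
  have vars: "mono_vars (Poly_Mapping.single (v, a) 2 + m) = Y" for a
    by (simp add: mono_vars_add Y_def) (simp add: mono_vars_def)
  have "(\<Sum>a\<in>D'. mono_ex (Poly_Mapping.single (v, a) 2 + m)) =
      local_ex (envelope Y) (\<lambda>x. \<Sum>a\<in>D'. mono_val (Poly_Mapping.single (v, a) 2 + m) x)"
    using assms(1) by (simp add: mono_ex_def vars local_ex_sum)
  also have "\<dots> = local_ex (envelope Y) (mono_val m)"
    unfolding local_ex_def
  proof (rule Ex_cong)
    fix x assume "\<And>u. u \<in> V \<Longrightarrow> x u \<in> D"
    then have "x v \<in> D'" using assms by auto
    have "(\<Sum>a\<in>D'. mono_val (Poly_Mapping.single (v, a) 2 + m) x) =
        (\<Sum>a\<in>D'. if x v = a then mono_val m x else 0)"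
      by (intro sum.cong) (auto simp: mono_val_add mono_val_single)
    also have "\<dots> = mono_val m x" using \<open>x v \<in> D'\<close> assms(1) by simp
    finally show "(\<Sum>a\<in>D'. mono_val (Poly_Mapping.single (v, a) 2 + m) x) * weight (inside (envelope Y)) x =
        mono_val m x * weight (inside (envelope Y)) x" by simp
  qed
  also have "\<dots> = mono_ex m"
    using Z assms by (intro mono_ex_eq[symmetric]) (auto simp: Y_def)
  finally show ?thesis .
qed

lemma mono_ex_pseudo_distribution:
  assumes "finite D'" "D \<subseteq> D'"
  shows "pseudo_distribution V D' d (lin_ext mono_ex)"
  unfolding pseudo_distribution_def
proof (intro conjI allI impI ballI)
  fix p q :: "('v \<times> 'd) mpoly"
  show "lin_ext mono_ex (p + q) = lin_ext mono_ex p + lin_ext mono_ex q" by (rule lin_ext_add)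
next
  fix a and p :: "('v \<times> 'd) mpoly"
  show "lin_ext mono_ex (mconst a * p) = a * lin_ext mono_ex p"
    by (rule lin_ext_mconst)
next
  have "mono_ex 0 = local_ex (envelope {}) (\<lambda>_. 1)"
    by (simp add: mono_ex_def mono_vars_def mono_val_def[abs_def])
  also have "\<dots> = 1" using envelope[of "{}"] by (intro local_ex_one) auto
  finally show "lin_ext mono_ex 1 = 1"
    by (simp add: single_one[symmetric] del: single_one)
next
  fix q :: "('v \<times> 'd) mpoly"
  assume "mvars q \<subseteq> V \<times> D' \<and> 2 * mdeg q \<le> d"
  then show "lin_ext mono_ex (q\<^sup>2) \<ge> 0" using mono_ex_square by blast
next
  fix h q :: "('v \<times> 'd) mpoly"
  assume h: "h \<in> assignment_axioms V D'" and q: "mvars q \<subseteq> V \<times> D' \<and> mdeg (h * q) \<le> d"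
  from h consider (one) v where "v \<in> V" "h = (\<Sum>a\<in>D'. (mvar (v, a))\<^sup>2) - 1"
    | (two) v a a' where "a \<noteq> a'" "h = mvar (v, a) * mvar (v, a')"
    by (auto simp: assignment_axioms_def)
  then show "lin_ext mono_ex (h * q) = 0"
  proof cases
    case one
    show ?thesis
    proof (cases "q = 0")
      case False
      obtain a0 where "a0 \<in> D'" using nu_sum assms by (cases "D = {}") auto
      \<comment> \<open>The axioms bound the degree of the product only; since leading terms do not
        cancel, the monomials of q leave room for the variable v.\<close>
      then have deg: "mdeg q + 2 \<le> d"
        using mdeg_assignment_mult[OF assms(1) _ False, of a0 v] one q by simp
      have "lin_ext mono_ex (h * q) = (\<Sum>a\<in>D'. \<Sum>m\<in>Poly_Mapping.keys q.
          Poly_Mapping.lookup q m * mono_ex (Poly_Mapping.single (v, a) 2 + m)) - lin_ext mono_ex q"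
        by (simp add: one mvar_square left_diff_distrib sum_distrib_right lin_ext_diff lin_ext_sum
            lin_ext_single_mult)
      also have "(\<Sum>a\<in>D'. \<Sum>m\<in>Poly_Mapping.keys q.
          Poly_Mapping.lookup q m * mono_ex (Poly_Mapping.single (v, a) 2 + m)) =
          (\<Sum>m\<in>Poly_Mapping.keys q. Poly_Mapping.lookup q m *
            (\<Sum>a\<in>D'. mono_ex (Poly_Mapping.single (v, a) 2 + m)))"
        unfolding sum_distrib_left by (rule sum.swap)
      also have "\<dots> = lin_ext mono_ex q"
        unfolding lin_ext_def
      proof (intro sum.cong refl arg_cong2[where f = "(*)"] mono_ex_assignment assms one(1))
        fix m assume m: "m \<in> Poly_Mapping.keys q"
        show "mono_vars m \<subseteq> V" using mono_vars_sub[OF m] q by blast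
        show "card (mono_vars m) + 1 \<le> d"
          using card_mono_vars[of m] tdeg_le_mdeg[OF m] deg by linarith
      qed
      finally show ?thesis by simp
    qed simp
  next
    case two
    have "mono_ex (Poly_Mapping.single (v, a) 1 + Poly_Mapping.single (v, a') 1 + m) = 0" for m
    proof -
      have "mono_val (Poly_Mapping.single (v, a) 1 + Poly_Mapping.single (v, a') 1 + m) = (\<lambda>x. 0)"
        using two by (auto simp: mono_val_add mono_val_single)
      then show ?thesis
        using local_ex_linear[of _ 0 "\<lambda>_. 0" 0 "\<lambda>_. 0"] by (simp add: mono_ex_def)
    qed
    then show ?thesis
      by (simp add: two mvar_def mult_single lin_ext_single_mult)
  qed
qed

text \<open>Where the local weight is nonzero, so is the density of this constraint, and exactly one
  b in R agrees with x. With \<open>k \<le> d\<close> the edge has an envelope, whose weight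
  includes that density.\<close>

lemma mono_ex_constraint:
  assumes \<sigma>: "\<sigma> ` {1..k} \<in> C" "k \<le> d" and R: "finite R" "R \<subseteq> extensional {1..k}"
    and supp: "\<And>x. (\<And>v. v \<in> V \<Longrightarrow> x v \<in> D) \<Longrightarrow> w (\<sigma> ` {1..k}) x \<noteq> 0 \<Longrightarrow> restrict (x \<circ> \<sigma>) {1..k} \<in> R"
  shows "lin_ext mono_ex (\<Sum>b\<in>R. \<Prod>i=1..k. mvar (\<sigma> i, b i)) = 1"
proof -
  define e where "e = \<sigma> ` {1..k}"
  define m where "m = (\<lambda>b :: nat \<Rightarrow> 'd. \<Sum>i=1..k. Poly_Mapping.single (\<sigma> i, b i) (1::nat))"
  have keys: "Poly_Mapping.keys (m b) = (\<lambda>i. (\<sigma> i, b i)) ` {1..k}" for b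
    unfolding m_def by (rule keys_sum_single) simp
  have vars: "mono_vars (m b) = e" for b
    by (auto simp: mono_vars_def keys e_def image_image)
  have val: "mono_val (m b) x = (if \<forall>i\<in>{1..k}. x (\<sigma> i) = b i then 1 else 0)" for b x
    by (auto simp: mono_val_def keys)
  have "e \<subseteq> V" using \<sigma> C_sub by (simp add: e_def)
  moreover have "card e \<le> d" using card_image_le[of "{1..k}" \<sigma>] \<sigma> by (simp add: e_def)
  ultimately have Z: "e \<subseteq> envelope e" "envelope e \<in> closed_upto (2 * int d)" using envelope by auto
  have "lin_ext mono_ex (\<Sum>b\<in>R. \<Prod>i=1..k. mvar (\<sigma> i, b i)) = (\<Sum>b\<in>R. mono_ex (m b))"
    by (simp add: lin_ext_sum prod_mvar m_def)
  also have "\<dots> = local_ex (envelope e) (\<lambda>x. \<Sum>b\<in>R. mono_val (m b) x)"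
    using R(1) by (simp add: mono_ex_def vars local_ex_sum)
  also have "\<dots> = local_ex (envelope e) (\<lambda>_. 1)"
    unfolding local_ex_def
  proof (rule Ex_cong)
    fix x assume x: "\<And>v. v \<in> V \<Longrightarrow> x v \<in> D"
    show "(\<Sum>b\<in>R. mono_val (m b) x) * weight (inside (envelope e)) x = 1 * weight (inside (envelope e)) x"
    proof (cases "weight (inside (envelope e)) x = 0")
      case False
      have "e \<in> inside (envelope e)" using Z \<sigma> by (simp add: inside_def e_def)
      then have "w e x \<noteq> 0" using False by (auto simp: weight_def)
      then have b: "restrict (x \<circ> \<sigma>) {1..k} \<in> R" using supp x by (simp add: e_def)
      have "(\<Sum>b\<in>R. mono_val (m b) x) = (\<Sum>b\<in>R. if restrict (x \<circ> \<sigma>) {1..k} = b then 1 else 0)"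
      proof (intro sum.cong refl)
        fix b assume "b \<in> R"
        then have "b \<in> extensional {1..k}" using R by auto
        then have "(\<forall>i\<in>{1..k}. x (\<sigma> i) = b i) \<longleftrightarrow> restrict (x \<circ> \<sigma>) {1..k} = b"
          by (auto simp: fun_eq_iff extensional_def restrict_def)
        then show "mono_val (m b) x = (if restrict (x \<circ> \<sigma>) {1..k} = b then 1 else 0)"
          by (simp add: val)
      qed
      also have "\<dots> = 1" using b R(1) by simp
      finally show ?thesis by simp
    qed simp
  qed
  also have "\<dots> = 1" using Z by (intro local_ex_one)
  finally show ?thesis .
qed

end

section \<open>Densities of constraints\<close>

locale twise_constraint = averaging "pmf \<nu>" "set_pmf \<nu>" for \<nu> :: "'d pmf" +
  fixes \<mu> :: "(nat \<Rightarrow> 'd) pmf" and t k :: nat and \<sigma> :: "nat \<Rightarrow> 'v"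
  assumes t_pos: "1 \<le> t" and t_le: "t \<le> k"
    and indep: "twise_independent t k \<nu> \<mu>"
    and inj: "inj_on \<sigma> {1..k}"
begin

definition marg :: "nat set \<Rightarrow> (nat \<Rightarrow> 'd) \<Rightarrow> real" where
  "marg J b = measure_pmf.prob \<mu> {Y. \<forall>i\<in>J. Y i = b i}"

text \<open>Values outside the support of \<open>\<nu>\<close> are moved into it, so that the density relative to
  \<open>\<nu>\<^sup>J\<close> never divides by zero.\<close>

definition retract :: "'d \<Rightarrow> 'd" where
  "retract a = (if a \<in> set_pmf \<nu> then a else (SOME b. b \<in> set_pmf \<nu>))"

definition density :: "nat set \<Rightarrow> ('v \<Rightarrow> 'd) \<Rightarrow> real" where
  "density J x = marg J (\<lambda>i. retract (x (\<sigma> i))) / (\<Prod>i\<in>J. pmf \<nu> (retract (x (\<sigma> i))))"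

lemma retract_in: "retract a \<in> set_pmf \<nu>"
  by (auto simp: retract_def set_pmf_not_empty some_in_eq)

lemma retract_id [simp]: "a \<in> set_pmf \<nu> \<Longrightarrow> retract a = a"
  by (simp add: retract_def)

lemma marg_full:
  assumes "T \<subseteq> {1..k}" "card T = t"
  shows "marg T b = (\<Prod>i\<in>T. pmf \<nu> (b i))"
proof -
  have fin: "finite T" using assms finite_subset by blast
  have "{Y. \<forall>i\<in>T. Y i = b i} = (\<lambda>Y. restrict Y T) -` {restrict b T}"
    by (auto simp: restrict_def fun_eq_iff split: if_splits)
  then have "marg T b = measure_pmf.prob (map_pmf (\<lambda>Y. restrict Y T) \<mu>) {restrict b T}"
    by (simp add: marg_def)
  also have "\<dots> = pmf (Pi_pmf T undefined (\<lambda>_. \<nu>)) (restrict b T)"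
    using indep assms by (simp add: twise_independent_def measure_pmf_single)
  also have "\<dots> = (\<Prod>i\<in>T. pmf \<nu> (b i))"
    using fin by (subst pmf_Pi') auto
  finally show ?thesis .
qed

text \<open>A single index extends to t indices, where the marginal is a product of copies of
  \<nu>.\<close>

lemma support_coordinate:
  assumes "Y \<in> set_pmf \<mu>" "i \<in> {1..k}"
  shows "Y i \<in> set_pmf \<nu>"
proof -
  have "\<exists>T. {i} \<subseteq> T \<and> T \<subseteq> {1..k} \<and> card T = t"
    using t_pos t_le assms(2) by (intro exists_subset_between) auto
  then obtain T where T: "i \<in> T" "T \<subseteq> {1..k}" "card T = t" by blast
  have fin: "finite T" using T finite_subset by blast
  have "restrict Y T \<in> set_pmf (map_pmf (\<lambda>Y. restrict Y T) \<mu>)" using assms by auto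
  also have "map_pmf (\<lambda>Y. restrict Y T) \<mu> = Pi_pmf T undefined (\<lambda>_. \<nu>)"
    using indep T by (simp add: twise_independent_def)
  also have "set_pmf \<dots> \<subseteq> PiE_dflt T undefined (\<lambda>_. set_pmf \<nu>)"
    using set_Pi_pmf_subset'[OF fin, of undefined "\<lambda>_. \<nu>"] by (simp add: comp_def)
  finally have "restrict Y T \<in> PiE_dflt T undefined (\<lambda>_. set_pmf \<nu>)" .
  then show ?thesis using T by (auto simp: PiE_dflt_def)
qed

lemma marg_sum:
  assumes "j \<in> {1..k}" "j \<notin> J"
  shows "(\<Sum>a\<in>set_pmf \<nu>. marg (insert j J) (b(j := a))) = marg J b"
proof -
  have "(\<Sum>a\<in>set_pmf \<nu>. marg (insert j J) (b(j := a))) =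
      measure_pmf.prob \<mu> (\<Union>a\<in>set_pmf \<nu>. {Y. \<forall>i\<in>insert j J. Y i = (b(j := a)) i})"
    unfolding marg_def
    by (intro measure_pmf.finite_measure_finite_Union[symmetric])
       (auto simp: finite_D disjoint_family_on_def)
  also have "\<dots> = marg J b"
    unfolding marg_def
  proof (intro measure_pmf.finite_measure_eq_AE)
    show "AE Y in measure_pmf \<mu>. (Y \<in> (\<Union>a\<in>set_pmf \<nu>. {Y. \<forall>i\<in>insert j J. Y i = (b(j := a)) i})) =
        (Y \<in> {Y. \<forall>i\<in>J. Y i = b i})"
    proof (rule AE_pmfI)
      fix Y assume "Y \<in> set_pmf \<mu>"
      then have "Y j \<in> set_pmf \<nu>" using support_coordinate assms by blast
      then show "(Y \<in> (\<Union>a\<in>set_pmf \<nu>. {Y. \<forall>i\<in>insert j J. Y i = (b(j := a)) i})) =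
        (Y \<in> {Y. \<forall>i\<in>J. Y i = b i})"
        using assms(2) by (auto split: if_splits)
    qed
  qed auto
  finally show ?thesis .
qed

lemma avg_density:
  assumes "j \<in> {1..k}" "j \<notin> J" "J \<subseteq> {1..k}"
  shows "avg (\<sigma> j) (density (insert j J)) = density J"
proof
  fix x
  have fin: "finite J" using assms finite_subset by blast
  have ne: "\<sigma> i \<noteq> \<sigma> j" if "i \<in> J" for i
    using that assms inj by (auto dest!: inj_onD)
  let ?b = "\<lambda>i. retract (x (\<sigma> i))"
  have "avg (\<sigma> j) (density (insert j J)) x =
    (\<Sum>a\<in>set_pmf \<nu>. marg (insert j J) (?b(j := a)) / (\<Prod>i\<in>J. pmf \<nu> (?b i)))"
    unfolding avg_def
  proof (intro sum.cong refl)
    fix a assume a: "a \<in> set_pmf \<nu>"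
    have 1: "marg (insert j J) (\<lambda>i. retract ((x(\<sigma> j := a)) (\<sigma> i))) = marg (insert j J) (?b(j := a))"
      unfolding marg_def using a ne by (intro arg_cong[where f = "measure_pmf.prob \<mu>"]) auto
    have 2: "(\<Prod>i\<in>insert j J. pmf \<nu> (retract ((x(\<sigma> j := a)) (\<sigma> i)))) = pmf \<nu> a * (\<Prod>i\<in>J. pmf \<nu> (?b i))"
      using fin assms(2) a ne by (auto intro!: prod.cong)
    show "pmf \<nu> a * density (insert j J) (x(\<sigma> j := a)) =
        marg (insert j J) (?b(j := a)) / (\<Prod>i\<in>J. pmf \<nu> (?b i))"
      unfolding density_def 1 2 using nu_pos[OF a] by simp
  qed
  also have "\<dots> = density J x"
    using marg_sum[OF assms(1,2), of ?b] by (simp add: density_def sum_divide_distrib[symmetric])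
  finally show "avg (\<sigma> j) (density (insert j J)) x = density J x" .
qed

lemma av_density:
  assumes "finite J'" "J \<inter> J' = {}" "J \<union> J' \<subseteq> {1..k}"
  shows "av (\<sigma> ` J') (density (J \<union> J')) = density J"
  using assms
proof (induction J' arbitrary: J rule: finite_induct)
  case (insert j J')
  have "\<sigma> j \<notin> \<sigma> ` J'"
    using insert inj by (auto dest!: inj_onD)
  then have "av (\<sigma> ` insert j J') (density (J \<union> insert j J')) =
      avg (\<sigma> j) (av (\<sigma> ` J') (density (insert j J \<union> J')))"
    using insert by (simp add: av_insert)
  also have "av (\<sigma> ` J') (density (insert j J \<union> J')) = density (insert j J)"
    using insert by (intro insert.IH) auto
  also have "avg (\<sigma> j) \<dots> = density J"
    using insert by (intro avg_density) auto
  finally show ?case .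
qed simp

lemma density_one:
  assumes "T \<subseteq> {1..k}" "card T = t"
  shows "density T = (\<lambda>_. 1)"
proof
  fix x
  have "(\<Prod>i\<in>T. pmf \<nu> (retract (x (\<sigma> i)))) \<noteq> 0"
    using retract_in nu_pos by (auto simp: set_pmf_iff prod_zero_iff finite_subset[OF assms(1)])
  then show "density T x = 1" by (simp add: density_def marg_full[OF assms])
qed

text \<open>Independence speaks of exactly t indices, so the remaining ones are first enlarged to
  such a set T: averaging down to T gives 1, and averaging 1 further changes nothing.\<close>

lemma av_density_small:
  assumes "N \<subseteq> \<sigma> ` {1..k}" "card N \<le> t"
  shows "av (\<sigma> ` {1..k} - N) (density {1..k}) = (\<lambda>_. 1)"
proof -
  define J where "J = {i\<in>{1..k}. \<sigma> i \<in> N}"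
  have N: "N = \<sigma> ` J" using assms(1) by (auto simp: J_def)
  have "inj_on \<sigma> J" using inj by (rule inj_on_subset) (auto simp: J_def)
  then have "card J \<le> t" using assms(2) by (simp add: N card_image)
  then have "\<exists>T. J \<subseteq> T \<and> T \<subseteq> {1..k} \<and> card T = t"
    using t_le by (intro exists_subset_between) (auto simp: J_def)
  then obtain T where T: "J \<subseteq> T" "T \<subseteq> {1..k}" "card T = t" by blast
  have fin: "finite T" using T finite_subset by blast
  have disj: "\<sigma> ` (T - J) \<inter> \<sigma> ` ({1..k} - T) = {}"
    using inj T by (auto dest!: inj_onD)
  have "\<sigma> ` {1..k} - N = \<sigma> ` ({1..k} - J)"
    unfolding N using inj by (intro inj_on_image_set_diff[symmetric]) (auto simp: J_def)
  also have "{1..k} - J = (T - J) \<union> ({1..k} - T)" using T by auto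
  finally have "av (\<sigma> ` {1..k} - N) (density {1..k}) =
      av (\<sigma> ` (T - J)) (av (\<sigma> ` ({1..k} - T)) (density (T \<union> ({1..k} - T))))"
    using fin disj T(2) by (simp add: image_Un av_union Un_absorb1)
  also have "av (\<sigma> ` ({1..k} - T)) (density (T \<union> ({1..k} - T))) = density T"
    using T by (intro av_density) auto
  also have "av (\<sigma> ` (T - J)) (density T) = (\<lambda>_. 1)"
    using fin by (simp add: density_one[OF T(2,3)] av_one)
  finally show ?thesis .
qed

lemma density_nonneg: "density J x \<ge> 0"
  by (simp add: density_def marg_def prod_nonneg)

lemma density_depends: "depends_only (density J) (\<sigma> ` J)"
  unfolding depends_only_def
proof (intro allI impI)
  fix x y :: "'v \<Rightarrow> 'd" assume "\<forall>v\<in>\<sigma> ` J. x v = y v"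
  then have *: "\<And>i. i \<in> J \<Longrightarrow> x (\<sigma> i) = y (\<sigma> i)" by auto
  then show "density J x = density J y"
    unfolding density_def marg_def by (auto intro!: arg_cong2[where f="(/)"] arg_cong[where f="measure_pmf.prob \<mu>"] prod.cong)
qed

lemma density_support:
  assumes "set_pmf \<mu> \<subseteq> R" "R \<subseteq> extensional {1..k}"
    and x: "\<And>i. i \<in> {1..k} \<Longrightarrow> x (\<sigma> i) \<in> set_pmf \<nu>" and "density {1..k} x \<noteq> 0"
  shows "restrict (x \<circ> \<sigma>) {1..k} \<in> R"
proof -
  have "marg {1..k} (\<lambda>i. retract (x (\<sigma> i))) \<noteq> 0" using assms(4) by (auto simp: density_def)
  then have "\<exists>Y\<in>set_pmf \<mu>. \<forall>i\<in>{1..k}. Y i = retract (x (\<sigma> i))"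
    unfolding marg_def measure_pmf_zero_iff by blast
  then obtain Y where Y: "Y \<in> set_pmf \<mu>" "\<And>i. i \<in> {1..k} \<Longrightarrow> Y i = x (\<sigma> i)"
    using x by auto
  have "Y \<in> extensional {1..k}" using Y assms by auto
  then have "restrict (x \<circ> \<sigma>) {1..k} = Y"
    using Y(2) by (auto simp: fun_eq_iff extensional_def restrict_def)
  then show ?thesis using Y assms by auto
qed

end

text \<open>The averages run over the support of \<nu>, where \<nu> is positive. A single \<nu>
  serves all relations, so all densities refer to the same product measure. \<open>k \<le> d\<close>
  keeps the objective within the degree.\<close>

lemma plausible_instance_pseudo_distribution:
  fixes V :: "'v set" and f :: "'v set \<Rightarrow> ('v, 'd) csp_constraint option"
  assumes csp: "is_csp k D Rs" "twise_independent_csp t k D Rs" and t: "1 \<le> t" "t \<le> k"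
    and V: "finite V"
    and C: "C = {e. e \<subseteq> V \<and> card e = k \<and> f e \<noteq> None}" "C \<noteq> {}"
    and f: "\<And>e. e \<in> C \<Longrightarrow> \<exists>\<sigma> R. f e = Some (\<sigma>, R) \<and> bij_betw \<sigma> {1..k} e \<and> R \<in> Rs"
    and pl: "\<And>X. X \<subseteq> V \<Longrightarrow> card X \<le> M \<Longrightarrow> real (card X) \<le> L * real_of_int (potential t C X)"
    and M: "L > 0" "4 * L * real d \<le> real M" "k \<le> d" "d \<le> M"
  shows "\<exists>E. pseudo_distribution V D d E \<and>
    E (val_poly k (V, image_mset (\<lambda>e. the (f e)) (mset_set C))) = 1"
proof -
  have finD: "finite D" and Rs: "\<And>R. R \<in> Rs \<Longrightarrow> R \<subseteq> {1..k} \<rightarrow>\<^sub>E D"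
    using csp(1) by (auto simp: is_csp_def)
  obtain \<nu> where \<nu>: "set_pmf \<nu> \<subseteq> D"
    and "\<forall>R\<in>Rs. \<exists>\<mu>. set_pmf \<mu> \<subseteq> R \<and> twise_independent t k \<nu> \<mu>"
    using csp(2) by (auto simp: twise_independent_csp_def)
  then obtain \<mu> where \<mu>: "\<And>R. R \<in> Rs \<Longrightarrow> set_pmf (\<mu> R) \<subseteq> R"
    "\<And>R. R \<in> Rs \<Longrightarrow> twise_independent t k \<nu> (\<mu> R)" by metis
  have fin\<nu>: "finite (set_pmf \<nu>)" using \<nu> finD finite_subset by blast
  interpret averaging "pmf \<nu>" "set_pmf \<nu>"
    using fin\<nu> by unfold_locales (auto simp: pmf_positive sum_pmf_eq_1)
  obtain \<sigma> R where \<sigma>R: "\<And>e. e \<in> C \<Longrightarrow> f e = Some (\<sigma> e, R e) \<and> bij_betw (\<sigma> e) {1..k} e \<and> R e \<in> Rs"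
    using f by metis
  have loc: "twise_constraint \<nu> (\<mu> (R e)) t k (\<sigma> e)" if "e \<in> C" for e
    using \<sigma>R[OF that] \<mu> t by unfold_locales (auto simp: bij_betw_def)
  have img: "\<sigma> e ` {1..k} = e" if "e \<in> C" for e
    using \<sigma>R[OF that] by (auto simp: bij_betw_def)
  define w where "w = (\<lambda>e. twise_constraint.density \<nu> (\<mu> (R e)) (\<sigma> e) {1..k})"
  have fR: "finite (R e)" "R e \<subseteq> extensional {1..k}" if "e \<in> C" for e
  proof -
    have "R e \<subseteq> {1..k} \<rightarrow>\<^sub>E D" using Rs \<sigma>R[OF that] by blast
    moreover have "finite ({1..k} \<rightarrow>\<^sub>E D)" using finD by (intro finite_PiE) auto
    ultimately show "finite (R e)" by (rule finite_subset)
    show "R e \<subseteq> extensional {1..k}" using \<open>R e \<subseteq> {1..k} \<rightarrow>\<^sub>E D\<close> by (auto simp: PiE_def)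
  qed
  interpret plausible_csp "pmf \<nu>" "set_pmf \<nu>" V C w t M d L
  proof
    fix e assume e: "e \<in> C"
    show "e \<subseteq> V" using e C by auto
    show "e \<noteq> {}" using e C t by auto
    show "w e x \<ge> 0" for x
      unfolding w_def by (rule twise_constraint.density_nonneg[OF loc[OF e]])
    show "depends_only (w e) e"
      using twise_constraint.density_depends[OF loc[OF e], of "{1..k}"] img[OF e] by (simp add: w_def)
    show "av (e - N) (w e) = (\<lambda>_. 1)" if "N \<subseteq> e" "card N \<le> t" for N
      using twise_constraint.av_density_small[OF loc[OF e], of N] img[OF e] that by (simp add: w_def)
  next
    show "0 < M" using M t by linarith
  qed (use V pl M in auto)
  have one: "lin_ext mono_ex (\<Sum>b\<in>R e. \<Prod>i=1..k. mvar (\<sigma> e i, b i)) = 1" if e: "e \<in> C" for e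
  proof (rule mono_ex_constraint)
    fix x assume x: "\<And>v. v \<in> V \<Longrightarrow> x v \<in> set_pmf \<nu>" and "w (\<sigma> e ` {1..k}) x \<noteq> 0"
    then have "twise_constraint.density \<nu> (\<mu> (R e)) (\<sigma> e) {1..k} x \<noteq> 0"
      unfolding img[OF e] w_def by simp
    moreover have "x (\<sigma> e i) \<in> set_pmf \<nu>" if "i \<in> {1..k}" for i
      using x img[OF e] C_sub[OF e] that by blast
    ultimately show "restrict (x \<circ> \<sigma> e) {1..k} \<in> R e"
      using \<mu>(1) \<sigma>R[OF e] fR[OF e] by (intro twise_constraint.density_support[OF loc[OF e]]) auto
  qed (use e img fR M in auto)
  have "lin_ext mono_ex (val_poly k (V, image_mset (\<lambda>e. the (f e)) (mset_set C))) = 1"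
  proof -
    have "val_poly k (V, image_mset (\<lambda>e. the (f e)) (mset_set C)) =
      mconst (1 / real (card C)) * (\<Sum>e\<in>C. \<Sum>b\<in>R e. \<Prod>i=1..k. mvar (\<sigma> e i, b i))"
    proof -
      have "(\<Sum>(\<sigma>, R)\<in>#image_mset (\<lambda>e. the (f e)) (mset_set C). \<Sum>b\<in>R. \<Prod>i=1..k. mvar (\<sigma> i, b i)) =
        (\<Sum>e\<in>C. case the (f e) of (\<sigma>, R) \<Rightarrow> \<Sum>b\<in>R. \<Prod>i=1..k. mvar (\<sigma> i, b i))"
        by (simp add: sum_unfold_sum_mset multiset.map_comp comp_def)
      also have "\<dots> = (\<Sum>e\<in>C. \<Sum>b\<in>R e. \<Prod>i=1..k. mvar (\<sigma> e i, b i))"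
        using \<sigma>R by (intro sum.cong) auto
      finally show ?thesis by (simp add: val_poly_def)
    qed
    then show ?thesis
      using one finite_C C(2) by (simp add: lin_ext_mconst lin_ext_sum)
  qed
  then show ?thesis
    using mono_ex_pseudo_distribution[OF finD \<nu>] by blast
qed

section \<open>Plausibility of random instances\<close>

text \<open>Keeps a single term of the binomial expansion of (1 + v/n)^n \<le> e^v.\<close>

lemma choose_le_exp:
  assumes "0 < v" "v \<le> n"
  shows "real (n choose v) \<le> (real n / real v) ^ v * exp (real v)"
proof -
  let ?x = "real v / real n"
  have x: "?x > 0" using assms by simp
  have "real (n choose v) * ?x ^ v \<le> (\<Sum>i\<le>n. real (n choose i) * ?x ^ i * 1 ^ (n - i))"
    using assms x by (intro order_trans[OF _ member_le_sum[of v]]) auto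
  also have "\<dots> = (?x + 1) ^ n" by (rule binomial_ring[symmetric])
  also have "\<dots> \<le> exp ?x ^ n"
    using x by (intro power_mono) (auto simp: add.commute)
  also have "\<dots> = exp (real v)"
    using assms by (simp add: exp_of_nat_mult[symmetric])
  finally have "real (n choose v) \<le> exp (real v) / ?x ^ v"
    using x by (simp add: pos_le_divide_eq)
  then show ?thesis using assms by (simp add: power_divide mult.commute)
qed

lemma choose_le_power: "n choose r \<le> n ^ r"
  by (cases "r \<le> n") (auto simp: binomial_le_pow binomial_eq_0)

lemma card_edges_meeting:
  assumes "finite V" "X \<subseteq> V"
  shows "card {e. e \<subseteq> V \<and> card e = k \<and> card (e \<inter> X) = j} \<le> card X ^ j * card V ^ (k - j)"
proof -
  have finX: "finite X" using assms finite_subset by blast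
  let ?A = "{a. a \<subseteq> X \<and> card a = j}" and ?B = "{b. b \<subseteq> V \<and> card b = k - j}"
  let ?S = "{e. e \<subseteq> V \<and> card e = k \<and> card (e \<inter> X) = j}"
  have "card ?S \<le> card (?A \<times> ?B)"
  proof (rule card_inj_on_le)
    show "inj_on (\<lambda>e. (e \<inter> X, e - X)) ?S" by (rule inj_onI) blast
    show "(\<lambda>e. (e \<inter> X, e - X)) ` ?S \<subseteq> ?A \<times> ?B"
    proof safe
      fix e assume e: "e \<subseteq> V"
      then have "finite e" using assms finite_subset by blast
      then show "card (e - X) = card e - card (e \<inter> X)" by (simp add: card_Diff_subset_Int)
    qed auto
    show "finite (?A \<times> ?B)" using finX assms by (intro finite_cartesian_product) auto
  qed
  also have "\<dots> = (card X choose j) * (card V choose (k - j))"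
    using finX assms by (simp add: card_cartesian_product n_subsets)
  also have "\<dots> \<le> card X ^ j * card V ^ (k - j)"
    by (intro mult_mono choose_le_power) auto
  finally show ?thesis .
qed

text \<open>Exponential Markov inequality in base B: independence of the edges turns the moment into
  a product, and 1 + z \<le> e^z turns this into the exponential of a sum. The law of an edge enters
  only through the probability of \<open>None\<close>.\<close>

lemma selected_sum_tail:
  fixes q :: "'e \<Rightarrow> 'a option pmf"
  assumes K: "finite K" and q: "\<And>e. e \<in> K \<Longrightarrow> pmf (q e) None = 1 - p" and p: "0 \<le> p"
    and B: "B \<ge> 1" and u: "\<And>e. e \<in> K \<Longrightarrow> u e \<ge> 0"
  shows "measure_pmf.prob (Pi_pmf K None q) {f. a \<le> (\<Sum>e\<in>{e\<in>K. f e \<noteq> None}. u e)}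
    \<le> exp (p * (\<Sum>e\<in>K. B powr u e - 1)) / B powr a"
proof -
  define F where "F = (\<lambda>e (y :: 'a option). if y = None then 1 else B powr u e)"
  have F_eq: "F e = (\<lambda>y. B powr u e + (1 - B powr u e) * indicator {None} y)" for e
    by (auto simp: F_def)
  have F_nonneg: "F e y \<ge> 0" for e y by (simp add: F_def)
  have intF: "integrable (measure_pmf (q e)) (F e)" for e
    by (rule measure_pmf.integrable_const_bound[where B = "1 + B powr u e"]) (auto simp: F_def)
  have expF: "measure_pmf.expectation (q e) (F e) = 1 + p * (B powr u e - 1)" if "e \<in> K" for e
  proof -
    have "integrable (measure_pmf (q e)) (indicator {None} :: 'a option \<Rightarrow> real)"
      by (rule measure_pmf.integrable_const_bound[where B = 1]) auto
    then have "measure_pmf.expectation (q e) (F e) = B powr u e + (1 - B powr u e) * (1 - p)"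
      unfolding F_eq by (simp add: measure_pmf_single q[OF that])
    then show ?thesis by (simp add: algebra_simps)
  qed
  have prodF: "(\<Prod>e\<in>K. F e (f e)) = B powr (\<Sum>e\<in>{e\<in>K. f e \<noteq> None}. u e)" for f
  proof -
    have "(\<Prod>e\<in>K. F e (f e)) = (\<Prod>e\<in>{e\<in>K. f e \<noteq> None}. B powr u e)"
      by (rule prod.mono_neutral_cong_right) (auto simp: K F_def)
    then show ?thesis using B by (simp add: powr_sum K)
  qed
  let ?M = "measure_pmf (Pi_pmf K None q)"
  have "measure ?M {f. a \<le> (\<Sum>e\<in>{e\<in>K. f e \<noteq> None}. u e)} \<le>
      measure ?M {f \<in> space ?M. B powr a \<le> (\<Prod>e\<in>K. F e (f e))}"
    unfolding prodF using B by (intro measure_pmf.finite_measure_mono) (auto intro!: powr_mono)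
  also have "\<dots> \<le> measure_pmf.expectation (Pi_pmf K None q) (\<lambda>f. \<Prod>e\<in>K. F e (f e)) / B powr a"
    using B by (intro integral_Markov_inequality_measure[where A = "{}"] integrable_prod_Pi_pmf K intF)
               (auto intro!: prod_nonneg F_nonneg)
  also have "measure_pmf.expectation (Pi_pmf K None q) (\<lambda>f. \<Prod>e\<in>K. F e (f e)) =
      (\<Prod>e\<in>K. 1 + p * (B powr u e - 1))"
    by (subst expectation_prod_Pi_pmf[OF K intF F_nonneg]) (simp add: expF)
  also have "\<dots> \<le> (\<Prod>e\<in>K. exp (p * (B powr u e - 1)))"
    using p B u by (intro prod_mono) (auto intro!: add_nonneg_nonneg mult_nonneg_nonneg ge_one_powr_ge_zero)
  also have "\<dots> = exp (p * (\<Sum>e\<in>K. B powr u e - 1))"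
    by (simp add: exp_sum[symmetric] K sum_distrib_left)
  finally show ?thesis using B by (simp add: divide_right_mono)
qed

text \<open>Group the edges by j = |e \<inter> X|. There are at most |X|^j n^(k-j) = n^k y^(-j) of
  them, and the y in the base cancels y^(-j), so each j gives the same power y^(-(t+1)/2). Edges
  below the threshold contribute 0 because of the subtracted 1.\<close>

lemma excess_moment:
  fixes V :: "'v set" and \<beta> :: real
  assumes V: "finite V" and X: "X \<subseteq> V" "X \<noteq> {}" and \<beta>: "\<beta> \<ge> 1" and t: "t \<le> k"
  defines "y \<equiv> real (card V) / real (card X)"
  shows "(\<Sum>e\<in>{e. e \<subseteq> V \<and> card e = k}. (y * \<beta>) powr (real_of_int (excess t e X) / 2) - 1)
    \<le> real (k + 1) * real (card V) ^ k * y powr (- (real t + 1) / 2) * \<beta> ^ k"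
proof -
  let ?K = "{e. e \<subseteq> V \<and> card e = k}"
  define n where "n = card V"
  define v where "v = card X"
  define \<tau> where "\<tau> = (real t + 1) / 2"
  have v: "0 < v" "v \<le> n"
    using X V finite_subset[OF X(1) V] by (auto simp: v_def n_def card_gt_0_iff intro: card_mono)
  have y: "y \<ge> 1" "y = real n / real v" using v by (auto simp: y_def n_def v_def)
  have B: "y * \<beta> \<ge> 1" using y \<beta> mult_mono[of 1 y 1 \<beta>] by simp
  define h where "h = (\<lambda>j. if t + 1 \<le> 2 * j then (y * \<beta>) powr (real j - \<tau>) else 0)"
  have finK: "finite ?K" using V by auto
  have "(\<Sum>e\<in>?K. (y * \<beta>) powr (real_of_int (excess t e X) / 2) - 1) \<le> (\<Sum>e\<in>?K. h (card (e \<inter> X)))"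
  proof (rule sum_mono)
    fix e
    show "(y * \<beta>) powr (real_of_int (excess t e X) / 2) - 1 \<le> h (card (e \<inter> X))"
    proof (cases "t + 1 \<le> 2 * card (e \<inter> X)")
      case True
      then have "real_of_int (excess t e X) / 2 = real (card (e \<inter> X)) - \<tau>"
        by (simp add: excess_def \<tau>_def field_simps)
      then have "(y * \<beta>) powr (real_of_int (excess t e X) / 2) = (y * \<beta>) powr (real (card (e \<inter> X)) - \<tau>)"
        by (rule arg_cong)
      then show ?thesis using True by (simp add: h_def)
    next
      case False
      then have "excess t e X = 0" by (simp add: excess_def)
      then show ?thesis using B False by (simp add: h_def)
    qed
  qed
  also have "\<dots> = (\<Sum>j\<in>{..k}. \<Sum>e\<in>{e\<in>?K. card (e \<inter> X) = j}. h (card (e \<inter> X)))"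
  proof (rule sum.group[symmetric])
    show "(\<lambda>e. card (e \<inter> X)) ` ?K \<subseteq> {..k}"
      using V by (auto intro!: card_mono dest: finite_subset)
  qed (auto simp: finK)
  also have "\<dots> \<le> (\<Sum>j\<in>{..k}. real n ^ k * y powr (- \<tau>) * \<beta> ^ k)"
  proof (rule sum_mono)
    fix j assume j: "j \<in> {..k}"
    have "(\<Sum>e\<in>{e\<in>?K. card (e \<inter> X) = j}. h (card (e \<inter> X))) =
        real (card {e\<in>?K. card (e \<inter> X) = j}) * h j" by simp
    also have "\<dots> \<le> (real v ^ j * real n ^ (k - j)) * h j"
    proof (rule mult_right_mono)
      have "card {e\<in>?K. card (e \<inter> X) = j} \<le> v ^ j * n ^ (k - j)"
        using card_edges_meeting[OF V X(1), of k j] by (simp add: v_def n_def conj_assoc)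
      then show "real (card {e\<in>?K. card (e \<inter> X) = j}) \<le> real v ^ j * real n ^ (k - j)"
        using of_nat_mono[where 'a = real] by fastforce
    qed (simp add: h_def)
    also have "\<dots> \<le> real n ^ k * y powr (- \<tau>) * \<beta> ^ k"
    proof (cases "t + 1 \<le> 2 * j")
      case True
      have 1: "real v ^ j * real n ^ (k - j) = real n ^ k * y powr (- real j)"
      proof -
        have "real n ^ k = real n ^ j * real n ^ (k - j)" using j by (simp add: power_add[symmetric])
        moreover have "y powr (- real j) = real v ^ j / real n ^ j"
          using y v by (simp add: powr_minus powr_realpow power_divide)
        ultimately show ?thesis using v by simp
      qed
      have 2: "h j = y powr (real j - \<tau>) * \<beta> powr (real j - \<tau>)"
        using True y(1) \<beta> by (simp add: h_def powr_mult)
      have "\<beta> powr (real j - \<tau>) \<le> \<beta> powr (real k)"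
      proof (rule powr_mono)
        have "\<tau> \<ge> 0" by (simp add: \<tau>_def)
        moreover have "real j \<le> real k" using j by simp
        ultimately show "real j - \<tau> \<le> real k" by linarith
      qed (use \<beta> in simp)
      then have 3: "\<beta> powr (real j - \<tau>) \<le> \<beta> ^ k" using \<beta> by (simp add: powr_realpow)
      have "(real v ^ j * real n ^ (k - j)) * h j =
          real n ^ k * (y powr (- real j) * y powr (real j - \<tau>)) * \<beta> powr (real j - \<tau>)"
        unfolding 1 2 by simp
      also have "y powr (- real j) * y powr (real j - \<tau>) = y powr (- \<tau>)"
        by (simp add: powr_add[symmetric])
      also have "real n ^ k * y powr (- \<tau>) * \<beta> powr (real j - \<tau>) \<le> real n ^ k * y powr (- \<tau>) * \<beta> ^ k"
        using 3 by (intro mult_left_mono) auto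
      finally show ?thesis .
    qed (use \<beta> in \<open>auto simp: h_def\<close>)
    finally show "(\<Sum>e\<in>{e\<in>?K. card (e \<inter> X) = j}. h (card (e \<inter> X))) \<le> real n ^ k * y powr (- \<tau>) * \<beta> ^ k" .
  qed
  also have "\<dots> = real (k + 1) * real n ^ k * y powr (- \<tau>) * \<beta> ^ k" by simp
  finally show ?thesis by (simp only: n_def \<tau>_def minus_divide_left)
qed

text \<open>1 + ln y is the entropy of choosing X, per element. In the difference only \<delta> ln y
  is left of ln y: its part in \<Delta> is bounded since \<delta> ln \<Delta> = 1/(16k), and its
  part in u is smaller than the gain from \<beta>.\<close>

lemma exponent_estimate:
  fixes y u A \<Delta> :: real and k t :: nat
  assumes k: "2 \<le> k" and t: "2 \<le> t" and \<Delta>: "2 \<le> \<Delta>" and A: "0 \<le> A"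
    and u: "0 < u" "u \<le> exp (- 8 * real k * (4 + A))" and y: "y = \<Delta> powr (2 / (real t - 1)) / u"
  defines "\<delta> \<equiv> 1 / (16 * real k * ln \<Delta>)"
  shows "1 + A + ln y - (1 - \<delta>) * (ln y + ln (u powr (- 1 / (2 * real k))))
    \<le> - 2 + ln u / (8 * real k)"
proof -
  define l where "l = - ln u"
  have l: "8 * real k * (4 + A) \<le> l"
    using u ln_le_cancel_iff[of u "exp (- 8 * real k * (4 + A))"] by (simp add: l_def)
  have l0: "l \<ge> 0" using l A by (intro order_trans[OF _ l]) auto
  have ln2: "2 / 3 \<le> ln \<Delta>"
    using ln2_ge_two_thirds \<Delta> ln_le_cancel_iff[of 2 \<Delta>] by linarith
  have \<delta>0: "\<delta> > 0" using k ln2 by (simp add: \<delta>_def)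
  have \<delta>ln: "\<delta> * ln \<Delta> = 1 / (16 * real k)" using k ln2 by (simp add: \<delta>_def)
  have \<delta>k: "\<delta> * real k \<le> 3 / 32"
  proof -
    have "\<delta> * real k = 1 / (16 * ln \<Delta>)" using k by (simp add: \<delta>_def)
    also have "\<dots> \<le> 1 / (16 * (2 / 3))" using ln2 by (intro divide_left_mono) auto
    finally show ?thesis by simp
  qed
  have lny: "ln y \<le> 2 * ln \<Delta> + l"
  proof -
    have "ln y = 2 / (real t - 1) * ln \<Delta> + l"
      using y u \<Delta> by (simp add: ln_div ln_powr l_def)
    moreover have "2 / (real t - 1) * ln \<Delta> \<le> 2 * ln \<Delta>"
      using t ln2 by (intro mult_right_mono) (auto simp: field_simps)
    ultimately show ?thesis by linarith
  qed
  have ln\<beta>: "ln (u powr (- 1 / (2 * real k))) = l / (2 * real k)"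
    using u by (simp add: ln_powr l_def)
  have "1 + A + ln y - (1 - \<delta>) * (ln y + l / (2 * real k)) =
      1 + A + \<delta> * ln y - (1 - \<delta>) * (l / (2 * real k))" by (simp add: algebra_simps)
  also have "\<dots> \<le> 1 + A + \<delta> * (2 * ln \<Delta> + l) - (1 - \<delta>) * (l / (2 * real k))"
    using lny \<delta>0 by (intro diff_right_mono add_left_mono mult_left_mono) auto
  also have "\<dots> = 1 + A + 2 * (\<delta> * ln \<Delta>) + (l / real k) * (\<delta> * real k - 1 / 2 + \<delta> / 2)"
    using k by (simp add: field_simps)
  \<comment> \<open>\<delta> k \<le> 3/32 and \<delta> \<le> \<delta> k / 2 bring the bracket below
    -1/4.\<close>
  also have "\<dots> \<le> 1 + A + 1 + (l / real k) * (- 1 / 4)"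
  proof (intro add_mono mult_left_mono order_refl)
    show "2 * (\<delta> * ln \<Delta>) \<le> 1" using k by (simp add: \<delta>ln)
    have "\<delta> * 2 \<le> \<delta> * real k" using k \<delta>0 by (intro mult_left_mono) auto
    then show "\<delta> * real k - 1 / 2 + \<delta> / 2 \<le> - 1 / 4" using \<delta>k by linarith
    show "0 \<le> l / real k" using l0 by simp
  qed
  \<comment> \<open>Half of l / (4k) absorbs the constants, which is where the threshold for u comes
    from; the other half is the final decay.\<close>
  also have "\<dots> \<le> - 2 - l / (8 * real k)"
  proof -
    define z where "z = l / (8 * real k)"
    have "4 + A \<le> z" using l k by (simp add: z_def pos_le_divide_eq mult.commute)
    then have "2 + A - 2 * z \<le> - 2 - z" by linarith
    moreover have "1 + A + 1 + (l / real k) * (- 1 / 4) = 2 + A - 2 * z" by (simp add: z_def)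
    ultimately show ?thesis by (simp only: z_def)
  qed
  finally show ?thesis unfolding ln\<beta> by (simp add: l_def)
qed


text \<open>
  The base \<open>y * \<beta>\<close> of the exponential moment has \<open>\<beta> = u\<^bsup>-1/(2k)\<^esup>\<close>: then the moment stays bounded by
  \<open>exp (O(|X|))\<close>, while \<open>\<beta>\<^bsup>-|X|\<^esup>\<close> compensates the loss from \<open>\<delta>\<close> in the union bound.
\<close>

lemma implausible_set_prob:
  fixes V :: "'v set" and q :: "'v set \<Rightarrow> 'a option pmf" and \<Delta> :: real
  assumes V: "finite V" and X: "X \<subseteq> V" "X \<noteq> {}" and k: "2 \<le> k" "k \<le> card V" and t: "2 \<le> t" "t \<le> k"
    and \<Delta>: "2 \<le> \<Delta>"
    and q: "\<And>e. e \<subseteq> V \<Longrightarrow> card e = k \<Longrightarrow> pmf (q e) None = 1 - \<Delta> * real (card V) / real (card V choose k)"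
    and y: "y = real (card V) / real (card X)" and u: "u = \<Delta> powr (2 / (real t - 1)) / y" "u \<le> 1"
  defines "\<delta> \<equiv> 1 / (16 * real k * ln \<Delta>)"
  shows "measure_pmf.prob (Pi_pmf {e. e \<subseteq> V \<and> card e = k} None q)
      {f. 8 * real k * ln \<Delta> * real_of_int (potential t {e. e \<subseteq> V \<and> card e = k \<and> f e \<noteq> None} X) < real (card X)}
    \<le> exp (real (card X) * (real (k + 1) * real k ^ k
        - (1 - \<delta>) * (ln y + ln (u powr (- 1 / (2 * real k))))))"
proof -
  let ?K = "{e. e \<subseteq> V \<and> card e = k}"
  define n where "n = card V"
  define v where "v = card X"
  define \<beta> where "\<beta> = u powr (- 1 / (2 * real k))"
  define p where "p = \<Delta> * real n / real (n choose k)"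
  have v: "0 < v" "v \<le> n"
    using X V finite_subset[OF X(1) V] by (auto simp: v_def n_def card_gt_0_iff intro: card_mono)
  have y1: "y \<ge> 1" "real n = y * real v" using v by (auto simp: y n_def[symmetric] v_def[symmetric])
  have ln\<Delta>: "ln \<Delta> > 0" using \<Delta> by simp
  have u0: "u > 0" using u y1 \<Delta> by simp
  have \<beta>1: "\<beta> \<ge> 1"
  proof -
    have "u powr (1 / (2 * real k)) \<le> 1" using u0 u by (intro powr_le1) auto
    then show ?thesis using u0 by (simp add: \<beta>_def powr_minus one_le_inverse)
  qed
  have B1: "y * \<beta> \<ge> 1" using mult_mono[of 1 y 1 \<beta>] y1 \<beta>1 by simp
  have choose_pos: "real (n choose k) > 0" using k by (simp add: n_def)
  have p0: "p \<ge> 0" using \<Delta> by (simp add: p_def)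
  have p_le: "p \<le> \<Delta> * real n * real k ^ k / real n ^ k"
  proof -
    have "(real n / real k) ^ k \<le> real (n choose k)"
      using k by (intro binomial_ge_n_over_k_pow_k) (simp add: n_def)
    then have "p \<le> \<Delta> * real n / (real n / real k) ^ k"
      unfolding p_def using \<Delta> choose_pos v k by (intro divide_left_mono) auto
    then show ?thesis by (simp add: power_divide)
  qed
  \<comment> \<open>8 k ln \<Delta> equals 1 / (2 \<delta>): failure means phi X < 2 \<delta> |X|,
    that is, half-excesses adding up to more than (1 - \<delta>) |X|.\<close>
  have "{f :: 'v set \<Rightarrow> 'a option. 8 * real k * ln \<Delta> *
        real_of_int (potential t {e. e \<subseteq> V \<and> card e = k \<and> f e \<noteq> None} X) < real (card X)} \<subseteq>
      {f. (1 - \<delta>) * real v \<le> (\<Sum>e\<in>{e\<in>?K. f e \<noteq> None}. real_of_int (excess t e X) / 2)}" (is "?bad \<subseteq> ?tail")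
  proof
    fix f :: "'v set \<Rightarrow> 'a option"
    let ?s = "\<Sum>e\<in>{e\<in>?K. f e \<noteq> None}. real_of_int (excess t e X)"
    assume "f \<in> ?bad"
    then have "8 * real k * ln \<Delta> * real_of_int (potential t {e. e \<subseteq> V \<and> card e = k \<and> f e \<noteq> None} X) < real (card X)"
      by simp
    moreover have "real_of_int (potential t {e. e \<subseteq> V \<and> card e = k \<and> f e \<noteq> None} X) = 2 * real v - ?s"
      by (simp add: potential_def v_def conj_assoc)
    ultimately have "8 * real k * ln \<Delta> * (2 * real v - ?s) < real v" by (simp add: v_def)
    then have "2 * real v - ?s < real v / (8 * real k * ln \<Delta>)"
      using k ln\<Delta> by (simp add: pos_less_divide_eq mult.commute)
    moreover have "real v / (8 * real k * ln \<Delta>) = 2 * (\<delta> * real v)"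
      by (simp add: \<delta>_def)
    ultimately have "(1 - \<delta>) * real v \<le> ?s / 2" by (simp add: left_diff_distrib)
    then show "f \<in> ?tail"
      by (simp add: sum_divide_distrib)
  qed
  then have "measure_pmf.prob (Pi_pmf ?K None q)
      {f. 8 * real k * ln \<Delta> * real_of_int (potential t {e. e \<subseteq> V \<and> card e = k \<and> f e \<noteq> None} X) < real (card X)}
    \<le> measure_pmf.prob (Pi_pmf ?K None q)
      {f. (1 - \<delta>) * real v \<le> (\<Sum>e\<in>{e\<in>?K. f e \<noteq> None}. real_of_int (excess t e X) / 2)}"
    by (intro measure_pmf.finite_measure_mono) auto
  also have "\<dots> \<le> exp (p * (\<Sum>e\<in>?K. (y * \<beta>) powr (real_of_int (excess t e X) / 2) - 1)) / (y * \<beta>) powr ((1 - \<delta>) * real v)"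
    using V q p0 B1 by (intro selected_sum_tail) (auto simp: p_def n_def)
  also have "\<dots> \<le> exp (real (k + 1) * real k ^ k * real v) / (y * \<beta>) powr ((1 - \<delta>) * real v)"
  proof (intro divide_right_mono iffD2[OF exp_le_cancel_iff])
    let ?S = "\<Sum>e\<in>?K. (y * \<beta>) powr (real_of_int (excess t e X) / 2) - 1"
    have "?S \<le> real (k + 1) * real n ^ k * y powr (- (real t + 1) / 2) * \<beta> ^ k"
      using excess_moment[OF V X \<beta>1 t(2)] by (simp add: y n_def)
    moreover have "?S \<ge> 0" using B1 by (intro sum_nonneg) (simp add: ge_one_powr_ge_zero)
    ultimately have "p * ?S \<le> (\<Delta> * real n * real k ^ k / real n ^ k) *
        (real (k + 1) * real n ^ k * y powr (- (real t + 1) / 2) * \<beta> ^ k)"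
      using p_le p0 \<Delta> by (intro mult_mono) auto
    also have "\<dots> = real (k + 1) * real k ^ k * (\<Delta> * (real n * y powr (- (real t + 1) / 2)) * \<beta> ^ k)"
      using v by simp
    also have "real n * y powr (- (real t + 1) / 2) = real v * y powr (- (real t - 1) / 2)"
    proof -
      have "y powr (- (real t - 1) / 2) = y powr (1 + (- (real t + 1) / 2))"
        by (intro arg_cong[where f = "(powr) y"]) (simp add: field_simps)
      also have "\<dots> = y * y powr (- (real t + 1) / 2)" using y1 by (simp only: powr_add) simp
      finally show ?thesis using y1 by simp
    qed
    \<comment> \<open>\<Delta> and y combine to u^((t-1)/2), and \<beta>^k = u^(-1/2). For t = 2
      these cancel, so \<beta> is as large as this bound permits; for larger t a positive power of u
      \<le> 1 remains.\<close>
    also have "\<Delta> * (real v * y powr (- (real t - 1) / 2)) * \<beta> ^ k = real v * u powr ((real t - 2) / 2)"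
    proof -
      have "y = \<Delta> powr (2 / (real t - 1)) * u powr (- 1)"
      proof -
        have "y \<noteq> 0" "u * y = \<Delta> powr (2 / (real t - 1))" using u(1) y1 by auto
        then have "y = \<Delta> powr (2 / (real t - 1)) / u" using u0 by (simp add: field_simps)
        then show ?thesis using u0 by (simp add: powr_minus divide_inverse)
      qed
      then have "y powr (- (real t - 1) / 2) = (\<Delta> powr (2 / (real t - 1))) powr (- (real t - 1) / 2) *
          (u powr (- 1)) powr (- (real t - 1) / 2)"
        by (simp only: powr_mult powr_ge_zero)
      also have "\<dots> = \<Delta> powr (- 1) * u powr ((real t - 1) / 2)"
      proof -
        have "2 / (real t - 1) * (- (real t - 1) / 2) = - 1" "- 1 * (- (real t - 1) / 2) = (real t - 1) / 2"
          using t by (simp_all add: field_simps)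
        then show ?thesis by (simp only: powr_powr)
      qed
      finally have 1: "\<Delta> * y powr (- (real t - 1) / 2) = u powr ((real t - 1) / 2)"
        using \<Delta> by (simp add: powr_minus)
      have 2: "\<beta> ^ k = u powr (- 1 / 2)"
        using k u0 \<beta>1 by (simp add: \<beta>_def powr_realpow[symmetric] powr_powr)
      have 3: "u powr ((real t - 1) / 2) * u powr (- 1 / 2) = u powr ((real t - 2) / 2)"
      proof -
        have "(real t - 1) / 2 + - 1 / 2 = (real t - 2) / 2" by (simp add: field_simps)
        then show ?thesis by (simp only: powr_add[symmetric])
      qed
      have "\<Delta> * (real v * y powr (- (real t - 1) / 2)) * \<beta> ^ k =
          real v * ((\<Delta> * y powr (- (real t - 1) / 2)) * \<beta> ^ k)" by (simp only: mult_ac)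
      then show ?thesis unfolding 1 2 3 .
    qed
    also have "u powr ((real t - 2) / 2) \<le> 1"
      using u0 u t by (intro powr_le1) auto
    finally show "p * ?S \<le> real (k + 1) * real k ^ k * real v"
      by (simp add: mult_left_mono)
  qed simp
  also have "(y * \<beta>) powr ((1 - \<delta>) * real v) = exp ((1 - \<delta>) * real v * (ln y + ln \<beta>))"
    using y1 \<beta>1 by (simp add: powr_def ln_mult)
  also have "exp (real (k + 1) * real k ^ k * real v) / exp ((1 - \<delta>) * real v * (ln y + ln \<beta>)) =
      exp (real v * (real (k + 1) * real k ^ k - (1 - \<delta>) * (ln y + ln \<beta>)))"
    by (simp add: exp_diff[symmetric] algebra_simps)
  finally show ?thesis by (simp add: v_def \<beta>_def)
qed

text \<open>Union bound by the size v of X: level v contributes at most 2^(-v) \<rho>^(1/(8k)). The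
  hypothesis on M keeps u = \<rho> v below the threshold of \<open>exponent_estimate\<close> at
  every level.\<close>

lemma implausible_prob:
  fixes V :: "'v set" and q :: "'v set \<Rightarrow> 'a option pmf" and \<Delta> :: real
  assumes V: "finite V" and k: "2 \<le> k" "k \<le> card V" and t: "2 \<le> t" "t \<le> k" and \<Delta>: "2 \<le> \<Delta>"
    and q: "\<And>e. e \<subseteq> V \<Longrightarrow> card e = k \<Longrightarrow> pmf (q e) None = 1 - \<Delta> * real (card V) / real (card V choose k)"
    and M: "\<Delta> powr (2 / (real t - 1)) * real M
      \<le> exp (- 8 * real k * (4 + real (k + 1) * real k ^ k)) * real (card V)"
  shows "measure_pmf.prob (Pi_pmf {e. e \<subseteq> V \<and> card e = k} None q)
      {f. \<exists>X\<subseteq>V. card X \<le> M \<and>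
        8 * real k * ln \<Delta> * real_of_int (potential t {e. e \<subseteq> V \<and> card e = k \<and> f e \<noteq> None} X) < real (card X)}
    \<le> (\<Delta> powr (2 / (real t - 1)) / real (card V)) powr (1 / (8 * real k))"
proof -
  let ?K = "{e. e \<subseteq> V \<and> card e = k}"
  let ?P = "measure_pmf.prob (Pi_pmf ?K None q)"
  define n where "n = card V"
  define A where "A = real (k + 1) * real k ^ k"
  define \<rho> where "\<rho> = \<Delta> powr (2 / (real t - 1)) / real n"
  define \<delta> where "\<delta> = 1 / (16 * real k * ln \<Delta>)"
  define bad where "bad = (\<lambda>X. {f :: 'v set \<Rightarrow> 'a option. 8 * real k * ln \<Delta> *
      real_of_int (potential t {e. e \<subseteq> V \<and> card e = k \<and> f e \<noteq> None} X) < real (card X)})"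
  define sub where "sub = (\<lambda>v. {X. X \<subseteq> V \<and> card X = v})"
  have n: "n > 0" using k by (simp add: n_def)
  have A0: "A \<ge> 0" by (simp add: A_def)
  have \<rho>0: "\<rho> > 0" using \<Delta> n by (simp add: \<rho>_def)
  have \<rho>M: "\<rho> * real M \<le> exp (- 8 * real k * (4 + A))"
    using M n by (simp add: \<rho>_def A_def n_def[symmetric] field_simps)
  have \<Delta>1: "\<Delta> powr (2 / (real t - 1)) \<ge> 1" using \<Delta> t by (intro ge_one_powr_ge_zero) auto
  have level: "(\<Sum>X\<in>sub v. ?P (bad X)) \<le> (1 / 2) ^ v * \<rho> powr (1 / (8 * real k))"
    if v: "v \<in> {1..M}" for v
  proof (cases "v \<le> n")
    case False
    have "sub v = {}" using False V card_mono[OF V] by (auto simp: sub_def n_def)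
    then show ?thesis by simp
  next
    case True
    define y where "y = real n / real v"
    define u where "u = \<rho> * real v"
    have y0: "y > 0" using v n by (simp add: y_def)
    have u0: "u > 0" using v \<rho>0 by (simp add: u_def)
    have uM: "u \<le> exp (- 8 * real k * (4 + A))"
    proof -
      have "u \<le> \<rho> * real M" unfolding u_def using v \<rho>0 by (intro mult_left_mono) auto
      then show ?thesis using \<rho>M by linarith
    qed
    also have "\<dots> \<le> 1" using A0 by (simp add: mult_nonneg_nonneg)
    finally have u1: "u \<le> 1" .
    have uy: "u = \<Delta> powr (2 / (real t - 1)) / y" by (simp add: u_def \<rho>_def y_def)
    define G where "G = A - (1 - \<delta>) * (ln y + ln (u powr (- 1 / (2 * real k))))"
    have single: "?P (bad X) \<le> exp (real v * G)" if "X \<in> sub v" for X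
    proof -
      have X: "X \<subseteq> V" "card X = v" "X \<noteq> {}" using that v by (auto simp: sub_def)
      have "?P (bad X) \<le> exp (real (card X) * (real (k + 1) * real k ^ k
        - (1 - 1 / (16 * real k * ln \<Delta>)) * (ln y + ln (u powr (- 1 / (2 * real k))))))"
        unfolding bad_def using X y_def uy u1
        by (intro implausible_set_prob V k t \<Delta> q) (auto simp: n_def)
      then show ?thesis by (simp only: X(2) G_def A_def \<delta>_def)
    qed
    have "(\<Sum>X\<in>sub v. ?P (bad X)) \<le> real (n choose v) * exp (real v * G)"
      using sum_bounded_above[of "sub v" "\<lambda>X. ?P (bad X)", OF single] V
      by (simp add: sub_def n_subsets n_def)
    also have "\<dots> \<le> (y ^ v * exp (real v)) * exp (real v * G)"
      unfolding y_def using v True by (intro mult_right_mono choose_le_exp) auto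
    also have "\<dots> = exp (real v * (1 + A + ln y - (1 - \<delta>) * (ln y + ln (u powr (- 1 / (2 * real k))))))"
    proof -
      have "y ^ v = exp (real v * ln y)" using y0 by (simp add: exp_of_nat_mult)
      then show ?thesis by (simp add: G_def exp_add[symmetric] algebra_simps)
    qed
    also have "\<dots> \<le> exp (real v * (- 2 + ln u / (8 * real k)))"
    proof (intro iffD2[OF exp_le_cancel_iff] mult_left_mono)
      have "y = \<Delta> powr (2 / (real t - 1)) / u" using uy y0 u0 by (simp add: field_simps)
      from exponent_estimate[OF k(1) t(1) \<Delta> A0 u0 uM this]
      show "1 + A + ln y - (1 - \<delta>) * (ln y + ln (u powr (- 1 / (2 * real k)))) \<le> - 2 + ln u / (8 * real k)"
        by (simp add: \<delta>_def)
    qed simp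
    also have "\<dots> = exp (- 2 * real v) * exp (real v * (ln u / (8 * real k)))"
      by (simp add: exp_add[symmetric] algebra_simps)
    \<comment> \<open>Of the v factors u^(1/(8k)), each at most 1, one is kept; it carries the decay
      in n.\<close>
    also have "\<dots> \<le> exp (- 2 * real v) * exp (1 * (ln u / (8 * real k)))"
    proof (intro mult_left_mono iffD2[OF exp_le_cancel_iff] mult_right_mono_neg)
      show "ln u / (8 * real k) \<le> 0" using u0 u1 by (simp add: divide_nonpos_nonneg)
    qed (use v in auto)
    also have "exp (1 * (ln u / (8 * real k))) = u powr (1 / (8 * real k))"
      using u0 by (simp add: powr_def)
    also have "\<dots> = \<rho> powr (1 / (8 * real k)) * real v powr (1 / (8 * real k))"
      using \<rho>0 v by (simp add: u_def powr_mult)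
    \<comment> \<open>The factor v^(1/(8k)) left over from u = \<rho> v uses up e^v of the available
      e^(-2v).\<close>
    also have "exp (- 2 * real v) * (\<rho> powr (1 / (8 * real k)) * real v powr (1 / (8 * real k))) \<le>
        exp (- 2 * real v) * (\<rho> powr (1 / (8 * real k)) * exp (real v))"
    proof (intro mult_left_mono)
      have "real v powr (1 / (8 * real k)) \<le> real v powr 1"
        using v k by (intro powr_mono) auto
      also have "real v powr 1 = real v" by simp
      also have "real v \<le> exp (real v)" using exp_ge_add_one_self[of "real v"] by linarith
      finally show "real v powr (1 / (8 * real k)) \<le> exp (real v)" .
    qed auto
    also have "\<dots> = exp (- real v) * \<rho> powr (1 / (8 * real k))"
    proof -
      have "exp (- 2 * real v) * exp (real v) = exp (- real v)" by (simp add: exp_add[symmetric])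
      then show ?thesis by (simp add: mult_ac)
    qed
    also have "\<dots> \<le> (1 / 2) ^ v * \<rho> powr (1 / (8 * real k))"
    proof (intro mult_right_mono)
      have "exp (- real v) = exp (- 1) ^ v" by (simp add: exp_of_nat_mult[symmetric])
      also have "\<dots> \<le> (1 / 2) ^ v"
      proof (intro power_mono)
        have "(2 :: real) \<le> exp 1" using exp_ge_add_one_self[of "1 :: real"] by simp
        then show "exp (- 1) \<le> (1 / 2 :: real)" by (simp add: exp_minus field_simps)
      qed simp
      finally show "exp (- real v) \<le> (1 / 2) ^ v" .
    qed simp
    finally show ?thesis .
  qed
  have fin_sub: "finite (sub v)" for v using V by (simp add: sub_def)
  have "?P {f. \<exists>X\<subseteq>V. card X \<le> M \<and>
        8 * real k * ln \<Delta> * real_of_int (potential t {e. e \<subseteq> V \<and> card e = k \<and> f e \<noteq> None} X) < real (card X)}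
      \<le> ?P (\<Union>v\<in>{1..M}. \<Union>X\<in>sub v. bad X)"
  proof (intro measure_pmf.finite_measure_mono subsetI)
    fix f :: "'v set \<Rightarrow> 'a option" assume "f \<in> {f. \<exists>X\<subseteq>V. card X \<le> M \<and>
        8 * real k * ln \<Delta> * real_of_int (potential t {e. e \<subseteq> V \<and> card e = k \<and> f e \<noteq> None} X) < real (card X)}"
    then obtain X where X: "X \<subseteq> V" "card X \<le> M" "f \<in> bad X" by (auto simp: bad_def)
    have "X \<noteq> {}" using X(3) by (auto simp: bad_def potential_def excess_def)
    then have "card X \<in> {1..M}"
      using X(2) finite_subset[OF X(1) V] by (simp add: card_gt_0_iff Suc_le_eq)
    then show "f \<in> (\<Union>v\<in>{1..M}. \<Union>X\<in>sub v. bad X)"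
      using X by (intro UN_I[of "card X"] UN_I[of X]) (auto simp: sub_def)
  qed auto
  also have "\<dots> \<le> (\<Sum>v\<in>{1..M}. ?P (\<Union>X\<in>sub v. bad X))"
    by (intro measure_pmf.finite_measure_subadditive_finite) auto
  also have "\<dots> \<le> (\<Sum>v\<in>{1..M}. \<Sum>X\<in>sub v. ?P (bad X))"
    using fin_sub by (intro sum_mono measure_pmf.finite_measure_subadditive_finite) auto
  also have "\<dots> \<le> (\<Sum>v\<in>{1..M}. (1 / 2) ^ v * \<rho> powr (1 / (8 * real k)))"
    by (intro sum_mono level)
  also have "\<dots> = (\<Sum>v\<in>{1..M}. (1 / 2) ^ v) * \<rho> powr (1 / (8 * real k))"
    by (simp add: sum_distrib_right)
  also have "\<dots> \<le> 1 * \<rho> powr (1 / (8 * real k))"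
  proof (intro mult_right_mono)
    have "(\<Sum>v\<in>{1..M}. (1 / 2 :: real) ^ v) = 1 - (1 / 2) ^ M"
      by (induction M) auto
    then show "(\<Sum>v\<in>{1..M}. (1 / 2 :: real) ^ v) \<le> 1" by simp
  qed simp
  finally show ?thesis by (simp add: \<rho>_def n_def)
qed

section \<open>The theorem\<close>

lemma mdeg_single_mult:
  fixes q :: "('x) mpoly"
  assumes "q \<noteq> 0"
  shows "tdeg s \<le> mdeg (Poly_Mapping.single s 1 * q)"
proof -
  obtain m where m: "m \<in> Poly_Mapping.keys q" using assms by (metis keys_eq_empty ex_in_conv)
  have "Poly_Mapping.lookup (Poly_Mapping.single s 1 * q) (s + m) = Poly_Mapping.lookup q m"
    using m by (simp add: lookup_single_mult)
  then have "s + m \<in> Poly_Mapping.keys (Poly_Mapping.single s 1 * q)"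
    using m by (simp add: in_keys_iff)
  then have "tdeg (s + m) \<le> mdeg (Poly_Mapping.single s 1 * q)" by (rule tdeg_le_mdeg)
  then show ?thesis by (simp add: tdeg_add)
qed

text \<open>
  In degree \<open>1\<close> the value of the functional on monomials of degree at least \<open>2\<close> is
  unconstrained, so it can be scaled to give any polynomial of positive degree-\<open>2\<close> mass the value \<open>1\<close>.
\<close>

lemma pseudo_distribution_degree_one:
  fixes p :: "('v \<times> 'd) mpoly"
  assumes D: "finite D" "D \<noteq> {}"
    and p: "Poly_Mapping.lookup p 0 = 0" and mass: "lin_ext (\<lambda>m. if 2 \<le> tdeg m then 1 else 0) p \<noteq> 0"
  shows "\<exists>E. pseudo_distribution V D 1 E \<and> E p = 1"
proof -
  define N where "N = lin_ext (\<lambda>m. if 2 \<le> tdeg m then 1 else 0) p"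
  define e where "e = (\<lambda>m :: 'v \<times> 'd \<Rightarrow>\<^sub>0 nat. if m = 0 then 1 else (if 2 \<le> tdeg m then 1 else 0) / N)"
  have "lin_ext e p = (\<Sum>m\<in>Poly_Mapping.keys p. Poly_Mapping.lookup p m * (if 2 \<le> tdeg m then 1 else 0)) / N"
    unfolding lin_ext_def sum_divide_distrib using p
    by (intro sum.cong) (auto simp: e_def in_keys_iff)
  then have val: "lin_ext e p = 1" using mass by (simp add: N_def lin_ext_def)
  have "pseudo_distribution V D 1 (lin_ext e)"
    unfolding pseudo_distribution_def
  proof (intro conjI allI impI ballI)
    show "lin_ext e (p + q) = lin_ext e p + lin_ext e q" for p q by (rule lin_ext_add)
    show "lin_ext e (mconst a * p) = a * lin_ext e p" for a p by (rule lin_ext_mconst)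
    show "lin_ext e 1 = 1" by (simp add: e_def single_one[symmetric] del: single_one)
  next
    fix q :: "('v \<times> 'd) mpoly" assume "mvars q \<subseteq> V \<times> D \<and> 2 * mdeg q \<le> 1"
    \<comment> \<open>2 * mdeg q is even, so q is a constant and its square is an honest
      one.\<close>
    then have deg: "mdeg q = 0" by auto
    have zero: "m = 0" if "m \<in> Poly_Mapping.keys q" for m
    proof -
      have "tdeg m = 0" using tdeg_le_mdeg[OF that] deg by simp
      then have "Poly_Mapping.lookup m x = 0" for x
        by (cases x) (auto simp: tdeg_def in_keys_iff)
      then show ?thesis by (intro poly_mapping_eqI) simp
    qed
    have "e (m + m') = 1" if "m \<in> Poly_Mapping.keys q" "m' \<in> Poly_Mapping.keys q" for m m'
      using zero[OF that(1)] zero[OF that(2)] by (simp add: e_def)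
    then have "lin_ext e (q\<^sup>2) = (\<Sum>m\<in>Poly_Mapping.keys q. \<Sum>m'\<in>Poly_Mapping.keys q.
        Poly_Mapping.lookup q m * Poly_Mapping.lookup q m')"
      unfolding power2_eq_square lin_ext_mult by (intro sum.cong refl) simp
    also have "\<dots> = (\<Sum>m\<in>Poly_Mapping.keys q. Poly_Mapping.lookup q m)\<^sup>2"
      by (simp add: power2_eq_square sum_product)
    finally show "0 \<le> lin_ext e (q\<^sup>2)" by simp
  next
    fix h q :: "('v \<times> 'd) mpoly"
    assume h: "h \<in> assignment_axioms V D" and q: "mvars q \<subseteq> V \<times> D \<and> mdeg (h * q) \<le> 1"
    \<comment> \<open>The generators have degree 2 and leading terms do not cancel, so a nonzero
      multiple has degree at least 2.\<close>
    have "q = 0"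
    proof (rule ccontr)
      assume ne: "q \<noteq> 0"
      from h consider (one) v where "h = (\<Sum>a\<in>D. (mvar (v, a))\<^sup>2) - 1"
        | (two) v a a' where "h = mvar (v, a) * mvar (v, a')"
        by (auto simp: assignment_axioms_def)
      then show False
      proof cases
        case one
        obtain a0 where "a0 \<in> D" using D by auto
        then show False using mdeg_assignment_mult[OF D(1) _ ne, of a0 v] one q by simp
      next
        case two
        then show False
          using mdeg_single_mult[OF ne, of "Poly_Mapping.single (v, a) 1 + Poly_Mapping.single (v, a') 1"] q
          by (simp add: mvar_def mult_single tdeg_add)
      qed
    qed
    then show "lin_ext e (h * q) = 0" by simp
  qed
  then show ?thesis using val by blast
qed

text \<open>Every monomial of the objective has degree k \<ge> 2 and a positive coefficient, so the
  mass to be rescaled is positive; relations are nonempty because each carries a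
  distribution.\<close>

lemma degree_one_instance:
  fixes V :: "'v set" and f :: "'v set \<Rightarrow> ('v, 'd) csp_constraint option"
  assumes csp: "is_csp k D Rs" "twise_independent_csp t k D Rs" and k: "2 \<le> k"
    and C: "finite C" "C \<noteq> {}"
    and f: "\<And>e. e \<in> C \<Longrightarrow> \<exists>\<sigma> R. f e = Some (\<sigma>, R) \<and> R \<in> Rs"
  shows "\<exists>E. pseudo_distribution V D 1 E \<and>
    E (val_poly k (V, image_mset (\<lambda>e. the (f e)) (mset_set C))) = 1"
proof -
  let ?p = "val_poly k (V, image_mset (\<lambda>e. the (f e)) (mset_set C))"
  obtain \<sigma> R where \<sigma>R: "\<And>e. e \<in> C \<Longrightarrow> f e = Some (\<sigma> e, R e) \<and> R e \<in> Rs" using f by metis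
  have finD: "finite D" using csp(1) by (simp add: is_csp_def)
  have D: "D \<noteq> {}"
    using csp(2) set_pmf_not_empty by (fastforce simp: twise_independent_csp_def)
  have R: "finite (R e)" "R e \<noteq> {}" if e: "e \<in> C" for e
  proof -
    have "R e \<subseteq> {1..k} \<rightarrow>\<^sub>E D" using csp(1) \<sigma>R[OF e] by (auto simp: is_csp_def)
    moreover have "finite ({1..k} \<rightarrow>\<^sub>E D)" using finD by (intro finite_PiE) auto
    ultimately show "finite (R e)" by (rule finite_subset)
    obtain \<mu> where "set_pmf \<mu> \<subseteq> R e"
      using csp(2) \<sigma>R[OF e] unfolding twise_independent_csp_def by blast
    then show "R e \<noteq> {}" using set_pmf_not_empty[of \<mu>] by auto
  qed
  define m where "m = (\<lambda>e (b :: nat \<Rightarrow> 'd). \<Sum>i=1..k. Poly_Mapping.single (\<sigma> e i, b i) (1::nat))"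
  have tdeg_m: "tdeg (m e b) = k" for e b
  proof -
    have "tdeg (\<Sum>i\<in>I. Poly_Mapping.single (\<sigma> e i, b i) (1::nat)) = card I" if "finite I" for I
      using that by (induction I rule: finite_induct) (auto simp: tdeg_add tdeg_def[of 0])
    then show ?thesis by (simp add: m_def)
  qed
  have p: "?p = mconst (1 / real (card C)) * (\<Sum>e\<in>C. \<Sum>b\<in>R e. Poly_Mapping.single (m e b) 1)"
  proof -
    have "(\<Sum>(\<sigma>, R)\<in>#image_mset (\<lambda>e. the (f e)) (mset_set C). \<Sum>b\<in>R. \<Prod>i=1..k. mvar (\<sigma> i, b i)) =
      (\<Sum>e\<in>C. case the (f e) of (\<sigma>, R) \<Rightarrow> \<Sum>b\<in>R. \<Prod>i=1..k. mvar (\<sigma> i, b i))"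
      by (simp add: sum_unfold_sum_mset multiset.map_comp comp_def)
    also have "\<dots> = (\<Sum>e\<in>C. \<Sum>b\<in>R e. \<Prod>i=1..k. mvar (\<sigma> e i, b i))"
      using \<sigma>R by (intro sum.cong) auto
    finally show ?thesis by (simp add: val_poly_def prod_mvar m_def)
  qed
  have "lin_ext (\<lambda>m. if 2 \<le> tdeg m then 1 else 0) ?p = (\<Sum>e\<in>C. real (card (R e))) / real (card C)"
    using k unfolding p by (simp add: lin_ext_mconst lin_ext_sum tdeg_m)
  moreover have "(\<Sum>e\<in>C. real (card (R e))) > 0"
    using C R by (intro sum_pos) (auto simp: card_gt_0_iff)
  ultimately have mass: "lin_ext (\<lambda>m. if 2 \<le> tdeg m then 1 else 0) ?p \<noteq> 0"
    using C by (simp add: card_gt_0_iff)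
  have "lin_ext (\<lambda>m. if m = 0 then 1 else 0) ?p = 0"
  proof -
    have "m e b \<noteq> 0" for e b using tdeg_m[of e b] k by (auto simp: tdeg_def)
    then show ?thesis unfolding p by (simp add: lin_ext_mconst lin_ext_sum)
  qed
  then have "Poly_Mapping.lookup ?p 0 = 0"
    by (simp add: lin_ext_def if_distrib[of "\<lambda>x. _ * x"] cong: if_cong) (auto simp: in_keys_iff split: if_splits)
  then show ?thesis using pseudo_distribution_degree_one[OF finD D _ mass] by blast
qed


section \<open>Random edges and the choice of parameters\<close>

definition edge_pmf :: "nat \<Rightarrow> (nat \<Rightarrow> 'd) set pmf \<Rightarrow> real \<Rightarrow> 'v set \<Rightarrow> ('v, 'd) csp_constraint option pmf" where
  "edge_pmf k \<rho> p e = bind_pmf (bernoulli_pmf p)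
     (\<lambda>selected. if selected then map_pmf Some (random_constraint k \<rho> e) else return_pmf None)"

lemma pmf_edge_None:
  assumes "0 \<le> p" "p \<le> 1"
  shows "pmf (edge_pmf k \<rho> p e) None = 1 - p"
proof -
  have "pmf (map_pmf Some (random_constraint k \<rho> e)) None = 0"
    by (simp add: pmf_eq_0_set_pmf)
  then show ?thesis using assms by (simp add: edge_pmf_def pmf_bind)
qed

lemma edge_support:
  assumes "f \<in> set_pmf (edge_pmf k \<rho> p e)" "f \<noteq> None" "finite e" "card e = k"
  shows "\<exists>\<sigma> R. f = Some (\<sigma>, R) \<and> bij_betw \<sigma> {1..k} e \<and> R \<in> set_pmf \<rho>"
proof -
  let ?S = "{\<sigma> \<in> {1..k} \<rightarrow>\<^sub>E e. bij_betw \<sigma> {1..k} e}"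
  have "finite ({1..k} \<rightarrow>\<^sub>E e)" using assms by (intro finite_PiE) auto
  then have fin: "finite ?S" by simp
  obtain h where h: "bij_betw h {1..k} e"
    using ex_bij_betw_nat_finite_1[OF assms(3)] assms(4) by auto
  have "bij_betw (restrict h {1..k}) {1..k} e \<longleftrightarrow> bij_betw h {1..k} e"
    by (rule bij_betw_cong) auto
  then have "restrict h {1..k} \<in> ?S" using h by (auto simp: bij_betw_def)
  then have "?S \<noteq> {}" by blast
  then have set: "set_pmf (pmf_of_set ?S) = ?S" using fin by (rule set_pmf_of_set)
  have "f \<in> Some ` set_pmf (random_constraint k \<rho> e)"
    using assms(1,2) by (auto simp: edge_pmf_def split: if_splits)
  then show ?thesis unfolding random_constraint_def set_pair_pmf set by auto
qed

lemma solvable_instance: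
  fixes V :: "'v set" and f :: "'v set \<Rightarrow> ('v, 'd) csp_constraint option" and x \<Delta> :: real
  assumes csp: "is_csp k D Rs" "twise_independent_csp t k D Rs" and t: "2 \<le> t" "t \<le> k"
    and V: "finite V" and \<Delta>: "2 \<le> \<Delta>"
    and C: "C = {e. e \<subseteq> V \<and> card e = k \<and> f e \<noteq> None}" "C \<noteq> {}"
    and f: "\<And>e. e \<in> C \<Longrightarrow> \<exists>\<sigma> R. f e = Some (\<sigma>, R) \<and> bij_betw \<sigma> {1..k} e \<and> R \<in> Rs"
    and pl: "x \<le> 1 \<or> (\<forall>X\<subseteq>V. card X \<le> nat \<lceil>32 * real k * ln \<Delta> * real (k * nat \<lceil>x\<rceil>)\<rceil> \<longrightarrow>
      real (card X) \<le> 8 * real k * ln \<Delta> * real_of_int (potential t C X))"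
  shows "\<exists>d E. x \<le> real d \<and> pseudo_distribution V D d E \<and>
    E (val_poly k (V, image_mset (\<lambda>e. the (f e)) (mset_set C))) = 1"
proof (cases "x \<le> 1")
  case True
  have "finite C" using V by (auto simp: C)
  then have "\<exists>E. pseudo_distribution V D 1 E \<and>
      E (val_poly k (V, image_mset (\<lambda>e. the (f e)) (mset_set C))) = 1"
    using t f by (intro degree_one_instance[OF csp _ _ C(2)]) (auto, blast)
  then show ?thesis using True by (intro exI[of _ 1]) auto
next
  case False
  \<comment> \<open>The factor k makes the degree at least k, as the objective requires, at the cost
    of a constant depending on k. M is 4 * L * d for L = 8 k ln \<Delta>, rounded up.\<close>
  define d where "d = k * nat \<lceil>x\<rceil>"
  define M where "M = nat \<lceil>32 * real k * ln \<Delta> * real d\<rceil>"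
  have ln2: "2 / 3 \<le> ln \<Delta>"
    using ln2_ge_two_thirds \<Delta> ln_le_cancel_iff[of 2 \<Delta>] by linarith
  have c1: "1 \<le> nat \<lceil>x\<rceil>" using False by (simp add: Suc_le_eq)
  have kd: "k \<le> d" using c1 by (simp add: d_def)
  have L: "1 \<le> 8 * real k * ln \<Delta>"
  proof -
    have "1 \<le> 8 * (2 :: real) * (2 / 3)" by simp
    also have "\<dots> \<le> 8 * real k * ln \<Delta>" using t ln2 by (intro mult_mono) auto
    finally show ?thesis .
  qed
  have M4: "4 * (8 * real k * ln \<Delta>) * real d \<le> real M"
    unfolding M_def using real_nat_ceiling_ge[of "32 * real k * ln \<Delta> * real d"] by simp
  have "1 * real d \<le> 4 * (8 * real k * ln \<Delta>) * real d" using L by (intro mult_right_mono) auto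
  then have dM: "d \<le> M" using M4 by linarith
  have xd: "x \<le> real d"
  proof -
    have "x \<le> real (nat \<lceil>x\<rceil>)" by (rule real_nat_ceiling_ge)
    also have "1 * nat \<lceil>x\<rceil> \<le> d" unfolding d_def using t by (intro mult_right_mono) auto
    then have "real (nat \<lceil>x\<rceil>) \<le> real d" by simp
    finally show ?thesis .
  qed
  have "\<exists>E. pseudo_distribution V D d E \<and>
      E (val_poly k (V, image_mset (\<lambda>e. the (f e)) (mset_set C))) = 1"
    using pl False L t M4 kd dM
    by (intro plausible_instance_pseudo_distribution[OF csp _ _ V C f, where M = M and L = "8 * real k * ln \<Delta>"])
       (auto simp: M_def d_def)
  then show ?thesis using xd by blast
qed

text \<open>Both ceilings are applied to numbers of at least 1 and lose at most a factor 2 each,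
  whence 128 = 4 * 32. One factor k stems from L, the other from rounding the degree to a multiple
  of k.\<close>

lemma degree_budget:
  fixes n k t :: nat and \<Delta> c x :: real
  assumes t: "2 \<le> t" "t \<le> k" and \<Delta>: "2 \<le> \<Delta>" and c: "c = r / (128 * real k ^ 2)" "0 < r"
    and x: "x = c * real n / (\<Delta> powr (2 / (real t - 1)) * ln \<Delta>)" "1 < x"
  shows "\<Delta> powr (2 / (real t - 1)) * real (nat \<lceil>32 * real k * ln \<Delta> * real (k * nat \<lceil>x\<rceil>)\<rceil>) \<le> r * real n"
proof -
  have ln2: "2 / 3 \<le> ln \<Delta>"
    using ln2_ge_two_thirds \<Delta> ln_le_cancel_iff[of 2 \<Delta>] by linarith
  define z where "z = 32 * real k * ln \<Delta> * real (k * nat \<lceil>x\<rceil>)"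
  have "real (nat \<lceil>x\<rceil>) \<le> 2 * x" using x(2) by linarith
  then have z1: "z \<le> 32 * real k * ln \<Delta> * (real k * (2 * x))"
    unfolding z_def of_nat_mult using ln2 by (intro mult_left_mono) auto
  have "1 \<le> 32 * (1 :: real) * (2 / 3) * (1 * 1)" by simp
  also have "\<dots> \<le> 32 * real k * ln \<Delta> * (real k * real (nat \<lceil>x\<rceil>))"
    using t ln2 x(2) by (intro mult_mono) auto
  finally have "1 \<le> z" by (simp add: z_def)
  then have "real (nat \<lceil>z\<rceil>) \<le> 2 * z" by linarith
  also have "\<dots> \<le> 128 * real k ^ 2 * (ln \<Delta> * x)"
    using z1 by (simp add: power2_eq_square mult_ac)
  finally have "\<Delta> powr (2 / (real t - 1)) * real (nat \<lceil>z\<rceil>) \<le>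
      \<Delta> powr (2 / (real t - 1)) * (128 * real k ^ 2 * (ln \<Delta> * x))"
    by (intro mult_left_mono) auto
  also have "\<dots> = r * real n"
  proof -
    have "\<Delta> powr (2 / (real t - 1)) * (ln \<Delta> * x) = c * real n"
      using \<Delta> ln2 unfolding x(1) by simp
    then have "128 * real k ^ 2 * (\<Delta> powr (2 / (real t - 1)) * (ln \<Delta> * x)) = 128 * real k ^ 2 * (c * real n)"
      by simp
    also have "\<dots> = r * real n" using t by (simp add: c)
    finally show ?thesis by (simp add: mult_ac)
  qed
  finally show ?thesis by (simp add: z_def)
qed

text \<open>
  Either \<open>\<Delta> \<le> ln n\<close>, or the assumption \<open>1 < x\<close> itself bounds the ratio by \<open>c / ln \<Delta>\<close>.
\<close>

lemma ratio_small:
  fixes n t :: nat and \<Delta> c x :: real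
  assumes t: "2 \<le> t" and \<Delta>: "2 \<le> \<Delta>" and c: "0 < c" and n: "exp 1 < ln (real n)" "0 < n"
    and x: "x = c * real n / (\<Delta> powr (2 / (real t - 1)) * ln \<Delta>)" "1 < x"
  shows "\<Delta> powr (2 / (real t - 1)) / real n \<le> (ln (real n))\<^sup>2 / real n + c / ln (ln (real n))"
proof -
  have ln0: "0 < ln \<Delta>" using \<Delta> by simp
  have lnn: "0 < ln (real n)" using n exp_gt_zero[of 1] by linarith
  have "1 < ln (ln (real n))"
    using n lnn ln_less_cancel_iff[of "exp 1" "ln (real n)"] by simp
  then have lnln: "0 < ln (ln (real n))" by linarith
  show ?thesis
  proof (cases "\<Delta> \<le> ln (real n)")
    case True
    have "\<Delta> powr (2 / (real t - 1)) \<le> \<Delta> powr 2"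
      using \<Delta> t by (intro powr_mono) (auto simp: field_simps)
    also have "\<dots> \<le> (ln (real n))\<^sup>2" using \<Delta> True by (simp add: power_mono)
    finally have "\<Delta> powr (2 / (real t - 1)) / real n \<le> (ln (real n))\<^sup>2 / real n"
      by (intro divide_right_mono) auto
    moreover have "0 \<le> c / ln (ln (real n))" using c lnln by simp
    ultimately show ?thesis by linarith
  next
    case False
    have "ln (ln (real n)) \<le> ln \<Delta>" using False lnn by simp
    then have "c / ln \<Delta> \<le> c / ln (ln (real n))" using c lnln ln0 by (intro divide_left_mono) auto
    moreover have "\<Delta> powr (2 / (real t - 1)) / real n \<le> c / ln \<Delta>"
    proof -
      have pos: "0 < \<Delta> powr (2 / (real t - 1)) * ln \<Delta>" using \<Delta> ln0 by simp
      have "1 < c * real n / (\<Delta> powr (2 / (real t - 1)) * ln \<Delta>)" using x by simp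
      then have "\<Delta> powr (2 / (real t - 1)) * ln \<Delta> < c * real n"
        using pos by (simp add: pos_less_divide_eq)
      then show ?thesis using ln0 n by (simp add: field_simps)
    qed
    moreover have "0 \<le> (ln (real n))\<^sup>2 / real n" by simp
    ultimately show ?thesis by linarith
  qed
qed

text \<open>An instance without constraints has the zero polynomial as objective (1 / 0 = 0) and
  never reaches value 1, so it is a bad event of its own. For x > 1 the other one is failure of
  plausibility; for x \<le> 1 the functional of degree one needs no plausibility.\<close>

lemma unsolvable_prob:
  fixes n k t :: nat and D :: "'d set" and \<Delta> c :: real
  assumes csp: "is_csp k D Rs" "twise_independent_csp t k D Rs" "set_pmf \<rho> \<subseteq> Rs"
    and t: "2 \<le> t" "t \<le> k" and \<Delta>: "2 \<le> \<Delta>" "\<Delta> * real n \<le> real (n choose k)"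
    and n: "k \<le> n" "exp 1 < ln (real n)"
    and c: "c = exp (- 8 * real k * (4 + real (k + 1) * real k ^ k)) / (128 * real k ^ 2)"
  shows "measure_pmf.prob (random_instance k \<rho> (\<Delta> * real n / real (n choose k)) {1..n})
      {I. \<not> (\<exists>d E. real d \<ge> c * real n / (\<Delta> powr (2 / (real t - 1)) * ln \<Delta>) \<and>
        pseudo_distribution (fst I) D d E \<and> E (val_poly k I) = 1)}
    \<le> exp (- real n) + ((ln (real n))\<^sup>2 / real n + c / ln (ln (real n))) powr (1 / (8 * real k))"
proof -
  define V where "V = {1..n}"
  define K where "K = {e. e \<subseteq> V \<and> card e = k}"
  define p where "p = \<Delta> * real n / real (n choose k)"
  define x where "x = c * real n / (\<Delta> powr (2 / (real t - 1)) * ln \<Delta>)"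
  define sel where "sel = (\<lambda>f :: nat set \<Rightarrow> (nat, 'd) csp_constraint option. {e. e \<subseteq> V \<and> card e = k \<and> f e \<noteq> None})"
  define g where "g = (\<lambda>f. (V, image_mset (\<lambda>e. the (f e)) (mset_set (sel f))))"
  define M where "M = nat \<lceil>32 * real k * ln \<Delta> * real (k * nat \<lceil>x\<rceil>)\<rceil>"
  define bad where "bad = {I :: (nat, 'd) csp_instance. \<not> (\<exists>d E. x \<le> real d \<and> pseudo_distribution (fst I) D d E \<and> E (val_poly k I) = 1)}"
  define none where "none = {f. sel f = {}}"
  define implaus where "implaus = (if x \<le> 1 then {} else {f. \<exists>X\<subseteq>V. card X \<le> M \<and>
      8 * real k * ln \<Delta> * real_of_int (potential t (sel f) X) < real (card X)})"
  let ?W = "Pi_pmf K None (edge_pmf k \<rho> p)"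
  have V: "finite V" "card V = n" by (auto simp: V_def)
  have finK: "finite K" using V by (simp add: K_def)
  have cardK: "card K = n choose k" using V by (simp add: K_def n_subsets)
  have k2: "2 \<le> k" using t by simp
  have n0: "0 < n" using n k2 by simp
  have choose0: "0 < real (n choose k)" using n by simp
  have c0: "c > 0" using k2 by (simp add: c)
  have p: "0 \<le> p" "p \<le> 1" using \<Delta> choose0 by (auto simp: p_def)
  have None: "pmf (edge_pmf k \<rho> p e) None = 1 - p" for e :: "nat set"
    by (rule pmf_edge_None[OF p])
  have inst: "random_instance k \<rho> p V = map_pmf g ?W"
    by (simp add: random_instance_def edge_pmf_def[abs_def] g_def sel_def K_def)
  have "g -` bad \<inter> set_pmf ?W \<subseteq> none \<union> implaus"
  proof
    fix f assume f: "f \<in> g -` bad \<inter> set_pmf ?W"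
    show "f \<in> none \<union> implaus"
    proof (rule ccontr)
      assume "f \<notin> none \<union> implaus"
      then have ne: "sel f \<noteq> {}" and pl: "x \<le> 1 \<or> (\<forall>X\<subseteq>V. card X \<le> M \<longrightarrow>
          real (card X) \<le> 8 * real k * ln \<Delta> * real_of_int (potential t (sel f) X))"
        by (auto simp: none_def implaus_def not_less split: if_splits)
      have edge: "\<exists>\<sigma> R. f e = Some (\<sigma>, R) \<and> bij_betw \<sigma> {1..k} e \<and> R \<in> Rs" if e: "e \<in> sel f" for e
      proof -
        have e': "e \<in> K" "f e \<noteq> None" "card e = k" "finite e"
          using e V finite_subset by (auto simp: sel_def K_def)
        have "f \<in> PiE_dflt K None (set_pmf \<circ> edge_pmf k \<rho> p)"
          using f set_Pi_pmf_subset'[OF finK, of None "edge_pmf k \<rho> p"] by (meson IntD2 subsetD)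
        then have "f e \<in> set_pmf (edge_pmf k \<rho> p e)" using e' by (auto simp: PiE_dflt_def)
        from edge_support[OF this e'(2,4,3)] show ?thesis using csp(3) by blast
      qed
      have "\<exists>d E. x \<le> real d \<and> pseudo_distribution V D d E \<and>
          E (val_poly k (V, image_mset (\<lambda>e. the (f e)) (mset_set (sel f)))) = 1"
        by (rule solvable_instance[OF csp(1,2) t V(1) \<Delta>(1) _ ne edge pl[unfolded M_def]])
           (simp_all add: sel_def)
      then show False using f by (auto simp: bad_def g_def)
    qed
  qed
  \<comment> \<open>Only the support counts: outside it an edge may carry a constraint that does not
    fit the edge or the relations.\<close>
  then have "measure_pmf.prob ?W (g -` bad \<inter> set_pmf ?W) \<le> measure_pmf.prob ?W (none \<union> implaus)"
    by (intro measure_pmf.finite_measure_mono) auto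
  also have "\<dots> \<le> measure_pmf.prob ?W none + measure_pmf.prob ?W implaus"
    by (rule measure_Un_le) auto
  finally have union: "measure_pmf.prob ?W (g -` bad) \<le> measure_pmf.prob ?W none + measure_pmf.prob ?W implaus"
    by (simp add: measure_Int_set_pmf)
  have none_prob: "measure_pmf.prob ?W none \<le> exp (- real n)"
  proof -
    have "none = Pi K (\<lambda>_. {None})"
    proof (rule set_eqI)
      fix f
      have "f \<in> none \<longleftrightarrow> (\<forall>e. \<not> (e \<subseteq> V \<and> card e = k \<and> f e \<noteq> None))"
        by (simp only: none_def sel_def mem_Collect_eq Collect_empty_eq)
      also have "\<dots> \<longleftrightarrow> (\<forall>e\<in>K. f e = None)"
        unfolding K_def Ball_def mem_Collect_eq by metis
      finally show "f \<in> none \<longleftrightarrow> f \<in> Pi K (\<lambda>_. {None})"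
        by (simp only: Pi_iff singleton_iff)
    qed
    then have "measure_pmf.prob ?W none = (\<Prod>e\<in>K. measure_pmf.prob (edge_pmf k \<rho> p e) {None})"
      using measure_Pi_pmf_Pi[OF finK] by simp
    also have "\<dots> = (1 - p) ^ (n choose k)"
      by (simp add: measure_pmf_single None cardK)
    also have "\<dots> \<le> exp (- p) ^ (n choose k)"
      using p exp_ge_add_one_self[of "- p"] by (intro power_mono) auto
    also have "\<dots> = exp (- (\<Delta> * real n))"
      using choose0 by (simp add: exp_of_nat_mult[symmetric] p_def)
    also have "\<dots> \<le> exp (- real n)" using \<Delta> by (simp add: mult_le_cancel_right1)
    finally show ?thesis .
  qed
  have implaus_prob: "measure_pmf.prob ?W implaus \<le>
      ((ln (real n))\<^sup>2 / real n + c / ln (ln (real n))) powr (1 / (8 * real k))"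
  proof (cases "x \<le> 1")
    case True
    then show ?thesis by (simp add: implaus_def)
  next
    case False
    have "measure_pmf.prob ?W implaus \<le> (\<Delta> powr (2 / (real t - 1)) / real (card V)) powr (1 / (8 * real k))"
    proof -
      have eq: "implaus = {f. \<exists>X\<subseteq>V. card X \<le> M \<and>
          8 * real k * ln \<Delta> * real_of_int (potential t {e. e \<subseteq> V \<and> card e = k \<and> f e \<noteq> None} X) < real (card X)}"
        using False by (simp only: implaus_def sel_def if_False)
      have budget: "\<Delta> powr (2 / (real t - 1)) * real M
          \<le> exp (- 8 * real k * (4 + real (k + 1) * real k ^ k)) * real (card V)"
        unfolding M_def V(2) using degree_budget[OF t \<Delta>(1) c _ x_def] False by simp
      show ?thesis
        unfolding K_def eq
        by (rule implausible_prob[OF V(1) k2 _ t \<Delta>(1) _ budget]) (use V(2) n None in \<open>simp_all add: p_def\<close>)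
    qed
    also have "\<dots> \<le> ((ln (real n))\<^sup>2 / real n + c / ln (ln (real n))) powr (1 / (8 * real k))"
      using ratio_small[OF t(1) \<Delta>(1) c0 n(2) n0 x_def] False V(2) by (intro powr_mono2) auto
    finally show ?thesis .
  qed
  have "measure_pmf.prob ?W (g -` bad) \<le>
      exp (- real n) + ((ln (real n))\<^sup>2 / real n + c / ln (ln (real n))) powr (1 / (8 * real k))"
    using union none_prob implaus_prob by linarith
  then show ?thesis
    unfolding p_def[symmetric] V_def[symmetric] x_def[symmetric] inst measure_map_pmf bad_def .
qed

text \<open>The eventual conditions on \<Delta> keep \<open>ln (\<Delta> n)\<close> away from 0 and
  the selection probability at most 1.\<close>

theorem theorem1p1:
  fixes k :: nat
  shows "\<exists>c::real. c > 0 \<and>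
    (\<forall>(t::nat) (D::nat set) (Rs::(nat \<Rightarrow> nat) set set) (\<rho>::(nat \<Rightarrow> nat) set pmf)
        (\<Delta>::nat \<Rightarrow> real).
      2 \<le> t \<and> t \<le> k \<and> is_csp k D Rs \<and> twise_independent_csp t k D Rs \<and> set_pmf \<rho> \<subseteq> Rs \<and>
      (\<forall>\<^sub>F n in sequentially. 2 \<le> \<Delta> n \<and> \<Delta> n * real n \<le> real (n choose k))
      \<longrightarrow>
      (\<lambda>n. measure_pmf.prob
             (random_instance k \<rho> (\<Delta> n * real n / real (n choose k)) {1..n})
             {I. \<not> (\<exists>d E.
                real d \<ge> c * real n / (\<Delta> n powr (2 / (real t - 1)) * ln (\<Delta> n)) \<and>
                pseudo_distribution (fst I) D d E \<and>
                E (val_poly k I) = 1)})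
        \<longlonglongrightarrow> 0)"
proof (cases "2 \<le> k")
  case False
  \<comment> \<open>No t satisfies 2 \<le> t \<le> k here.\<close>
  then show ?thesis by (intro exI[of _ 1]) auto
next
  case True
  \<comment> \<open>The numerator is the bound on u under which the union bound converges, with (k +
    1) k^k from the moment estimate; the denominator collects the losses of
    \<open>degree_budget\<close>. Both involve k only.\<close>
  define c where "c = exp (- 8 * real k * (4 + real (k + 1) * real k ^ k)) / (128 * real k ^ 2)"
  have c0: "c > 0" using True by (simp add: c_def)
  show ?thesis
  proof (intro exI[of _ c] conjI c0 allI impI, elim conjE)
    fix t :: nat and D :: "nat set" and Rs :: "(nat \<Rightarrow> nat) set set"
      and \<rho> :: "(nat \<Rightarrow> nat) set pmf" and \<Delta> :: "nat \<Rightarrow> real"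
    assume t: "2 \<le> t" "t \<le> k" and csp: "is_csp k D Rs" "twise_independent_csp t k D Rs" "set_pmf \<rho> \<subseteq> Rs"
      and ev: "\<forall>\<^sub>F n in sequentially. 2 \<le> \<Delta> n \<and> \<Delta> n * real n \<le> real (n choose k)"
    let ?b = "\<lambda>n. exp (- real n) + ((ln (real n))\<^sup>2 / real n + c / ln (ln (real n))) powr (1 / (8 * real k))"
    have "(\<lambda>n. (ln (real n))\<^sup>2 / real n + c / ln (ln (real n))) \<longlonglongrightarrow> 0"
      by real_asymp
    moreover have "\<forall>\<^sub>F n in sequentially. 0 \<le> (ln (real n))\<^sup>2 / real n + c / ln (ln (real n))"
      using c0 by real_asymp
    ultimately have "(\<lambda>n. ((ln (real n))\<^sup>2 / real n + c / ln (ln (real n))) powr (1 / (8 * real k))) \<longlonglongrightarrow> 0"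
      using True by (intro tendsto_zero_powrI[where b = "1 / (8 * real k)"] tendsto_const) auto
    moreover have "(\<lambda>n. exp (- real n)) \<longlonglongrightarrow> 0" by real_asymp
    ultimately have lim: "?b \<longlonglongrightarrow> 0" using tendsto_add by fastforce
    have big: "\<forall>\<^sub>F n in sequentially. exp 1 < ln (real n)" by real_asymp
    show "(\<lambda>n. measure_pmf.prob
             (random_instance k \<rho> (\<Delta> n * real n / real (n choose k)) {1..n})
             {I. \<not> (\<exists>d E.
                real d \<ge> c * real n / (\<Delta> n powr (2 / (real t - 1)) * ln (\<Delta> n)) \<and>
                pseudo_distribution (fst I) D d E \<and>
                E (val_poly k I) = 1)}) \<longlonglongrightarrow> 0"
    proof (rule tendsto_sandwich[OF _ _ tendsto_const lim])
      show "\<forall>\<^sub>F n in sequentially. measure_pmf.prob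
             (random_instance k \<rho> (\<Delta> n * real n / real (n choose k)) {1..n})
             {I. \<not> (\<exists>d E.
                real d \<ge> c * real n / (\<Delta> n powr (2 / (real t - 1)) * ln (\<Delta> n)) \<and>
                pseudo_distribution (fst I) D d E \<and>
                E (val_poly k I) = 1)} \<le> ?b n"
        using ev big eventually_ge_at_top[of k]
      proof eventually_elim
        case (elim n)
        then show ?case by (intro unsolvable_prob[OF csp t _ _ _ _ c_def]) auto
      qed
    qed simp
  qed
qed

end
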